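(* Let $d\ge1$, $0<\theta\le s\le1$ and $1\le p<\infty$ with $\frac1p=\frac{s-\theta}{2d}$. Then there exists a constant $C$ independent of $\hbar$ such that for every $\hbar>0$ and every compact operator $\rho$ on $L^2(\mathbb{R}^d)$, $$\|\rho\|_{\dot{\mathcal W}^{\theta,\infty}}\le C\,\|\rho\|_{\dot{\mathcal W}^{s,p}}.$$
   Context: $\hbar>0$, $h=2\pi\hbar$; operators act on $L^2(\mathbb{R}^d)$; $\|\rho\|_{\mathcal L^p}=h^{d/p}(\mathrm{Tr}|\rho|^p)^{1/p}$ for $p<\infty$ and $\|\cdot\|_{\mathcal L^\infty}$ is the operator norm. For a vector of operators $A=(A_1,\dots,A_n)$, $|A|=(\sum_kA_k^*A_k)^{1/2}$, $\|A\|_{\mathcal L^p}=h^{d/p}(\mathrm{Tr}|A|^p)^{1/p}$. Quantum gradient $\nabla\rho=([\nabla,\rho],[\frac{x}{i\hbar},\rho])$. For $z=(x_0,\xi_0)\in\mathbb{R}^{2d}$, $(\tau_z\varphi)(x)=e^{i\xi_0\cdot(x-x_0/2)/\hbar}\varphi(x-x_0)$, $\mathsf T_z\rho=\tau_z\rho\tau_z^*$. $\omega_a=2\pi^{a/2}/\Gamma(a/2)$, $\gamma_{s,p}=\frac{p|\omega_{-2s}|}{4\omega_{2d+sp}}\big(\frac{\pi\omega_{p+1}}{s^{(p-2)/2}}\big)^s$. Norms: $\|\rho\|_{\dot{\mathcal W}^{1,p}}=\|\nabla\rho\|_{\mathcal L^p}$; for $s\in(0,1)$, $\|\rho\|_{\dot{\mathcal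 W}^{s,p}}^p=\gamma_{s,p}h^d\int_{\mathbb{R}^{2d}}\frac{\mathrm{Tr}|\mathsf T_z\rho-\rho|^p}{|z|^{2d+sp}}dz$; for $\theta\in(0,1]$, $\|\rho\|_{\dot{\mathcal W}^{\theta,\infty}}=\sup_{z\in\mathbb{R}^{2d}}\frac{\|\mathsf T_z\rho-\rho\|_{\mathcal L^\infty}}{|z|^\theta}$. *)

theory Defs
  imports "HOL-Analysis.Analysis"
begin

text \<open>Functions on R^d (d = CARD('d)) with complex values; L^2 is represented by the
  set of square-integrable Borel functions, operators act on such functions and are
  required to respect a.e. equality (so they act on L^2 classes).\<close>

type_synonym 'd fn = "real^'d \<Rightarrow> complex"

definition L2 :: "'d::finite fn set" where
  "L2 = {f. f \<in> borel_measurable lborel \<and> integrable lborel (\<lambda>x. (cmod (f x))\<^sup>2)}"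

definition l2norm :: "'d::finite fn \<Rightarrow> real" where
  "l2norm f = sqrt (\<integral>x. (cmod (f x))\<^sup>2 \<partial>lborel)"

definition l2inner :: "'d::finite fn \<Rightarrow> 'd fn \<Rightarrow> complex" where
  "l2inner g f = (\<integral>x. cnj (g x) * f x \<partial>lborel)"

definition is_operator :: "('d::finite fn \<Rightarrow> 'd fn) \<Rightarrow> bool" where
  "is_operator A \<longleftrightarrow>
     (\<forall>f\<in>L2. A f \<in> L2) \<and>
     (\<forall>f\<in>L2. \<forall>g\<in>L2. (AE x in lborel. f x = g x) \<longrightarrow> (AE x in lborel. A f x = A g x)) \<and>
     (\<forall>f\<in>L2. \<forall>g\<in>L2. \<forall>a b. AE x in lborel.
         A (\<lambda>y. a * f y + b * g y) x = a * A f x + b * A g x)"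

definition compact_op :: "('d::finite fn \<Rightarrow> 'd fn) \<Rightarrow> bool" where
  "compact_op A \<longleftrightarrow> is_operator A \<and>
     (\<forall>F B. (\<forall>n. F n \<in> L2 \<and> l2norm (F n) \<le> B) \<longrightarrow>
        (\<exists>r::nat \<Rightarrow> nat. strict_mono r \<and>
           (\<forall>e>0. \<exists>N. \<forall>m\<ge>N. \<forall>n\<ge>N. l2norm (\<lambda>x. A (F (r m)) x - A (F (r n)) x) < e)))"

definition opnorm :: "('d::finite fn \<Rightarrow> 'd fn) \<Rightarrow> ennreal" where
  "opnorm A = (SUP f\<in>{f\<in>L2. l2norm f \<le> 1}. ennreal (l2norm (A f)))"

text \<open>Singular values (approximation numbers) of the column operator
  f \<mapsto> (A_k f)_{k\<in>I} : L^2 \<rightarrow> (L^2)^I, given through its sesquilinear form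
  B g f = \<Sum>_k <g_k, A_k f>, tested on f, g_k in the set D.
  s_m = inf over rank \<le> m operators F f = \<Sum>_{i<m} <u_i,f> v_i of ||A - F||.\<close>
definition sval :: "'i set \<Rightarrow> 'd::finite fn set \<Rightarrow> (('i \<Rightarrow> 'd fn) \<Rightarrow> 'd fn \<Rightarrow> complex)
                    \<Rightarrow> nat \<Rightarrow> ennreal" where
  "sval I D B m =
     (INF uv\<in>{(u, v). (\<forall>i<m. u i \<in> L2 \<and> (\<forall>k\<in>I. v i k \<in> L2))}.
       (SUP fg\<in>{(f, g). f \<in> D \<and> (\<forall>k\<in>I. g k \<in> D) \<and> l2norm f \<le> 1
                         \<and> (\<Sum>k\<in>I. (l2norm (g k))\<^sup>2) \<le> 1}.
          ennreal (cmod (B (snd fg) (fst fg)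
             - (\<Sum>i<m. l2inner (fst uv i) (fst fg) *
                        (\<Sum>k\<in>I. l2inner (snd fg k) (snd uv i k)))))))"

definition ennpowr :: "ennreal \<Rightarrow> real \<Rightarrow> ennreal" where
  "ennpowr t a = (if t = \<infinity> then \<infinity> else ennreal (enn2real t powr a))"

definition trace_pow :: "'i set \<Rightarrow> 'd::finite fn set \<Rightarrow> (('i \<Rightarrow> 'd fn) \<Rightarrow> 'd fn \<Rightarrow> complex)
                    \<Rightarrow> real \<Rightarrow> ennreal" where
  "trace_pow I D B p = (\<Sum>m. ennpowr (sval I D B m) p)"

definition op_form :: "('d::finite fn \<Rightarrow> 'd fn) \<Rightarrow> (unit \<Rightarrow> 'd fn) \<Rightarrow> 'd fn \<Rightarrow> complex" where
  "op_form A g f = l2inner (g ()) (A f)"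

definition planck :: "real \<Rightarrow> real" where "planck hb = 2 * pi * hb"

definition tau :: "real \<Rightarrow> (real^'d) \<times> (real^'d) \<Rightarrow> 'd::finite fn \<Rightarrow> 'd fn" where
  "tau hb z \<phi> = (\<lambda>x. cis ((snd z \<bullet> (x - (1/2) *\<^sub>R fst z)) / hb) * \<phi> (x - fst z))"

definition tau_adj :: "real \<Rightarrow> (real^'d) \<times> (real^'d) \<Rightarrow> 'd::finite fn \<Rightarrow> 'd fn" where
  "tau_adj hb z \<psi> = (\<lambda>x. cis (- (snd z \<bullet> (x + (1/2) *\<^sub>R fst z)) / hb) * \<psi> (x + fst z))"

definition Tz :: "real \<Rightarrow> (real^'d) \<times> (real^'d) \<Rightarrow> ('d::finite fn \<Rightarrow> 'd fn) \<Rightarrow> ('d fn \<Rightarrow> 'd fn)" where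
  "Tz hb z \<rho> = (\<lambda>f. tau hb z (\<rho> (tau_adj hb z f)))"

definition op_diff :: "('d::finite fn \<Rightarrow> 'd fn) \<Rightarrow> ('d fn \<Rightarrow> 'd fn) \<Rightarrow> ('d fn \<Rightarrow> 'd fn)" where
  "op_diff A B = (\<lambda>f x. A f x - B f x)"

definition schatten :: "real \<Rightarrow> real \<Rightarrow> ('d::finite fn \<Rightarrow> 'd fn) \<Rightarrow> ennreal" where
  "schatten hb p A = ennreal (planck hb powr (CARD('d) / p))
        * ennpowr (trace_pow (UNIV :: unit set) L2 (op_form A) p) (1 / p)"

text \<open>Test functions: compactly supported C^1 functions (a core for the commutators).\<close>
definition partial :: "'d::finite \<Rightarrow> 'd fn \<Rightarrow> 'd fn" where
  "partial j f = (\<lambda>x. frechet_derivative f (at x) (axis j 1))"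

definition test_fn :: "'d::finite fn set" where
  "test_fn = {f. f differentiable_on UNIV \<and> (\<forall>j. continuous_on UNIV (partial j f))
                 \<and> bounded {x. f x \<noteq> 0}}"

text \<open>Sesquilinear form of the quantum gradient
  (([d_j, rho])_j, ([x_j/(i hbar), rho])_j), index (j, False) resp. (j, True):
  <g, [d_j,rho] f> = - <d_j g, rho f> - <g, rho (d_j f)>,
  <g, [x_j/(i hbar), rho] f> = (<x_j g, rho f> - <g, rho (x_j f)>) / (i hbar).\<close>
definition grad_form :: "real \<Rightarrow> ('d::finite fn \<Rightarrow> 'd fn) \<Rightarrow> ('d \<times> bool \<Rightarrow> 'd fn) \<Rightarrow> 'd fn \<Rightarrow> complex" where
  "grad_form hb \<rho> g f =
     (\<Sum>j\<in>UNIV. - l2inner (partial j (g (j, False))) (\<rho> f)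
                - l2inner (g (j, False)) (\<rho> (partial j f)))
   + (\<Sum>j\<in>UNIV. (l2inner (\<lambda>x. complex_of_real (x $ j) * g (j, True) x) (\<rho> f)
                - l2inner (g (j, True)) (\<rho> (\<lambda>x. complex_of_real (x $ j) * f x)))
               / (\<i> * complex_of_real hb))"

definition omega :: "real \<Rightarrow> real" where
  "omega a = 2 * pi powr (a / 2) / Gamma (a / 2)"

definition gamma_sp :: "nat \<Rightarrow> real \<Rightarrow> real \<Rightarrow> real" where
  "gamma_sp d s p = p * \<bar>omega (-2 * s)\<bar> / (4 * omega (2 * real d + s * p))
       * (pi * omega (p + 1) / s powr ((p - 2) / 2)) powr s"

definition W_sp :: "real \<Rightarrow> real \<Rightarrow> real \<Rightarrow> ('d::finite fn \<Rightarrow> 'd fn) \<Rightarrow> ennreal" where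
  "W_sp hb s p \<rho> =
     (if s = 1 then
        ennreal (planck hb powr (CARD('d) / p))
        * ennpowr (trace_pow (UNIV :: ('d \<times> bool) set) test_fn (grad_form hb \<rho>) p) (1 / p)
      else
        ennpowr (ennreal (gamma_sp CARD('d) s p) * ennreal (planck hb ^ CARD('d))
          * (\<integral>\<^sup>+ z. trace_pow (UNIV :: unit set) L2 (op_form (op_diff (Tz hb z \<rho>) \<rho>)) p
                     / ennreal (norm z powr (2 * real CARD('d) + s * p)) \<partial>lborel)) (1 / p))"

definition W_inf :: "real \<Rightarrow> real \<Rightarrow> ('d::finite fn \<Rightarrow> 'd fn) \<Rightarrow> ennreal" where
  "W_inf hb \<theta> \<rho> =
     (SUP z\<in>UNIV - {0 :: (real^'d) \<times> (real^'d)}.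
        opnorm (op_diff (Tz hb z \<rho>) \<rho>) / ennreal (norm z powr \<theta>))"

end

theory Submission
  imports Defs "HOL-Probability.Probability"
begin

text \<open>
  For unit vectors \<open>f, g\<close> consider the orbit \<open>u z = \<langle>g, T\<^sub>z \<rho> f\<rangle>\<close>, a continuous function on phase space with
  \<open>u (z + y) - u z = \<langle>\<tau>\<^sub>z\<^sup>* g, (T\<^sub>y \<rho> - \<rho>) \<tau>\<^sub>z\<^sup>* f\<rangle>\<close>. Moyal's inequality
  \<open>\<integral> |\<langle>x, \<tau>\<^sub>z\<^sup>* f\<rangle>|\<^sup>2 dz \<le> h\<^sup>d |x|\<^sup>2 |f|\<^sup>2\<close> bounds \<open>\<integral> |\<langle>\<tau>\<^sub>z\<^sup>* g, F \<tau>\<^sub>z\<^sup>* f\<rangle>|\<^sup>2 dz\<close> by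
  \<open>h\<^sup>d rank F |F|\<^sup>2\<close>; approximating an operator \<open>\<mu>\<close> by operators of rank \<open>2\<^sup>k - 1\<close> and summing over \<open>k\<close> gives,
  because \<open>p > 2\<close>, the weak-type estimate
  \<open>\<integral>\<^sub>E |\<langle>\<tau>\<^sub>z\<^sup>* g, \<mu> \<tau>\<^sub>z\<^sup>* f\<rangle>| dz \<le> C |\<mu>|\<^sub>p |E|\<^bsup>1 - 1/p\<^esup>\<close> with the \<open>\<L>\<^sup>p\<close> norm, uniformly in \<open>\<hbar>\<close>.
  Applied to \<open>\<mu> = T\<^sub>y \<rho> - \<rho>\<close> (or to \<open>\<mu> = \<nabla>\<rho>\<close> and integrated along segments when \<open>s = 1\<close>) it bounds the mean
  oscillation of \<open>u\<close> on balls of radius \<open>r\<close> by \<open>C r\<^sup>\<theta> |\<rho>|\<close>, and Campanato's telescoping of averages turns this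
  into Hoelder continuity of \<open>u\<close> at the origin, uniformly in \<open>f, g\<close>. No singular value decomposition is needed.
\<close>

subsection \<open>Square-integrable functions\<close>

text \<open>Singular values enter \<open>W_sp\<close> as approximation numbers, so finite-rank
  approximants come with the definition. The relation between the exponents forces \<open>p\<close>
  above 2d, hence above 2; then the \<open>L^2\<close> bounds of successive differences of
  approximants grow geometrically with \<open>k\<close>, and the sum is governed by its last scale,
  where the rank is comparable to the number \<open>V / planck hb ^ CARD('d)\<close> of Planck cells
  in the set. The power of h produced in this way is exactly the one in the norm, so no constant
  depends on \<open>hb\<close>. Two obstacles shape the rest. The trace of the p-th power of
  \<open>T_y \<rho> - \<rho>\<close> is not known to be measurable in \<open>y\<close>, so it is
  never integrated by linearity: a measurable minorant of the integrand takes its place. The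
  gradient form is tested on test functions alone, so the estimates are stated for a dense set
  \<open>D\<close> stable under phase space shifts, and derivatives of the orbit always fall on the
  test vectors. Compactness supplies boundedness of \<open>\<rho>\<close>, hence continuity of the
  orbit, which makes the telescoping end at the right value.\<close>

lemma L2_measurable[measurable_dest]: "f \<in> L2 \<Longrightarrow> f \<in> borel_measurable borel"
  by (simp add: L2_def)

lemma L2I:
  "f \<in> borel_measurable borel \<Longrightarrow> integrable lborel (\<lambda>x. (cmod (f x))\<^sup>2) \<Longrightarrow> f \<in> L2"
  by (simp add: L2_def)

lemma L2_integrable[simp]: "f \<in> L2 \<Longrightarrow> integrable lborel (\<lambda>x. (cmod (f x))\<^sup>2)"
  by (simp add: L2_def)

lemma L2_bound:
  assumes "f \<in> borel_measurable borel" "integrable lborel g" "\<And>x. (cmod (f x))\<^sup>2 \<le> g x"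
  shows "f \<in> L2"
proof (rule L2I)
  note [measurable] = assms(1)
  show "integrable lborel (\<lambda>x. (cmod (f x))\<^sup>2)"
    by (rule Bochner_Integration.integrable_bound[OF assms(2)])
       (use assms(3) in \<open>auto intro!: AE_I2 intro: order_trans[OF _ abs_ge_self]\<close>)
qed fact

lemma L2_zero[simp]: "(\<lambda>x. 0) \<in> L2"
  by (auto intro!: L2I)

lemma L2_scale[simp, intro]: "f \<in> L2 \<Longrightarrow> (\<lambda>x. c * f x) \<in> L2"
  using L2_integrable[of f] L2_measurable[of f]
  by (auto intro!: L2I simp: norm_mult power_mult_distrib)

lemma cmod_add_sq: "(cmod (a + b))\<^sup>2 \<le> 2 * (cmod a)\<^sup>2 + 2 * (cmod b)\<^sup>2"
proof -
  have "(cmod (a + b))\<^sup>2 \<le> (cmod a + cmod b)\<^sup>2"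
    by (simp add: norm_triangle_ineq power_mono)
  moreover have "0 \<le> (cmod a - cmod b)\<^sup>2" by simp
  ultimately show ?thesis by (simp add: power2_eq_square algebra_simps)
qed

lemma L2_add[simp, intro]:
  assumes "f \<in> L2" "g \<in> L2" shows "(\<lambda>x. f x + g x) \<in> L2"
proof (rule L2_bound)
  show "integrable lborel (\<lambda>x. 2 * (cmod (f x))\<^sup>2 + 2 * (cmod (g x))\<^sup>2)"
    using assms by simp
qed (use assms cmod_add_sq in \<open>auto dest: L2_measurable\<close>)

lemma L2_uminus[simp, intro]: "f \<in> L2 \<Longrightarrow> (\<lambda>x. - f x) \<in> L2"
  using L2_scale[of f "-1"] by simp

lemma L2_diff[simp, intro]: "f \<in> L2 \<Longrightarrow> g \<in> L2 \<Longrightarrow> (\<lambda>x. f x - g x) \<in> L2"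
  using L2_add[of f "\<lambda>x. - g x"] by simp

lemma L2_sum[simp, intro]: "(\<And>i. i \<in> A \<Longrightarrow> f i \<in> L2) \<Longrightarrow> (\<lambda>x. \<Sum>i\<in>A. f i x) \<in> L2"
  by (induct A rule: infinite_finite_induct) auto

lemma L2_prod_integrable[simp]:
  assumes "f \<in> L2" "g \<in> L2" shows "integrable lborel (\<lambda>x. cmod (g x) * cmod (f x))"
proof (rule Bochner_Integration.integrable_bound)
  show "integrable lborel (\<lambda>x. (cmod (f x))\<^sup>2 + (cmod (g x))\<^sup>2)"
    using assms by simp
  show "AE x in lborel. norm (cmod (g x) * cmod (f x)) \<le> norm ((cmod (f x))\<^sup>2 + (cmod (g x))\<^sup>2)"
  proof (rule AE_I2)
    fix x
    have "b * a \<le> a\<^sup>2 + b\<^sup>2" if "0 \<le> a" "0 \<le> b" for a b :: real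
      using sum_squares_bound[of a b] mult_nonneg_nonneg[OF that] unfolding mult.commute[of b a] by linarith
    then show "norm (cmod (g x) * cmod (f x)) \<le> norm ((cmod (f x))\<^sup>2 + (cmod (g x))\<^sup>2)"
      by simp
  qed
qed (use assms[THEN L2_measurable] in measurable)

lemma cnj_borel[measurable]: "cnj \<in> borel_measurable borel"
  by (intro borel_measurable_continuous_onI continuous_intros)

lemma L2_inner_integrable[simp, intro]:
  assumes "f \<in> L2" "g \<in> L2" shows "integrable lborel (\<lambda>x. cnj (g x) * f x)"
proof -
  have [measurable]: "f \<in> borel_measurable borel" "g \<in> borel_measurable borel"
    using assms by (auto dest: L2_measurable)
  show ?thesis
    by (rule Bochner_Integration.integrable_bound[OF L2_prod_integrable[OF assms]])
       (auto simp: norm_mult)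
qed

lemma l2norm_nonneg[simp]: "0 \<le> l2norm f"
  by (simp add: l2norm_def)

lemma l2norm_sq: "(l2norm f)\<^sup>2 = (\<integral>x. (cmod (f x))\<^sup>2 \<partial>lborel)"
  by (simp add: l2norm_def)

lemma l2norm_zero[simp]: "l2norm (\<lambda>x. 0) = 0"
  by (simp add: l2norm_def)

lemma l2norm_scale: "l2norm (\<lambda>x. c * f x) = cmod c * l2norm f"
  by (simp add: l2norm_def norm_mult power_mult_distrib real_sqrt_mult)

lemma l2norm_minus_commute: "l2norm (\<lambda>x. f x - g x) = l2norm (\<lambda>x. g x - f x)"
  by (simp add: l2norm_def norm_minus_commute)

lemma l2norm_eq_0_AE:
  assumes "f \<in> L2" "l2norm f = 0" shows "AE x in lborel. f x = 0"
proof -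
  have "(\<integral>x. (cmod (f x))\<^sup>2 \<partial>lborel) = 0" using assms(2) by (simp add: l2norm_def)
  then have "AE x in lborel. (cmod (f x))\<^sup>2 = 0"
    using integral_nonneg_eq_0_iff_AE[OF L2_integrable[OF assms(1)]] by auto
  then show ?thesis by simp
qed

lemma l2norm_cong_AE:
  assumes "f \<in> L2" "g \<in> L2" "AE x in lborel. f x = g x" shows "l2norm f = l2norm g"
  unfolding l2norm_def
  by (intro arg_cong[where f = sqrt] integral_cong_AE)
     (use assms in \<open>auto dest!: L2_measurable\<close>)

lemma l2inner_cong_AE:
  assumes "f \<in> L2" "f' \<in> L2" "g \<in> L2" "g' \<in> L2"
    "AE x in lborel. f x = f' x" "AE x in lborel. g x = g' x"
  shows "l2inner g f = l2inner g' f'"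
proof -
  have [measurable]: "f \<in> borel_measurable borel" "g \<in> borel_measurable borel"
    "f' \<in> borel_measurable borel" "g' \<in> borel_measurable borel"
    using assms by (auto dest: L2_measurable)
  show ?thesis unfolding l2inner_def
    by (intro integral_cong_AE) (use assms(5,6) in auto)
qed

lemma l2_abs_CS:
  assumes "f \<in> L2" "g \<in> L2"
  shows "(\<integral>x. cmod (g x) * cmod (f x) \<partial>lborel) \<le> l2norm g * l2norm f"
proof -
  \<comment> \<open>Young's inequality with a free weight \<open>a\<close>; the choice
    \<open>l2norm f / l2norm g\<close> below optimises it and yields the product of the
    norms.\<close>
  have young: "(\<integral>x. cmod (g x) * cmod (f x) \<partial>lborel) \<le> (a * (l2norm g)\<^sup>2 + (l2norm f)\<^sup>2 / a) / 2"
    if "a > 0" for a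
  proof -
    have "(\<integral>x. cmod (g x) * cmod (f x) \<partial>lborel)
       \<le> (\<integral>x. (a * (cmod (g x))\<^sup>2 + (cmod (f x))\<^sup>2 / a) / 2 \<partial>lborel)"
    proof (rule integral_mono)
      show "integrable lborel (\<lambda>x. (a * (cmod (g x))\<^sup>2 + (cmod (f x))\<^sup>2 / a) / 2)"
        using assms by simp
      fix x
      have "0 \<le> (a * cmod (g x) - cmod (f x))\<^sup>2 / a" using that by simp
      also have "\<dots> = a * (cmod (g x))\<^sup>2 + (cmod (f x))\<^sup>2 / a - 2 * (cmod (g x) * cmod (f x))"
        using that by (simp add: field_simps power2_eq_square)
      finally show "cmod (g x) * cmod (f x) \<le> (a * (cmod (g x))\<^sup>2 + (cmod (f x))\<^sup>2 / a) / 2"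
        by simp
    qed (rule L2_prod_integrable[OF assms])
    also have "\<dots> = (a * (l2norm g)\<^sup>2 + (l2norm f)\<^sup>2 / a) / 2"
      using assms by (simp add: l2norm_sq L2_integrable)
    finally show ?thesis .
  qed
  show ?thesis
  proof (cases "l2norm f = 0 \<or> l2norm g = 0")
    case True
    then have "AE x in lborel. cmod (g x) * cmod (f x) = 0"
      using l2norm_eq_0_AE[OF assms(1)] l2norm_eq_0_AE[OF assms(2)] by auto
    then have "(\<integral>x. cmod (g x) * cmod (f x) \<partial>lborel) = 0"
      by (rule integral_eq_zero_AE)
    then show ?thesis by simp
  next
    case False
    then have "l2norm f > 0" "l2norm g > 0"
      using l2norm_nonneg[of f] l2norm_nonneg[of g] by linarith+
    then show ?thesis
      using young[of "l2norm f / l2norm g"] by (simp add: field_simps power2_eq_square)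
  qed
qed

lemma l2inner_CS:
  assumes "f \<in> L2" "g \<in> L2"
  shows "cmod (l2inner g f) \<le> l2norm g * l2norm f"
proof -
  have "cmod (l2inner g f) \<le> (\<integral>x. cmod (cnj (g x) * f x) \<partial>lborel)"
    unfolding l2inner_def by (rule integral_norm_bound)
  also have "\<dots> \<le> l2norm g * l2norm f"
    using l2_abs_CS[OF assms] by (simp add: norm_mult)
  finally show ?thesis .
qed

lemma l2norm_triangle:
  assumes "f \<in> L2" "g \<in> L2"
  shows "l2norm (\<lambda>x. f x + g x) \<le> l2norm f + l2norm g"
proof -
  have "(l2norm (\<lambda>x. f x + g x))\<^sup>2 \<le>
    (\<integral>x. (cmod (f x))\<^sup>2 + 2 * (cmod (g x) * cmod (f x)) + (cmod (g x))\<^sup>2 \<partial>lborel)"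
    unfolding l2norm_sq
  proof (rule integral_mono)
    fix x
    have "(cmod (f x + g x))\<^sup>2 \<le> (cmod (f x) + cmod (g x))\<^sup>2"
      by (simp add: norm_triangle_ineq power_mono)
    then show "(cmod (f x + g x))\<^sup>2 \<le> (cmod (f x))\<^sup>2 + 2 * (cmod (g x) * cmod (f x)) + (cmod (g x))\<^sup>2"
      by (simp add: power2_eq_square algebra_simps)
  qed (use assms in \<open>simp_all\<close>)
  also have "\<dots> = (l2norm f)\<^sup>2 + 2 * (\<integral>x. cmod (g x) * cmod (f x) \<partial>lborel) + (l2norm g)\<^sup>2"
    using assms by (simp add: l2norm_sq L2_integrable L2_prod_integrable)
  also have "\<dots> \<le> (l2norm f + l2norm g)\<^sup>2"
    using l2_abs_CS[OF assms] by (simp add: power2_eq_square algebra_simps)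
  finally show ?thesis by (rule power2_le_imp_le) simp
qed

lemma l2norm_diff_le:
  assumes "f \<in> L2" "g \<in> L2"
  shows "l2norm f \<le> l2norm g + l2norm (\<lambda>x. f x - g x)"
  using l2norm_triangle[OF assms(2) L2_diff[OF assms]] by simp

lemma l2norm_diff_triangle:
  assumes "f \<in> L2" "g \<in> L2" "h \<in> L2"
  shows "l2norm (\<lambda>x. f x - h x) \<le> l2norm (\<lambda>x. f x - g x) + l2norm (\<lambda>x. g x - h x)"
  using l2norm_triangle[of "\<lambda>x. f x - g x" "\<lambda>x. g x - h x"] assms by simp

lemma l2inner_cnj: "cnj (l2inner f g) = l2inner g f"
proof -
  have "l2inner g f = (\<integral>x. cnj (cnj (f x) * g x) \<partial>lborel)"
    unfolding l2inner_def by (intro arg_cong[where f = "integral\<^sup>L lborel"]) auto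
  also have "\<dots> = cnj (l2inner f g)"
    unfolding l2inner_def by (rule Bochner_Integration.integral_cnj)
  finally show ?thesis ..
qed

lemma l2inner_scale_right: "l2inner g (\<lambda>x. c * f x) = c * l2inner g f"
  unfolding l2inner_def by (simp add: mult.left_commute)

lemma l2inner_scale_left: "l2inner (\<lambda>x. c * g x) f = cnj c * l2inner g f"
  unfolding l2inner_def by (simp add: mult.assoc)

lemma l2inner_add_right:
  assumes "g \<in> L2" "f1 \<in> L2" "f2 \<in> L2"
  shows "l2inner g (\<lambda>x. f1 x + f2 x) = l2inner g f1 + l2inner g f2"
  using assms by (simp add: l2inner_def distrib_left)

lemma l2inner_add_left:
  assumes "f \<in> L2" "g1 \<in> L2" "g2 \<in> L2"
  shows "l2inner (\<lambda>x. g1 x + g2 x) f = l2inner g1 f + l2inner g2 f"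
  using assms by (simp add: l2inner_def distrib_right)

lemma l2inner_zero[simp]: "l2inner (\<lambda>x. 0) f = 0" "l2inner g (\<lambda>x. 0) = 0"
  by (simp_all add: l2inner_def)

lemma l2inner_diff_right:
  assumes "g \<in> L2" "f1 \<in> L2" "f2 \<in> L2"
  shows "l2inner g (\<lambda>x. f1 x - f2 x) = l2inner g f1 - l2inner g f2"
  using assms by (simp add: l2inner_def right_diff_distrib)

lemma l2inner_diff_left:
  assumes "f \<in> L2" "g1 \<in> L2" "g2 \<in> L2"
  shows "l2inner (\<lambda>x. g1 x - g2 x) f = l2inner g1 f - l2inner g2 f"
  using assms by (simp add: l2inner_def left_diff_distrib)

lemma l2inner_sum_right:
  assumes "g \<in> L2" "\<And>i. i \<in> A \<Longrightarrow> f i \<in> L2"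
  shows "l2inner g (\<lambda>x. \<Sum>i\<in>A. f i x) = (\<Sum>i\<in>A. l2inner g (f i))"
  using assms(2)
  by (induct A rule: infinite_finite_induct) (simp_all add: l2inner_add_right assms(1))

lemma l2inner_sum_left:
  assumes "f \<in> L2" "\<And>i. i \<in> A \<Longrightarrow> g i \<in> L2"
  shows "l2inner (\<lambda>x. \<Sum>i\<in>A. g i x) f = (\<Sum>i\<in>A. l2inner (g i) f)"
  using assms(2)
  by (induct A rule: infinite_finite_induct) (simp_all add: l2inner_add_left assms(1))

lemma l2inner_self: "l2inner f f = complex_of_real ((l2norm f)\<^sup>2)"
proof -
  have "(\<lambda>x. cnj (f x) * f x) = (\<lambda>x. complex_of_real ((cmod (f x))\<^sup>2))"
    by (auto simp: complex_norm_square mult.commute simp del: of_real_power)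
  then show ?thesis
    unfolding l2inner_def l2norm_sq by (simp del: of_real_power)
qed

subsection \<open>Density of test functions\<close>

text \<open>The derivative is quantified existentially and its continuity is asked direction by
  direction. On \<open>real^'d\<close> this matches the continuity of the partial derivatives in
  \<open>test_fn\<close>, and it passes through sums, products and compositions without computing a
  \<open>frechet_derivative\<close>.\<close>

definition C1 :: "('a::real_normed_vector \<Rightarrow> 'b::real_normed_vector) \<Rightarrow> bool" where
  "C1 f \<longleftrightarrow> (\<exists>f'. (\<forall>x. (f has_derivative f' x) (at x)) \<and> (\<forall>h. continuous_on UNIV (\<lambda>x. f' x h)))"

lemma C1I:
  "(\<And>x. (f has_derivative f' x) (at x)) \<Longrightarrow> (\<And>h. continuous_on UNIV (\<lambda>x. f' x h)) \<Longrightarrow> C1 f"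
  unfolding C1_def by blast

lemma C1_continuous: "C1 f \<Longrightarrow> continuous_on S f"
  unfolding C1_def
  by (metis has_derivative_continuous continuous_at_imp_continuous_on)

lemma C1_const: "C1 (\<lambda>x. c)"
  by (rule C1I[where f' = "\<lambda>x h. 0"]) auto

lemma C1_bounded_linear: "bounded_linear f \<Longrightarrow> C1 f"
  by (rule C1I[where f' = "\<lambda>x. f"]) (auto simp: bounded_linear_imp_has_derivative)

lemma C1_add: assumes "C1 f" "C1 g" shows "C1 (\<lambda>x. f x + g x)"
proof -
  obtain f' g' where "\<And>x. (f has_derivative f' x) (at x)" "\<And>h. continuous_on UNIV (\<lambda>x. f' x h)"
    "\<And>x. (g has_derivative g' x) (at x)" "\<And>h. continuous_on UNIV (\<lambda>x. g' x h)"
    using assms unfolding C1_def by metis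
  then show ?thesis
    by (intro C1I[where f' = "\<lambda>x h. f' x h + g' x h"]) (auto intro!: derivative_intros continuous_intros)
qed

text \<open>One product rule serves multiplication, scaling and the inner product, from which the
  cutoffs, polynomials and phases below are built.\<close>

lemma C1_bilinear:
  assumes "bounded_bilinear b" "C1 f" "C1 g" shows "C1 (\<lambda>x. b (f x) (g x))"
proof -
  interpret bounded_bilinear b by fact
  obtain f' g' where f: "\<And>x. (f has_derivative f' x) (at x)" "\<And>h. continuous_on UNIV (\<lambda>x. f' x h)"
    and g: "\<And>x. (g has_derivative g' x) (at x)" "\<And>h. continuous_on UNIV (\<lambda>x. g' x h)"
    using assms unfolding C1_def by metis
  have "continuous_on UNIV f" "continuous_on UNIV g" using assms by (auto intro: C1_continuous)
  then show ?thesis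
    by (intro C1I[where f' = "\<lambda>x h. b (f x) (g' x h) + b (f' x h) (g x)"])
       (auto intro!: FDERIV continuous_on continuous_on_add f g)
qed

lemmas C1_mult = C1_bilinear[OF bounded_bilinear_mult]
  and C1_scaleR = C1_bilinear[OF bounded_bilinear_scaleR]
  and C1_inner = C1_bilinear[OF bounded_bilinear_inner]

lemma C1_compose_real:
  fixes \<phi> :: "real \<Rightarrow> 'b::real_normed_vector"
  assumes "C1 \<phi>" "C1 g" shows "C1 (\<lambda>x. \<phi> (g x))"
proof -
  obtain f' g' where f: "\<And>x. (\<phi> has_derivative f' x) (at x)" "\<And>h. continuous_on UNIV (\<lambda>x. f' x h)"
    and g: "\<And>x. (g has_derivative g' x) (at x)" "\<And>h. continuous_on UNIV (\<lambda>x. g' x h)"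
    using assms unfolding C1_def by metis
  \<comment> \<open>A linear map on the reals is multiplication by its value at 1; continuity for a
    moving direction thus reduces to the fixed direction 1.\<close>
  have eq: "f' s k = k *\<^sub>R f' s 1" for s k
    using linear_cmul[OF has_derivative_linear[OF f(1)], of s k 1] by simp
  show ?thesis
  proof (rule C1I[where f' = "\<lambda>x h. f' (g x) (g' x h)"])
    show "((\<lambda>x. \<phi> (g x)) has_derivative (\<lambda>h. f' (g x) (g' x h))) (at x)" for x
      using has_derivative_compose[OF g(1) f(1)] .
    show "continuous_on UNIV (\<lambda>x. f' (g x) (g' x h))" for h
      by (subst eq) (intro continuous_intros g continuous_on_compose2[OF f(2)] C1_continuous assms; simp)
  qed
qed

lemma C1_translate:
  assumes "C1 f" shows "C1 (\<lambda>x. f (x + a))"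
proof -
  obtain f' where f: "\<And>x. (f has_derivative f' x) (at x)" "\<And>h. continuous_on UNIV (\<lambda>x. f' x h)"
    using assms unfolding C1_def by metis
  show ?thesis
  proof (rule C1I[where f' = "\<lambda>x h. f' (x + a) h"])
    show "((\<lambda>x. f (x + a)) has_derivative f' (x + a)) (at x)" for x
    proof -
      have "((\<lambda>x. x + a) has_derivative (\<lambda>h. h)) (at x)" by (auto intro!: derivative_eq_intros)
      from has_derivative_compose[OF this f(1)] show ?thesis .
    qed
    show "continuous_on UNIV (\<lambda>x. f' (x + a) h)" for h
      by (intro continuous_on_compose2[OF f(2)] continuous_intros) simp
  qed
qed

lemma C1_real_polynomial_function:
  fixes p :: "'a::real_normed_vector \<Rightarrow> real"
  assumes "real_polynomial_function p" shows "C1 p"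
  using assms
proof induct
  case (linear f) then show ?case by (rule C1_bounded_linear)
next
  case (const c) show ?case by (rule C1_const)
next
  case (add f g) then show ?case by (intro C1_add)
next
  case (mult f g) then show ?case by (intro C1_mult)
qed

lemma C1_polynomial_function:
  fixes p :: "'a::real_normed_vector \<Rightarrow> complex"
  assumes "polynomial_function p" shows "C1 p"
proof -
  have re: "C1 (\<lambda>x. Re (p x))" and im: "C1 (\<lambda>x. Im (p x))"
    using assms bounded_linear_Re bounded_linear_Im
    by (auto simp: polynomial_function_def o_def intro!: C1_real_polynomial_function)
  have "C1 (\<lambda>x. Re (p x) *\<^sub>R (1::complex) + Im (p x) *\<^sub>R \<i>)"
    by (intro C1_add C1_scaleR C1_const re im)
  moreover have "(\<lambda>x. Re (p x) *\<^sub>R (1::complex) + Im (p x) *\<^sub>R \<i>) = p"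
    by (auto simp: complex_eq_iff)
  ultimately show ?thesis by simp
qed

text \<open>Squaring removes the kink of the positive part: away from 0 the difference quotient at 0
  is again \<open>max 0 y\<close>, which tends to 0. This is the profile from which compactly
  supported C1 cutoffs are made.\<close>

lemma C1_max_0_sq: "C1 (\<lambda>s::real. (max 0 s)\<^sup>2)"
proof (rule C1I[where f' = "\<lambda>s h. 2 * max 0 s * h"])
  fix x :: real
  show "((\<lambda>s. (max 0 s)\<^sup>2) has_derivative (\<lambda>h. 2 * max 0 x * h)) (at x)"
  proof (cases "x = 0")
    case False
    then consider "x > 0" | "x < 0" by linarith
    then show ?thesis
    proof cases
      case 1
      have "((\<lambda>s. s\<^sup>2) has_derivative (\<lambda>h. 2 * max 0 x * h)) (at x)"
        using 1 by (auto intro!: derivative_eq_intros)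
      then show ?thesis
        by (rule has_derivative_transform_within_open[where s = "{0<..}"]) (use 1 in auto)
    next
      case 2
      have "((\<lambda>s. 0) has_derivative (\<lambda>h. 2 * max 0 x * h)) (at x)"
        using 2 by (auto intro!: derivative_eq_intros)
      then show ?thesis
        by (rule has_derivative_transform_within_open[where s = "{..<0}"]) (use 2 in auto)
    qed
  next
    case True
    have "((\<lambda>y::real. max 0 y) \<longlongrightarrow> 0) (at 0)"
      using tendsto_max[OF tendsto_const[of 0] tendsto_ident_at[of "0::real" UNIV]] by simp
    then have "((\<lambda>y::real. (max 0 y)\<^sup>2 / y) \<longlongrightarrow> 0) (at 0)"
      by (rule Lim_transform_eventually)
         (auto simp: eventually_at_filter max_def power2_eq_square)
    then have "DERIV (\<lambda>s::real. (max 0 s)\<^sup>2) 0 :> 0"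
      by (simp add: has_field_derivative_iff)
    then show ?thesis
      using True by (simp add: has_field_derivative_def lambda_zero)
  qed
qed (intro continuous_intros)

lemma C1_cis: "C1 cis"
proof (rule C1I[where f' = "\<lambda>x h. h *\<^sub>R (\<i> * cis x)"])
  show "(cis has_derivative (\<lambda>h. h *\<^sub>R (\<i> * cis x))) (at x)" for x
    by (rule has_derivative_cis[OF has_derivative_ident])
  show "continuous_on UNIV (\<lambda>x. h *\<^sub>R (\<i> * cis x))" for h
    by (intro continuous_intros continuous_on_cis)
qed

lemma C1_imp_differentiable: "C1 f \<Longrightarrow> f differentiable (at x)"
  unfolding C1_def differentiable_def by blast

section \<open>Test functions: regularity, support and square integrability\<close>

lemma test_fnI:
  fixes f :: "'d::finite fn"
  assumes "C1 f" "\<And>x. norm x > R \<Longrightarrow> f x = 0"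
  shows "f \<in> test_fn"
proof -
  obtain f' where f: "\<And>x. (f has_derivative f' x) (at x)" "\<And>h. continuous_on UNIV (\<lambda>x. f' x h)"
    using assms unfolding C1_def by metis
  have "partial j f = (\<lambda>x. f' x (axis j 1))" for j
    unfolding partial_def using frechet_derivative_at[OF f(1)] by metis
  moreover have "bounded {x. f x \<noteq> 0}"
    by (rule bounded_subset[OF bounded_cball[of 0 R]]) (use assms(2) in \<open>force simp: dist_norm\<close>)
  ultimately show ?thesis
    using f C1_imp_differentiable[OF assms(1)]
    by (auto simp: test_fn_def differentiable_on_def differentiable_at_withinI)
qed

lemma test_fn_derivative:
  assumes "f \<in> test_fn"
  shows "(f has_derivative (\<lambda>h. \<Sum>j\<in>UNIV. complex_of_real (h $ j) * partial j f x)) (at x)"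
proof -
  have "f differentiable (at x)"
    using assms by (auto simp: test_fn_def differentiable_on_def)
  then have D: "(f has_derivative frechet_derivative f (at x)) (at x)"
    by (simp add: frechet_derivative_works)
  then have lin: "linear (frechet_derivative f (at x))"
    by (rule has_derivative_linear)
  have "frechet_derivative f (at x) h = (\<Sum>j\<in>UNIV. complex_of_real (h $ j) * partial j f x)" for h
  proof -
    have "frechet_derivative f (at x) h = frechet_derivative f (at x) (\<Sum>j\<in>UNIV. (h $ j) *\<^sub>R axis j 1)"
      using basis_expansion[of h] by (simp add: scalar_mult_eq_scaleR)
    also have "\<dots> = (\<Sum>j\<in>UNIV. complex_of_real (h $ j) * partial j f x)"
      by (simp only: linear_sum[OF lin] linear_cmul[OF lin] partial_def scaleR_conv_of_real[symmetric])
    finally show ?thesis .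
  qed
  then have "frechet_derivative f (at x) = (\<lambda>h. \<Sum>j\<in>UNIV. complex_of_real (h $ j) * partial j f x)"
    by blast
  then show ?thesis using D by metis
qed

lemma test_fn_C1: "f \<in> test_fn \<Longrightarrow> C1 f"
  by (rule C1I[OF test_fn_derivative])
     (auto intro!: continuous_intros simp: test_fn_def)

lemma test_fn_support:
  assumes "f \<in> test_fn" obtains R where "R > 0" "\<And>x. norm x > R \<Longrightarrow> f x = 0"
proof -
  obtain B where "\<forall>x\<in>{x. f x \<noteq> 0}. norm x \<le> B"
    using assms bounded_iff[of "{x. f x \<noteq> 0}"] by (auto simp: test_fn_def)
  then show thesis by (intro that[of "max B 1"]) force+
qed

lemma continuous_compact_support_bounded:
  fixes f :: "'a::euclidean_space \<Rightarrow> 'b::real_normed_vector"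
  assumes "continuous_on UNIV f" "\<And>x. norm x > R \<Longrightarrow> f x = 0"
  obtains B where "B > 0" "\<And>x. norm (f x) \<le> B"
proof -
  have "compact (f ` cball 0 R)"
    by (intro compact_continuous_image continuous_on_subset[OF assms(1)]) auto
  then obtain B where B: "\<forall>y\<in>f ` cball 0 R. norm y \<le> B"
    using compact_imp_bounded bounded_iff by metis
  show thesis
  proof (rule that[of "max B 1"])
    show "norm (f x) \<le> max B 1" for x
      by (cases "norm x \<le> R") (use B assms(2)[of x] in \<open>auto simp: max.coboundedI1\<close>)
  qed simp
qed

lemma integrable_indicator_cball[simp]:
  "integrable lborel (\<lambda>x::'a::euclidean_space. B * indicator (cball a R) x :: real)"
  by (intro integrable_mult_right integrable_real_indicator) (auto intro: emeasure_bounded_finite[unfolded infinity_ennreal_def])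

lemma integrable_indicator_cball'[simp]:
  "integrable lborel (\<lambda>x::'a::euclidean_space. indicator (cball a R) x :: real)"
  using integrable_indicator_cball[of 1 a R] by (simp only: mult_1)

lemma continuous_compact_support_L2:
  fixes f :: "'d::finite fn"
  assumes "continuous_on UNIV f" "\<And>x. norm x > R \<Longrightarrow> f x = 0"
  shows "f \<in> L2"
proof -
  obtain B where B: "B > 0" "\<And>x. norm (f x) \<le> B"
    using continuous_compact_support_bounded[OF assms] by blast
  show ?thesis
  proof (rule L2_bound[where g = "\<lambda>x. B\<^sup>2 * indicator (cball 0 R) x"])
    show "f \<in> borel_measurable borel" using assms(1) by (rule borel_measurable_continuous_onI)
    show "(cmod (f x))\<^sup>2 \<le> B\<^sup>2 * indicator (cball 0 R) x" for x
      using B assms(2)[of x] by (auto simp: indicator_def not_le intro!: power_mono)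
  qed simp
qed

lemma test_fn_L2: "f \<in> test_fn \<Longrightarrow> f \<in> L2"
  by (metis test_fn_support continuous_compact_support_L2 C1_continuous test_fn_C1)

lemma l2norm_dominated_convergence:
  fixes F :: "nat \<Rightarrow> 'd::finite fn"
  assumes "\<And>n. F n \<in> L2" "f \<in> L2" "integrable lborel G"
    and "AE x in lborel. (\<lambda>n. F n x) \<longlonglongrightarrow> f x"
    and "\<And>n x. (cmod (F n x - f x))\<^sup>2 \<le> G x"
  shows "(\<lambda>n. l2norm (\<lambda>x. F n x - f x)) \<longlonglongrightarrow> 0"
proof -
  have [measurable]: "f \<in> borel_measurable borel" "F n \<in> borel_measurable borel" for n
    using assms(1,2) by (auto dest: L2_measurable)
  have "(\<lambda>n. \<integral>x. (cmod (F n x - f x))\<^sup>2 \<partial>lborel) \<longlonglongrightarrow> (\<integral>x. 0 \<partial>(lborel :: (real^'d) measure))"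
  proof (rule integral_dominated_convergence[where w = G])
    show "AE x in lborel. (\<lambda>i. (cmod (F i x - f x))\<^sup>2) \<longlonglongrightarrow> 0"
      using assms(4)
    proof eventually_elim
      case (elim x)
      then have "(\<lambda>i. F i x - f x) \<longlonglongrightarrow> 0" by (simp add: LIM_zero)
      then show ?case using tendsto_power[OF tendsto_norm_zero, of _ _ 2] by fastforce
    qed
    show "AE x in lborel. norm ((cmod (F i x - f x))\<^sup>2) \<le> G x" for i
      using assms(5) by simp
  qed (use assms(3) in measurable)
  then show ?thesis
    unfolding l2norm_def using tendsto_real_sqrt by fastforce
qed

text \<open>Approximants are kept in the unit ball because \<open>sval\<close> tests a form on
  vectors of norm at most 1; bounds obtained on \<open>D\<close> then extend to the unit ball of
  \<open>L2\<close> with the same constant.\<close>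

definition dense_L2 :: "'d::finite fn set \<Rightarrow> bool" where
  "dense_L2 D \<longleftrightarrow> D \<subseteq> L2 \<and>
    (\<forall>f\<in>L2. l2norm f \<le> 1 \<longrightarrow> (\<forall>e>0. \<exists>g\<in>D. l2norm g \<le> 1 \<and> l2norm (\<lambda>x. f x - g x) < e))"

lemma dense_L2_L2: "dense_L2 L2"
  unfolding dense_L2_def by (auto intro!: bexI)

lemma L2_truncate_approx:
  fixes f :: "'d::finite fn"
  assumes "f \<in> L2" "e > 0"
  obtains g M where "g \<in> L2" "M > 0" "\<And>x. cmod (g x) \<le> M" "\<And>x. norm x > M \<Longrightarrow> g x = 0"
    "l2norm (\<lambda>x. f x - g x) < e"
proof -
  have [measurable]: "f \<in> borel_measurable borel" using assms(1) by (rule L2_measurable)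
  define F where "F n x = (if norm x \<le> real n \<and> cmod (f x) \<le> real n then f x else 0)" for n :: nat and x
  have F: "F n \<in> L2" for n
  proof (rule L2_bound[OF _ L2_integrable[OF assms(1)]])
    show "F n \<in> borel_measurable borel" unfolding F_def by measurable
  qed (simp add: F_def)
  have "(\<lambda>n. l2norm (\<lambda>x. F n x - f x)) \<longlonglongrightarrow> 0"
  proof (rule l2norm_dominated_convergence[OF F assms(1) L2_integrable[OF assms(1)]])
    show "AE x in lborel. (\<lambda>n. F n x) \<longlonglongrightarrow> f x"
    proof (rule AE_I2)
      fix x
      have "eventually (\<lambda>n. F n x = f x) sequentially"
        using eventually_ge_at_top[of "nat \<lceil>max (norm x) (cmod (f x))\<rceil>"]
        by eventually_elim (auto simp: F_def)
      then show "(\<lambda>n. F n x) \<longlonglongrightarrow> f x" by (rule tendsto_eventually)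
    qed
    show "(cmod (F n x - f x))\<^sup>2 \<le> (cmod (f x))\<^sup>2" for n x by (simp add: F_def)
  qed
  then have "eventually (\<lambda>n. l2norm (\<lambda>x. F n x - f x) < e) sequentially"
    using assms(2) by (rule order_tendstoD)
  then obtain n where "l2norm (\<lambda>x. F n x - f x) < e"
    using eventually_happens by force
  then show thesis
    by (intro that[of "F n" "real n + 1"] F)
       (auto simp: F_def l2norm_minus_commute[of f] intro: add_nonneg_pos)
qed

text \<open>Lebesgue measurability supplies continuous functions converging almost everywhere, but
  without a common bound or support. Projecting their values to the closed ball of radius
  \<open>M\<close> and multiplying by a spatial cutoff repairs both. Each operation leaves
  \<open>f\<close> fixed, so the limit is unchanged and dominated convergence applies.\<close>

lemma bounded_support_continuous_approx:
  fixes f :: "'d::finite fn"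
  assumes f: "f \<in> L2" and M: "M > 0" "\<And>x. cmod (f x) \<le> M" "\<And>x. norm x > M \<Longrightarrow> f x = 0"
    and "e > 0"
  obtains g where "continuous_on UNIV g" "\<And>x. norm x > M + 1 \<Longrightarrow> g x = 0"
    "l2norm (\<lambda>x. f x - g x) < e"
proof -
  have "f \<in> borel_measurable lebesgue"
    using L2_measurable[OF f] by (simp add: measurable_completion)
  then have "f measurable_on UNIV"
    using lebesgue_measurable_imp_measurable_on[of f UNIV] by simp
  then obtain N h where N: "negligible N" and hc: "\<And>n::nat. continuous_on UNIV (h n)"
    and hl: "\<And>x. x \<notin> N \<Longrightarrow> (\<lambda>n. h n x) \<longlonglongrightarrow> f x"
    unfolding measurable_on_def by auto
  define k :: "real^'d \<Rightarrow> complex" where "k x = of_real (max 0 (min 1 (M + 1 - norm x)))" for x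
  define F where "F n x = k x * closest_point (cball 0 M) (h n x)" for n x
  have ccp: "continuous_on UNIV (closest_point (cball (0::complex) M))"
    using M(1) by (intro continuous_on_closest_point) auto
  have Fc: "continuous_on UNIV (F n)" for n
    unfolding F_def k_def
    by (intro continuous_intros continuous_on_compose2[OF ccp hc]) auto
  have F0: "F n x = 0" if "norm x > M + 1" for n x
    using that by (auto simp: F_def k_def)
  have FL: "F n \<in> L2" for n by (rule continuous_compact_support_L2[OF Fc F0])
  have cp_le: "cmod (closest_point (cball 0 M) y) \<le> M" for y :: complex
    using closest_point_in_set[of "cball 0 M" y] M(1) by simp
  have k1: "cmod (k x) \<le> 1" for x by (simp add: k_def)
  have F_le: "cmod (F n x) \<le> M" for n x
    unfolding F_def norm_mult using mult_mono[OF k1[of x] cp_le[of "h n x"]] by simp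
  have "(\<lambda>n. l2norm (\<lambda>x. F n x - f x)) \<longlonglongrightarrow> 0"
  proof (rule l2norm_dominated_convergence[OF FL f, where G = "\<lambda>x. (2 * M)\<^sup>2 * indicator (cball 0 (M + 1)) x"])
    show "AE x in lborel. (\<lambda>n. F n x) \<longlonglongrightarrow> f x"
    proof -
      have "N \<in> null_sets lebesgue" using N by (simp add: negligible_iff_null_sets)
      then have "AE x in lebesgue. x \<notin> N" by (rule AE_not_in)
      then have "AE x in lborel. x \<notin> N"
        using AE_completion_iff by blast
      then show ?thesis
      proof eventually_elim
        case (elim x)
        have "isCont (closest_point (cball (0::complex) M)) (f x)"
          using ccp by (simp add: continuous_on_eq_continuous_at)
        then have "(\<lambda>n. closest_point (cball 0 M) (h n x)) \<longlonglongrightarrow> closest_point (cball 0 M) (f x)"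
          using isCont_tendsto_compose hl[OF elim] by blast
        then have "(\<lambda>n. F n x) \<longlonglongrightarrow> k x * closest_point (cball 0 M) (f x)"
          unfolding F_def by (intro tendsto_intros)
        moreover have "closest_point (cball 0 M) (f x) = f x"
          using M(2)[of x] by (intro closest_point_self) simp
        moreover have "k x * f x = f x"
          by (cases "norm x > M") (use M(3)[of x] in \<open>auto simp: k_def\<close>)
        ultimately show ?case by simp
      qed
    qed
    show "(cmod (F n x - f x))\<^sup>2 \<le> (2 * M)\<^sup>2 * indicator (cball 0 (M + 1)) x" for n x
    proof (cases "norm x \<le> M + 1")
      case True
      have "cmod (F n x - f x) \<le> 2 * M"
        using norm_triangle_ineq4[of "F n x" "f x"] F_le[of n x] M(2)[of x] by linarith
      then have "(cmod (F n x - f x))\<^sup>2 \<le> (2 * M)\<^sup>2" by (intro power_mono) auto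
      then show ?thesis using True by simp
    next
      case False
      then show ?thesis using F0[of x n] M(3)[of x] by simp
    qed
  qed simp
  then have "eventually (\<lambda>n. l2norm (\<lambda>x. F n x - f x) < e) sequentially"
    using assms(5) by (rule order_tendstoD)
  then obtain n where "l2norm (\<lambda>x. F n x - f x) < e"
    using eventually_happens by force
  then show thesis
    by (intro that[of "F n"] Fc F0) (auto simp: l2norm_minus_commute[of f])
qed

lemma l2norm_le_ball:
  fixes f :: "'d::finite fn"
  assumes "f \<in> L2" "\<And>x. norm x > R \<Longrightarrow> f x = 0" "\<And>x. norm x \<le> R \<Longrightarrow> cmod (f x) \<le> B" "B \<ge> 0"
  shows "l2norm f \<le> B * sqrt (measure lborel (cball (0::real^'d) R))"
proof -
  have "(\<integral>x. (cmod (f x))\<^sup>2 \<partial>lborel) \<le> (\<integral>x. B\<^sup>2 * indicator (cball (0::real^'d) R) x \<partial>lborel)"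
  proof (rule integral_mono)
    show "(cmod (f x))\<^sup>2 \<le> B\<^sup>2 * indicator (cball 0 R) x" for x
      using assms(2,3)[of x] by (auto simp: indicator_def not_le intro!: power_mono)
  qed (use assms(1) in auto)
  also have "\<dots> = B\<^sup>2 * measure lborel (cball (0::real^'d) R)" by simp
  finally show ?thesis
    unfolding l2norm_def using assms(4) real_sqrt_le_mono by (fastforce simp: real_sqrt_mult)
qed

text \<open>Polynomials approximate uniformly on a ball but have no compact support. So
  \<open>f\<close> is divided by a C1 cutoff \<open>k\<close>, the quotient is approximated by a
  polynomial (Stone-Weierstrass), and the cutoff is multiplied back, which gives a C1 function
  vanishing outside radius \<open>S\<close>.\<close>

lemma continuous_test_fn_approx:
  fixes f :: "'d::finite fn"
  assumes f: "continuous_on UNIV f" "\<And>x. norm x > R \<Longrightarrow> f x = 0" and R: "R > 0" and "e > 0"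
  obtains g where "g \<in> test_fn" "l2norm (\<lambda>x. f x - g x) < e"
proof -
  define S where "S = R + 1"
  define c where "c = (S\<^sup>2 - R\<^sup>2)\<^sup>2"
  have SR: "S\<^sup>2 - R\<^sup>2 > 0" using R by (simp add: S_def power2_eq_square algebra_simps)
  then have c: "c > 0" by (simp add: c_def)
  define k :: "real^'d \<Rightarrow> real" where "k x = (max 0 (S\<^sup>2 - x \<bullet> x))\<^sup>2" for x
  have "C1 (\<lambda>x::real^'d. S\<^sup>2 + (- 1) * (x \<bullet> x))"
    by (intro C1_add C1_const C1_mult C1_inner C1_bounded_linear bounded_linear_ident)
  then have kC1: "C1 k"
    unfolding k_def using C1_compose_real[OF C1_max_0_sq] by simp
  have k_ge: "k x \<ge> c" if "norm x \<le> R" for x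
  proof -
    have "x \<bullet> x \<le> R\<^sup>2" using that by (simp add: power_mono flip: power2_norm_eq_inner)
    then show ?thesis unfolding k_def c_def using SR by (intro power_mono) auto
  qed
  have k0: "k x = 0" if "norm x > S" for x
  proof -
    have "S\<^sup>2 \<le> x \<bullet> x" using that R
      by (simp add: power_mono S_def flip: power2_norm_eq_inner)
    then show ?thesis by (simp add: k_def)
  qed
  have k_le: "k x \<le> S ^ 4" for x
  proof -
    have "max 0 (S\<^sup>2 - x \<bullet> x) \<le> S\<^sup>2" by simp
    then have "k x \<le> (S\<^sup>2)\<^sup>2" unfolding k_def by (intro power_mono) auto
    then show ?thesis by simp
  qed
  have k_nn: "k x \<ge> 0" for x by (simp add: k_def)
  \<comment> \<open>The maximum with \<open>c\<close> keeps the denominator positive where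
    \<open>k\<close> vanishes; on the ball carrying \<open>f\<close> the cutoff is at least
    \<open>c\<close>, so \<open>k\<close> times \<open>q\<close> is \<open>f\<close>
    everywhere.\<close>
  define q where "q x = f x / of_real (max c (k x))" for x
  have qc: "continuous_on UNIV q"
    unfolding q_def using c
    by (intro continuous_intros f C1_continuous[OF kC1]) (auto simp: max_def)
  have qk: "of_real (k x) * q x = f x" for x
  proof (cases "norm x \<le> R")
    case True
    then show ?thesis using k_ge[OF True] c by (simp add: q_def max_def)
  next
    case False
    then show ?thesis using f(2)[of x] by (simp add: q_def)
  qed
  define m where "m = sqrt (measure lborel (cball (0::real^'d) S))"
  \<comment> \<open>The error is multiplied by at most \<open>S ^ 4\<close> from the cutoff and
    \<open>m\<close> from the volume; \<open>m + 1\<close> excludes a zero denominator and makes the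
    final bound strict.\<close>
  define \<delta> where "\<delta> = e / (S ^ 4 * (m + 1))"
  have m: "m \<ge> 0" by (simp add: m_def)
  have S: "S > 0" using R by (simp add: S_def)
  have \<delta>: "\<delta> > 0" using S m \<open>e > 0\<close> by (simp add: \<delta>_def)
  obtain p where p: "polynomial_function p" "\<forall>x\<in>cball 0 S. norm (q x - p x) < \<delta>"
    using Stone_Weierstrass_polynomial_function[of "cball 0 S" q \<delta>] continuous_on_subset[OF qc] \<delta>
    by auto
  define g where "g x = k x *\<^sub>R p x" for x
  have gC1: "C1 g"
    unfolding g_def by (intro C1_scaleR kC1 C1_polynomial_function p)
  have g0: "g x = 0" if "norm x > S" for x using k0[OF that] by (simp add: g_def)
  have gt: "g \<in> test_fn" by (rule test_fnI[OF gC1 g0])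
  have fL: "f \<in> L2" by (rule continuous_compact_support_L2[OF f])
  have "l2norm (\<lambda>x. f x - g x) \<le> (S ^ 4 * \<delta>) * m"
    unfolding m_def
  proof (rule l2norm_le_ball)
    show "f x - g x = 0" if "norm x > S" for x
      using g0[OF that] f(2)[of x] that by (simp add: S_def)
    show "cmod (f x - g x) \<le> S ^ 4 * \<delta>" if "norm x \<le> S" for x
    proof -
      have "f x - g x = of_real (k x) * (q x - p x)"
        using qk[of x] by (simp add: g_def scaleR_conv_of_real right_diff_distrib)
      then have "cmod (f x - g x) = k x * cmod (q x - p x)"
        using k_nn[of x] by (simp add: norm_mult)
      also have "\<dots> \<le> S ^ 4 * \<delta>"
        using p(2)[rule_format, of x] that k_le k_nn S by (intro mult_mono) auto
      finally show ?thesis .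
    qed
  qed (use fL test_fn_L2[OF gt] \<delta> in auto)
  also have "(S ^ 4 * \<delta>) * m = e * (m / (m + 1))"
    using S by (simp add: \<delta>_def)
  also have "\<dots> < e * 1"
    using m \<open>e > 0\<close> by (intro mult_strict_left_mono) auto
  finally have "l2norm (\<lambda>x. f x - g x) < e" by simp
  then show thesis using that gt by blast
qed

lemma test_fn_scale: "f \<in> test_fn \<Longrightarrow> (\<lambda>x. c * f x) \<in> test_fn"
  by (rule test_fn_support, assumption, rule test_fnI)
     (auto intro!: C1_mult C1_const dest: test_fn_C1)

lemma dense_L2_test_fn: "dense_L2 (test_fn :: 'd::finite fn set)"
  unfolding dense_L2_def
proof (intro conjI subsetI ballI impI allI)
  fix f :: "'d fn" and e :: real
  assume f: "f \<in> L2" "l2norm f \<le> 1" "e > 0"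
  \<comment> \<open>Three approximations cost less than \<open>3 * d\<close>, and shrinking by
    \<open>1 / (1 + 3 * d)\<close> to return to the unit ball costs at most \<open>3 * d\<close>
    more: six parts out of eight.\<close>
  define d where "d = e / 8"
  have d: "d > 0" using f by (simp add: d_def)
  obtain f1 M where f1: "f1 \<in> L2" "M > 0" "\<And>x. cmod (f1 x) \<le> M" "\<And>x. norm x > M \<Longrightarrow> f1 x = 0"
    "l2norm (\<lambda>x. f x - f1 x) < d"
    using L2_truncate_approx[OF f(1) d] by blast
  obtain f2 where f2: "continuous_on UNIV f2" "\<And>x. norm x > M + 1 \<Longrightarrow> f2 x = 0"
    "l2norm (\<lambda>x. f1 x - f2 x) < d"
    using bounded_support_continuous_approx[OF f1(1-4) d] by metis
  obtain f3 where f3: "f3 \<in> test_fn" "l2norm (\<lambda>x. f2 x - f3 x) < d"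
    using continuous_test_fn_approx[OF f2(1,2) _ d] f1(2) by (metis add_pos_pos zero_less_one)
  have L: "f2 \<in> L2" "f3 \<in> L2"
    using continuous_compact_support_L2[OF f2(1,2)] test_fn_L2[OF f3(1)] by auto
  have ff3: "l2norm (\<lambda>x. f x - f3 x) < 3 * d"
    using l2norm_diff_triangle[OF f(1) f1(1) L(2)] l2norm_diff_triangle[OF f1(1) L] f1(5) f2(3) f3(2)
    by linarith
  have n3: "l2norm f3 < 1 + 3 * d"
    using l2norm_diff_le[OF L(2) f(1)] ff3 f(2) l2norm_minus_commute[of f3 f] by linarith
  define g where "g x = of_real (1 / (1 + 3 * d)) * f3 x" for x
  have gt: "g \<in> test_fn" unfolding g_def by (rule test_fn_scale[OF f3(1)])
  have "l2norm g = l2norm f3 / (1 + 3 * d)"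
    unfolding g_def l2norm_scale norm_of_real using d by simp
  then have g1: "l2norm g \<le> 1" using n3 d by simp
  have "l2norm (\<lambda>x. f3 x - g x) = 3 * d * l2norm g"
  proof -
    have "(\<lambda>x. f3 x - g x) = (\<lambda>x. of_real (3 * d) * g x)"
    proof
      fix x
      have "f3 x = of_real (1 + 3 * d) * g x"
      proof -
        have "of_real (1 + 3 * d) * of_real (1 / (1 + 3 * d)) = (1 :: complex)"
          unfolding of_real_mult[symmetric] using d by simp
        then show ?thesis by (simp only: g_def mult.assoc[symmetric] mult_1)
      qed
      then show "f3 x - g x = of_real (3 * d) * g x" by (simp add: algebra_simps)
    qed
    then show ?thesis using d by (simp add: l2norm_scale del: of_real_mult)
  qed
  also have "\<dots> \<le> 3 * d" using g1 d by simp
  finally have "l2norm (\<lambda>x. f x - g x) < e"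
    using l2norm_diff_triangle[OF f(1) L(2) test_fn_L2[OF gt]] ff3 d by (simp add: d_def)
  then show "\<exists>g\<in>test_fn. l2norm g \<le> 1 \<and> l2norm (\<lambda>x. f x - g x) < e"
    using gt g1 by blast
qed (simp add: test_fn_L2)

subsection \<open>Phase space translations\<close>

lemma L2_approx_test_fn:
  assumes "f \<in> L2" "e > 0"
  obtains g where "g \<in> test_fn" "l2norm (\<lambda>x. f x - g x) < e"
proof -
  define c where "c = l2norm f + 1"
  have c: "c > 0" by (simp add: c_def add_nonneg_pos)
  define f' where "f' x = of_real (1 / c) * f x" for x
  have "f' \<in> L2" unfolding f'_def using assms(1) by (rule L2_scale)
  moreover have "l2norm f' \<le> 1"
    unfolding f'_def l2norm_scale norm_of_real using c by (simp add: c_def)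
  moreover have "e / c > 0" using c assms(2) by simp
  ultimately obtain g where g: "g \<in> test_fn" "l2norm (\<lambda>x. f' x - g x) < e / c"
    using dense_L2_test_fn unfolding dense_L2_def by blast
  show thesis
  proof (rule that[OF test_fn_scale[OF g(1), of "of_real c"]])
    have "(\<lambda>x. f x - of_real c * g x) = (\<lambda>x. of_real c * (f' x - g x))"
      using c by (auto simp: f'_def right_diff_distrib)
    then have "l2norm (\<lambda>x. f x - of_real c * g x) = c * l2norm (\<lambda>x. f' x - g x)"
      using c by (simp only: l2norm_scale norm_of_real abs_of_pos)
    then show "l2norm (\<lambda>x. f x - of_real c * g x) < e"
      using g(2) c by (simp add: field_simps)
  qed
qed

section \<open>Translation invariance of integrals\<close>

lemma lborel_distr_translate: "distr lborel borel (\<lambda>x. x + a) = (lborel :: 'a::euclidean_space measure)"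
  using lborel_distr_plus[of a] by (simp add: add.commute[of _ a])

lemma nn_integral_translate:
  fixes a :: "'a::euclidean_space"
  assumes [measurable]: "f \<in> borel_measurable borel"
  shows "(\<integral>\<^sup>+x. f (x + a) \<partial>lborel) = (\<integral>\<^sup>+x. f x \<partial>lborel)"
proof -
  have "(\<integral>\<^sup>+x. f x \<partial>lborel) = (\<integral>\<^sup>+x. f x \<partial>(distr lborel borel (\<lambda>x. x + a)))"
    by (simp add: lborel_distr_translate)
  also have "\<dots> = (\<integral>\<^sup>+x. f (x + a) \<partial>lborel)"
    by (subst nn_integral_distr) simp_all
  finally show ?thesis ..
qed

lemma integral_translate:
  fixes a :: "'a::euclidean_space" and f :: "'a \<Rightarrow> 'b::{banach, second_countable_topology}"
  assumes [measurable]: "f \<in> borel_measurable borel"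
  shows "(\<integral>x. f (x + a) \<partial>lborel) = (\<integral>x. f x \<partial>lborel)"
proof -
  have "(\<integral>x. f x \<partial>lborel) = (\<integral>x. f x \<partial>(distr lborel borel (\<lambda>x. x + a)))"
    by (simp add: lborel_distr_translate)
  also have "\<dots> = (\<integral>x. f (x + a) \<partial>lborel)"
    by (subst integral_distr) simp_all
  finally show ?thesis ..
qed

lemma integrable_translate:
  fixes a :: "'a::euclidean_space" and f :: "'a \<Rightarrow> 'b::{banach, second_countable_topology}"
  assumes "integrable lborel f"
  shows "integrable lborel (\<lambda>x. f (x + a))"
proof -
  have "integrable (distr lborel borel (\<lambda>x. x + a)) f"
    using assms by (simp add: lborel_distr_translate)
  then show ?thesis by (rule integrable_distr[rotated]) simp
qed

lemma cis_borel[measurable]: "cis \<in> borel_measurable borel"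
  by (intro borel_measurable_continuous_onI continuous_intros)

section \<open>Isometry and strong continuity of phase space shifts on \<open>L2\<close>\<close>

lemma tau_adj_L2[simp, intro]:
  assumes "f \<in> L2" shows "tau_adj hb z f \<in> L2"
proof (rule L2I)
  have [measurable]: "f \<in> borel_measurable borel" using assms by (rule L2_measurable)
  show "tau_adj hb z f \<in> borel_measurable borel" unfolding tau_adj_def by measurable
  show "integrable lborel (\<lambda>x. (cmod (tau_adj hb z f x))\<^sup>2)"
    using integrable_translate[OF L2_integrable[OF assms]] by (simp add: tau_adj_def norm_mult)
qed

lemma tau_L2[simp, intro]:
  assumes "f \<in> L2" shows "tau hb z f \<in> L2"
proof (rule L2I)
  have [measurable]: "f \<in> borel_measurable borel" using assms by (rule L2_measurable)
  show "tau hb z f \<in> borel_measurable borel" unfolding tau_def by measurable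
  show "integrable lborel (\<lambda>x. (cmod (tau hb z f x))\<^sup>2)"
    using integrable_translate[OF L2_integrable[OF assms], of "- fst z"] by (simp add: tau_def norm_mult)
qed

lemma l2norm_tau_adj[simp]:
  assumes "f \<in> L2" shows "l2norm (tau_adj hb z f) = l2norm f"
proof -
  have [measurable]: "f \<in> borel_measurable borel" using assms by (rule L2_measurable)
  show ?thesis
    using integral_translate[of "\<lambda>x. (cmod (f x))\<^sup>2" "fst z"]
    by (simp add: l2norm_def tau_adj_def norm_mult)
qed

text \<open>Substituting \<open>x + fst z\<close> turns the midpoint \<open>x - fst z / 2\<close> of
  \<open>tau\<close> into the \<open>x + fst z / 2\<close> of \<open>tau_adj\<close>, and
  conjugation reverses the phase; so \<open>tau_adj\<close> is the adjoint of
  \<open>tau\<close>.\<close>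

lemma l2inner_tau:
  assumes "f \<in> L2" "g \<in> L2"
  shows "l2inner g (tau hb z f) = l2inner (tau_adj hb z g) f"
proof -
  have [measurable]: "f \<in> borel_measurable borel" "g \<in> borel_measurable borel"
    using assms by (auto intro: L2_measurable)
  have "(\<lambda>x. cnj (g x) * tau hb z f x) \<in> borel_measurable borel"
    unfolding tau_def by measurable
  from integral_translate[OF this, of "fst z"]
  have "l2inner g (tau hb z f) = (\<integral>x. cnj (g (x + fst z)) * tau hb z f (x + fst z) \<partial>lborel)"
    by (simp add: l2inner_def)
  also have "\<dots> = l2inner (tau_adj hb z g) f"
    unfolding l2inner_def
  proof (intro Bochner_Integration.integral_cong refl)
    fix x
    have "x + fst z - (1 / 2) *\<^sub>R fst z = x + (1 / 2) *\<^sub>R fst z"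
      by (simp add: vec_eq_iff)
    then have "tau hb z f (x + fst z) = cis ((snd z \<bullet> (x + (1 / 2) *\<^sub>R fst z)) / hb) * f x"
      by (simp only: tau_def add_diff_cancel_right')
    then show "cnj (g (x + fst z)) * tau hb z f (x + fst z) = cnj (tau_adj hb z g x) * f x"
      by (simp add: tau_adj_def cis_cnj)
  qed
  finally show ?thesis .
qed

lemma tau_adj_0[simp]: "tau_adj hb 0 f = f"
  by (simp add: tau_adj_def)

lemma tau_adj_diff: "tau_adj hb z (\<lambda>x. f x - g x) = (\<lambda>x. tau_adj hb z f x - tau_adj hb z g x)"
  by (simp add: tau_adj_def right_diff_distrib)

text \<open>The Heisenberg--Weyl relation: the phase is constant in \<open>x\<close>.\<close>
lemma tau_adj_add:
  "\<exists>c. cmod c = 1 \<and> (\<forall>f. tau_adj hb (z + y) f = (\<lambda>x. c * tau_adj hb y (tau_adj hb z f) x))"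
proof (intro exI conjI allI ext)
  let ?c = "cis ((snd z \<bullet> fst y - snd y \<bullet> fst z) / 2 / hb)"
  show "cmod ?c = 1" by simp
  fix f :: "'a fn" and x
  have "- (snd (z + y) \<bullet> (x + (1 / 2) *\<^sub>R fst (z + y))) / hb =
    (snd z \<bullet> fst y - snd y \<bullet> fst z) / 2 / hb + - (snd y \<bullet> (x + (1 / 2) *\<^sub>R fst y)) / hb
    + - (snd z \<bullet> (x + fst y + (1 / 2) *\<^sub>R fst z)) / hb"
    unfolding add_divide_distrib[symmetric]
    by (intro arg_cong[where f = "\<lambda>t. t / hb"]) (simp add: inner_add field_simps)
  moreover have "x + fst (z + y) = x + fst y + fst z" by simp
  ultimately show "tau_adj hb (z + y) f x = ?c * tau_adj hb y (tau_adj hb z f) x"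
    by (simp only: tau_adj_def cis_mult[symmetric] mult.assoc)
qed

text \<open>Stability of test functions under shifts lets the gradient form, which is tested on
  \<open>test_fn\<close> only, be evaluated along a whole orbit.\<close>

lemma tau_adj_test_fn[simp, intro]:
  fixes f :: "'d::finite fn"
  assumes "f \<in> test_fn" shows "tau_adj hb z f \<in> test_fn"
proof -
  obtain R where R: "R > 0" "\<And>x. norm x > R \<Longrightarrow> f x = 0" using test_fn_support[OF assms] by blast
  have "C1 (\<lambda>x. (- (snd z \<bullet> ((1 / 2) *\<^sub>R fst z)) / hb) + (- 1 / hb) * (snd z \<bullet> x))"
    by (intro C1_add C1_const C1_mult C1_inner C1_bounded_linear bounded_linear_ident)
  then have "C1 (\<lambda>x. - (snd z \<bullet> (x + (1 / 2) *\<^sub>R fst z)) / hb)"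
    by (simp add: inner_add_right add_divide_distrib diff_divide_distrib add.commute)
  from C1_mult[OF C1_compose_real[OF C1_cis this] C1_translate[OF test_fn_C1[OF assms]]]
  have "C1 (tau_adj hb z f)"
    unfolding tau_adj_def .
  then show ?thesis
  proof (rule test_fnI[where R = "R + norm (fst z)"])
    fix x :: "real^'d" assume "R + norm (fst z) < norm x"
    then have "norm (x + fst z) > R"
      using norm_triangle_ineq4[of "x + fst z" "fst z"] by simp
    then show "tau_adj hb z f x = 0" by (simp add: tau_adj_def R)
  qed
qed

text \<open>For a continuous compactly supported function the shifts converge pointwise. A
  convergent sequence of shifts is bounded, so all the shifted functions live in one ball of radius
  \<open>R + K\<close> under one bound \<open>B\<close>.\<close>

lemma tau_adj_tendsto_test_fn:
  fixes f :: "'d::finite fn"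
  assumes f: "f \<in> test_fn" and z: "Z \<longlonglongrightarrow> z"
  shows "(\<lambda>n. l2norm (\<lambda>x. tau_adj hb (Z n) f x - tau_adj hb z f x)) \<longlonglongrightarrow> 0"
proof -
  obtain R where R: "R > 0" "\<And>x. norm x > R \<Longrightarrow> f x = 0" using test_fn_support[OF f] by blast
  have fc: "continuous_on UNIV f" by (intro C1_continuous test_fn_C1 f)
  obtain B where B: "B > 0" "\<And>x. norm (f x) \<le> B"
    using continuous_compact_support_bounded[OF fc R(2)] by blast
  have z1: "(\<lambda>n. fst (Z n)) \<longlonglongrightarrow> fst z" and z2: "(\<lambda>n. snd (Z n)) \<longlonglongrightarrow> snd z"
    using z by (auto intro: tendsto_intros)
  obtain K where K: "K > 0" "\<And>n. norm (fst (Z n)) \<le> K"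
    using convergent_imp_Bseq[OF convergentI[OF z1]] by (auto simp: Bseq_def)
  have Kz: "norm (fst z) \<le> K"
    by (rule Lim_bounded[OF tendsto_norm[OF z1]]) (use K in auto)
  have t0: "tau_adj hb w f x = 0" if "norm (fst w) \<le> K" "norm x > R + K" for w x
  proof -
    have "norm (x + fst w) > R"
      using norm_triangle_ineq4[of "x + fst w" "fst w"] that by simp
    then show ?thesis by (simp add: tau_adj_def R)
  qed
  have tB: "cmod (tau_adj hb w f x) \<le> B" for w x
    by (simp add: tau_adj_def norm_mult B)
  show ?thesis
  proof (rule l2norm_dominated_convergence[where G = "\<lambda>x. (2 * B)\<^sup>2 * indicator (cball 0 (R + K)) x"])
    show "AE x in lborel. (\<lambda>n. tau_adj hb (Z n) f x) \<longlonglongrightarrow> tau_adj hb z f x"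
    proof (rule AE_I2)
      fix x
      have "isCont f (x + fst z)" using fc by (simp add: continuous_on_eq_continuous_at)
      moreover have "(\<lambda>n. x + fst (Z n)) \<longlonglongrightarrow> x + fst z" by (intro tendsto_intros z1)
      ultimately have a: "(\<lambda>n. f (x + fst (Z n))) \<longlonglongrightarrow> f (x + fst z)"
        by (rule isCont_tendsto_compose)
      have cc: "isCont cis t" for t
        using continuous_on_cis[of UNIV "\<lambda>t. t"] by (simp add: continuous_on_eq_continuous_at)
      have b: "(\<lambda>n. - (snd (Z n) \<bullet> (x + (1 / 2) *\<^sub>R fst (Z n))) / hb)
        \<longlonglongrightarrow> - (snd z \<bullet> (x + (1 / 2) *\<^sub>R fst z)) / hb"
        unfolding divide_inverse[of _ hb] by (intro tendsto_intros z1 z2)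
      show "(\<lambda>n. tau_adj hb (Z n) f x) \<longlonglongrightarrow> tau_adj hb z f x"
        unfolding tau_adj_def by (intro tendsto_mult a isCont_tendsto_compose[OF cc b])
    qed
    show "(cmod (tau_adj hb (Z n) f x - tau_adj hb z f x))\<^sup>2 \<le> (2 * B)\<^sup>2 * indicator (cball 0 (R + K)) x" for n x
    proof (cases "norm x \<le> R + K")
      case True
      have "cmod (tau_adj hb (Z n) f x - tau_adj hb z f x) \<le> 2 * B"
        using norm_triangle_ineq4[of "tau_adj hb (Z n) f x" "tau_adj hb z f x"] tB[of "Z n" x] tB[of z x]
        by linarith
      then have "(cmod (tau_adj hb (Z n) f x - tau_adj hb z f x))\<^sup>2 \<le> (2 * B)\<^sup>2" by (intro power_mono) auto
      then show ?thesis using True by simp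
    next
      case False
      then show ?thesis using t0[OF K(2)[of n]] t0[OF Kz] by simp
    qed
  qed (use test_fn_L2[OF f] in auto)
qed

text \<open>Every shift is an isometry, so the error of replacing \<open>f\<close> by a test
  function is the same for all \<open>n\<close>; three thirds of \<open>e\<close> then add
  up.\<close>

lemma tau_adj_tendsto:
  fixes f :: "'d::finite fn"
  assumes f: "f \<in> L2" and z: "Z \<longlonglongrightarrow> z"
  shows "(\<lambda>n. l2norm (\<lambda>x. tau_adj hb (Z n) f x - tau_adj hb z f x)) \<longlonglongrightarrow> 0"
proof (rule LIMSEQ_I)
  fix e :: real assume e: "e > 0"
  then have e3: "e / 3 > 0" by simp
  obtain g where g: "g \<in> test_fn" "l2norm (\<lambda>x. f x - g x) < e / 3"
    using L2_approx_test_fn[OF f e3] by blast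
  have gL: "g \<in> L2" by (rule test_fn_L2[OF g(1)])
  obtain N where N: "\<And>n. n \<ge> N \<Longrightarrow> l2norm (\<lambda>x. tau_adj hb (Z n) g x - tau_adj hb z g x) < e / 3"
    using LIMSEQ_D[OF tau_adj_tendsto_test_fn[OF g(1) z] e3] by auto
  have "l2norm (\<lambda>x. tau_adj hb (Z n) f x - tau_adj hb z f x) < e" if "n \<ge> N" for n
  proof -
    have fg: "l2norm (\<lambda>x. tau_adj hb w f x - tau_adj hb w g x) < e / 3" for w
      using g(2) l2norm_tau_adj[of "\<lambda>x. f x - g x" hb w] f gL by (simp add: tau_adj_diff)
    have "l2norm (\<lambda>x. tau_adj hb (Z n) f x - tau_adj hb z f x)
      \<le> l2norm (\<lambda>x. tau_adj hb (Z n) f x - tau_adj hb (Z n) g x)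
       + l2norm (\<lambda>x. tau_adj hb (Z n) g x - tau_adj hb z f x)"
      by (rule l2norm_diff_triangle) (use f gL in auto)
    also have "l2norm (\<lambda>x. tau_adj hb (Z n) g x - tau_adj hb z f x)
      \<le> l2norm (\<lambda>x. tau_adj hb (Z n) g x - tau_adj hb z g x)
       + l2norm (\<lambda>x. tau_adj hb z g x - tau_adj hb z f x)"
      by (rule l2norm_diff_triangle) (use f gL in auto)
    finally show ?thesis
      using fg[of "Z n"] fg[of z] N[OF that] l2norm_minus_commute[of "tau_adj hb z g" "tau_adj hb z f"]
      by linarith
  qed
  then show "\<exists>N. \<forall>n\<ge>N. norm (l2norm (\<lambda>x. tau_adj hb (Z n) f x - tau_adj hb z f x) - 0) < e"
    by auto
qed

lemma l2inner_tendsto: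
  assumes L: "\<And>n. f n \<in> L2" "\<And>n. g n \<in> L2" "f0 \<in> L2" "g0 \<in> L2"
    and f: "(\<lambda>n. l2norm (\<lambda>x. f n x - f0 x)) \<longlonglongrightarrow> 0"
    and g: "(\<lambda>n. l2norm (\<lambda>x. g n x - g0 x)) \<longlonglongrightarrow> 0"
  shows "(\<lambda>n. l2inner (g n) (f n)) \<longlonglongrightarrow> l2inner g0 f0"
proof -
  have "(\<lambda>n. l2inner (g n) (f n) - l2inner g0 f0) \<longlonglongrightarrow> 0"
  proof (rule Lim_null_comparison)
    let ?u = "\<lambda>n. l2norm (\<lambda>x. f n x - f0 x)" and ?v = "\<lambda>n. l2norm (\<lambda>x. g n x - g0 x)"
    show "\<forall>\<^sub>F n in sequentially. norm (l2inner (g n) (f n) - l2inner g0 f0)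
      \<le> ?v n * ?u n + ?v n * l2norm f0 + l2norm g0 * ?u n"
    proof (rule always_eventually, rule allI)
      fix n
      note CS = l2inner_CS[OF L2_diff[OF L(1,3)] L2_diff[OF L(2,4)], of n n]
        l2inner_CS[OF L(3) L2_diff[OF L(2,4)], of n] l2inner_CS[OF L2_diff[OF L(1,3)] L(4), of n]
      have eq: "l2inner (g n) (f n) - l2inner g0 f0 =
         l2inner (\<lambda>x. g n x - g0 x) (\<lambda>x. f n x - f0 x) + l2inner (\<lambda>x. g n x - g0 x) f0
         + l2inner g0 (\<lambda>x. f n x - f0 x)"
        by (simp only: l2inner_diff_left[OF L2_diff[OF L(1,3)] L(2,4)] l2inner_diff_left[OF L(3) L(2,4)]
            l2inner_diff_right[OF L(2) L(1,3)] l2inner_diff_right[OF L(4) L(1,3)]) simp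
      show "norm (l2inner (g n) (f n) - l2inner g0 f0)
        \<le> ?v n * ?u n + ?v n * l2norm f0 + l2norm g0 * ?u n"
        unfolding eq by (rule order_trans[OF norm_triangle_ineq add_mono[OF order_trans[OF norm_triangle_ineq add_mono[OF CS(1,2)]] CS(3)]])
    qed
    have "(\<lambda>n. ?v n * ?u n + ?v n * l2norm f0 + l2norm g0 * ?u n) \<longlonglongrightarrow> 0 * 0 + 0 * l2norm f0 + l2norm g0 * 0"
      by (intro tendsto_add tendsto_mult tendsto_const f g)
    then show "(\<lambda>n. ?v n * ?u n + ?v n * l2norm f0 + l2norm g0 * ?u n) \<longlonglongrightarrow> 0"
      by (simp only: mult_zero_left mult_zero_right add_0_left)
  qed
  then show ?thesis by (rule LIM_zero_cancel)
qed

lemma continuous_on_l2inner_tau_adj: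
  assumes "f \<in> L2" "g \<in> L2"
  shows "continuous_on UNIV (\<lambda>z. l2inner g (tau_adj hb z f))"
    "continuous_on UNIV (\<lambda>z. l2inner (tau_adj hb z g) f)"
proof -
  have *: "(\<lambda>n. l2norm (\<lambda>x. h x - h x)) \<longlonglongrightarrow> 0" for h :: "'a fn" by simp
  show "continuous_on UNIV (\<lambda>z. l2inner g (tau_adj hb z f))"
    unfolding continuous_on_sequentially o_def
    using l2inner_tendsto[OF _ _ _ _ tau_adj_tendsto[OF assms(1)] *[of g]] assms by simp
  show "continuous_on UNIV (\<lambda>z. l2inner (tau_adj hb z g) f)"
    unfolding continuous_on_sequentially o_def
    using l2inner_tendsto[OF _ _ _ _ *[of f] tau_adj_tendsto[OF assms(2)]] assms by simp
qed

subsection \<open>Plancherel and Moyal inequalities\<close>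

lemma lborel_integral_prod:
  fixes f :: "'a::euclidean_space \<Rightarrow> real \<Rightarrow> complex"
  assumes "\<And>b. b \<in> Basis \<Longrightarrow> integrable lborel (f b)"
  shows "(\<integral>x. (\<Prod>b\<in>Basis. f b (x \<bullet> b)) \<partial>lborel) = (\<Prod>b\<in>Basis. \<integral>t. f b t \<partial>lborel)"
proof -
  interpret product_sigma_finite "\<lambda>_::'a. lborel :: real measure" ..
  have [measurable]: "f b \<in> borel_measurable borel" if "b \<in> Basis" for b
    using borel_measurable_integrable[OF assms[OF that]] by simp
  have eq: "(\<Sum>b\<in>Basis. g b *\<^sub>R b) \<bullet> c = g c" if "c \<in> Basis" for g :: "'a \<Rightarrow> real" and c
    using that by (simp add: inner_sum_left inner_Basis if_distrib cong: if_cong)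
  have "(\<integral>x. (\<Prod>b\<in>Basis. f b (x \<bullet> b)) \<partial>(lborel :: 'a measure)) =
    (\<integral>g. (\<Prod>b\<in>Basis. f b ((\<Sum>b\<in>Basis. g b *\<^sub>R b) \<bullet> b)) \<partial>(\<Pi>\<^sub>M b\<in>Basis. lborel))"
    by (subst lborel_eq, subst integral_distr) simp_all
  also have "\<dots> = (\<integral>g. (\<Prod>b\<in>Basis. f b (g b)) \<partial>(\<Pi>\<^sub>M b\<in>Basis. lborel))"
    by (intro Bochner_Integration.integral_cong prod.cong refl) (simp add: eq)
  also have "\<dots> = (\<Prod>b\<in>Basis. \<integral>t. f b t \<partial>lborel)"
    by (rule product_integral_prod) (use assms in auto)
  finally show ?thesis .
qed

lemma integrable_gaussian: 
  assumes "\<epsilon> \<noteq> 0" shows "integrable lborel (\<lambda>x::real. exp (- (\<epsilon> * x)\<^sup>2 / 2))"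
    "(\<integral>x. exp (- (\<epsilon> * x)\<^sup>2 / 2) \<partial>lborel) = sqrt (2 * pi) / \<bar>\<epsilon>\<bar>"
proof -
  have "integrable lborel (\<lambda>x. sqrt (2 * pi) * std_normal_density x)"
    by (intro integrable_mult_right integrable_normal_density) simp
  then have 1: "integrable lborel (\<lambda>x::real. exp (- x\<^sup>2 / 2))"
    by (simp add: std_normal_density_def)
  have "(\<integral>x. std_normal_density x \<partial>lborel) = 1"
    by (rule integral_normal_density) simp
  then have 2: "(\<integral>x. exp (- x\<^sup>2 / 2) \<partial>lborel) = sqrt (2 * pi)"
    by (simp add: std_normal_density_def field_simps)
  show "integrable lborel (\<lambda>x::real. exp (- (\<epsilon> * x)\<^sup>2 / 2))"
    using lborel_integrable_real_affine[OF 1 assms, of 0] by simp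
  show "(\<integral>x. exp (- (\<epsilon> * x)\<^sup>2 / 2) \<partial>lborel) = sqrt (2 * pi) / \<bar>\<epsilon>\<bar>"
    using lborel_integral_real_affine[OF assms, of "\<lambda>x. exp (- x\<^sup>2 / 2)" 0] 2 assms
    by (simp add: field_simps)
qed

text \<open>The Fourier transform of the Gaussian is read off from the characteristic function of
  the standard normal law, then rescaled by an affine substitution.\<close>

lemma integral_gaussian_cis:
  assumes "\<epsilon> \<noteq> 0"
  shows "integrable lborel (\<lambda>x::real. complex_of_real (exp (- (\<epsilon> * x)\<^sup>2 / 2)) * cis (t * x))"
    "(\<integral>x. complex_of_real (exp (- (\<epsilon> * x)\<^sup>2 / 2)) * cis (t * x) \<partial>lborel)
      = complex_of_real (sqrt (2 * pi) / \<bar>\<epsilon>\<bar> * exp (- (t / \<epsilon>)\<^sup>2 / 2))"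
proof -
  show "integrable lborel (\<lambda>x::real. complex_of_real (exp (- (\<epsilon> * x)\<^sup>2 / 2)) * cis (t * x))"
    by (rule Bochner_Integration.integrable_bound[OF integrable_gaussian(1)[OF assms]])
       (auto simp: norm_mult)
  have "char std_normal_distribution s = (\<integral>x. std_normal_density x *\<^sub>R cis (s * x) \<partial>lborel)" for s
    unfolding char_def by (subst integral_density) (auto simp: cis_conv_exp)
  then have *: "(\<integral>x. std_normal_density x *\<^sub>R cis (s * x) \<partial>lborel) = complex_of_real (exp (- s\<^sup>2 / 2))" for s
    by (simp add: char_std_normal_distribution)
  have 1: "(\<integral>x. complex_of_real (exp (- x\<^sup>2 / 2)) * cis (s * x) \<partial>lborel)
      = complex_of_real (sqrt (2 * pi) * exp (- s\<^sup>2 / 2))" for s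
  proof -
    have "complex_of_real (exp (- x\<^sup>2 / 2)) * cis (s * x)
      = complex_of_real (sqrt (2 * pi)) * (std_normal_density x *\<^sub>R cis (s * x))" for x
    proof -
      have "exp (- x\<^sup>2 / 2) = sqrt (2 * pi) * std_normal_density x"
        by (simp add: std_normal_density_def)
      then show ?thesis
        by (simp only: scaleR_conv_of_real mult.assoc[symmetric] of_real_mult)
    qed
    then show ?thesis by (simp only: integral_mult_right_zero * of_real_mult)
  qed
  have scale_eq: "I = inverse a *\<^sub>R J" if "a *\<^sub>R I = J" "a \<noteq> 0" for a and I J :: complex
    using that by auto
  have "(\<integral>x. complex_of_real (exp (- x\<^sup>2 / 2)) * cis (t / \<epsilon> * x) \<partial>lborel) =
    \<bar>\<epsilon>\<bar> *\<^sub>R (\<integral>x. complex_of_real (exp (- (\<epsilon> * x)\<^sup>2 / 2)) * cis (t * x) \<partial>lborel)"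
    using lborel_integral_real_affine[OF assms, of "\<lambda>x. complex_of_real (exp (- x\<^sup>2 / 2)) * cis (t / \<epsilon> * x)" 0] assms
    by simp
  then have "\<bar>\<epsilon>\<bar> *\<^sub>R (\<integral>x. complex_of_real (exp (- (\<epsilon> * x)\<^sup>2 / 2)) * cis (t * x) \<partial>lborel)
    = complex_of_real (sqrt (2 * pi) * exp (- (t / \<epsilon>)\<^sup>2 / 2))"
    using 1[of "t / \<epsilon>"] by (simp only:)
  then have "(\<integral>x. complex_of_real (exp (- (\<epsilon> * x)\<^sup>2 / 2)) * cis (t * x) \<partial>lborel)
    = inverse \<bar>\<epsilon>\<bar> *\<^sub>R complex_of_real (sqrt (2 * pi) * exp (- (t / \<epsilon>)\<^sup>2 / 2))"
    by (rule scale_eq) (use assms in simp)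
  also have "\<dots> = complex_of_real (inverse \<bar>\<epsilon>\<bar> * (sqrt (2 * pi) * exp (- (t / \<epsilon>)\<^sup>2 / 2)))"
    by (simp only: scaleR_conv_of_real of_real_mult)
  also have "inverse \<bar>\<epsilon>\<bar> * (sqrt (2 * pi) * exp (- (t / \<epsilon>)\<^sup>2 / 2)) = sqrt (2 * pi) / \<bar>\<epsilon>\<bar> * exp (- (t / \<epsilon>)\<^sup>2 / 2)"
    by (simp only: divide_inverse mult_ac)
  finally show "(\<integral>x. complex_of_real (exp (- (\<epsilon> * x)\<^sup>2 / 2)) * cis (t * x) \<partial>lborel)
      = complex_of_real (sqrt (2 * pi) / \<bar>\<epsilon>\<bar> * exp (- (t / \<epsilon>)\<^sup>2 / 2))" .
qed

text \<open>The Gaussian with exponent minus half the squared norm of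
  \<open>\<epsilon> \<xi>\<close>, written as a product over coordinates so that its integrals
  factor into one-dimensional ones.\<close>

definition gauss_wt :: "real \<Rightarrow> 'a::euclidean_space \<Rightarrow> real" where
  "gauss_wt \<epsilon> \<xi> = (\<Prod>b\<in>Basis. exp (- (\<epsilon> * (\<xi> \<bullet> b))\<^sup>2 / 2))"

text \<open>The Fourier transform of \<open>gauss_wt\<close>, again a product of one-dimensional
  Gaussians.\<close>

definition gauss_ker :: "real \<Rightarrow> 'a::euclidean_space \<Rightarrow> real" where
  "gauss_ker \<epsilon> w = (\<Prod>b\<in>Basis. sqrt (2 * pi) / \<bar>\<epsilon>\<bar> * exp (- ((w \<bullet> b) / \<epsilon>)\<^sup>2 / 2))"

lemma gauss_nonneg[simp]: "0 \<le> gauss_wt \<epsilon> \<xi>" "0 \<le> gauss_ker \<epsilon> w"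
  by (auto simp: gauss_wt_def gauss_ker_def intro!: prod_nonneg)

lemma gauss_measurable[measurable]:
  "gauss_wt \<epsilon> \<in> borel_measurable borel" "gauss_ker \<epsilon> \<in> borel_measurable borel"
  unfolding gauss_wt_def gauss_ker_def by measurable

lemma nn_integral_gaussian:
  "\<epsilon> \<noteq> 0 \<Longrightarrow> (\<integral>\<^sup>+x. ennreal (exp (- (\<epsilon> * x)\<^sup>2 / 2)) \<partial>lborel) = ennreal (sqrt (2 * pi) / \<bar>\<epsilon>\<bar>)"
  using integrable_gaussian by (subst nn_integral_eq_integral) auto

lemma integrable_gauss_wt:
  assumes "\<epsilon> \<noteq> 0" shows "integrable lborel (gauss_wt \<epsilon> :: 'a::euclidean_space \<Rightarrow> real)"
proof (rule integrableI_bounded)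
  have "(\<integral>\<^sup>+\<xi>. ennreal (norm (gauss_wt \<epsilon> \<xi>)) \<partial>(lborel :: 'a measure)) =
    (\<integral>\<^sup>+\<xi>. (\<Prod>b\<in>Basis. ennreal (exp (- (\<epsilon> * (\<xi> \<bullet> b))\<^sup>2 / 2))) \<partial>(lborel :: 'a measure))"
    by (simp add: gauss_wt_def prod_ennreal abs_prod)
  also have "\<dots> = (\<Prod>b\<in>(Basis::'a set). ennreal (sqrt (2 * pi) / \<bar>\<epsilon>\<bar>))"
    unfolding nn_integral_gaussian[OF assms, symmetric]
    by (rule nn_integral_lborel_prod) simp_all
  also have "\<dots> < \<infinity>" by (simp add: prod_ennreal ennreal_power)
  finally show "(\<integral>\<^sup>+\<xi>. ennreal (norm (gauss_wt \<epsilon> \<xi>)) \<partial>(lborel :: 'a measure)) < \<infinity>" .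
qed simp

lemma gauss_wt_fourier:
  fixes w :: "'a::euclidean_space"
  assumes "\<epsilon> \<noteq> 0"
  shows "(\<integral>\<xi>. complex_of_real (gauss_wt \<epsilon> \<xi>) * cis (\<xi> \<bullet> w) \<partial>lborel) = complex_of_real (gauss_ker \<epsilon> w)"
proof -
  have cis_sum: "cis (\<Sum>b\<in>A. f b) = (\<Prod>b\<in>A. cis (f b))" for A :: "'a set" and f
    by (induct A rule: infinite_finite_induct) (simp_all add: cis_mult[symmetric])
  have "complex_of_real (gauss_wt \<epsilon> \<xi>) * cis (\<xi> \<bullet> w)
    = (\<Prod>b\<in>Basis. complex_of_real (exp (- (\<epsilon> * (\<xi> \<bullet> b))\<^sup>2 / 2)) * cis ((w \<bullet> b) * (\<xi> \<bullet> b)))" for \<xi>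
  proof -
    have "\<xi> \<bullet> w = (\<Sum>b\<in>Basis. (w \<bullet> b) * (\<xi> \<bullet> b))"
      by (subst euclidean_inner) (simp add: mult.commute)
    then show ?thesis by (simp only: gauss_wt_def cis_sum prod.distrib of_real_prod)
  qed
  then have "(\<integral>\<xi>. complex_of_real (gauss_wt \<epsilon> \<xi>) * cis (\<xi> \<bullet> w) \<partial>lborel) =
    (\<integral>\<xi>. (\<Prod>b\<in>Basis. (\<lambda>b t. complex_of_real (exp (- (\<epsilon> * t)\<^sup>2 / 2)) * cis ((w \<bullet> b) * t)) b (\<xi> \<bullet> b)) \<partial>lborel)"
    by simp
  also have "\<dots> = complex_of_real (gauss_ker \<epsilon> w)"
    by (subst lborel_integral_prod)
       (simp_all only: integral_gaussian_cis[OF assms] gauss_ker_def of_real_prod)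
  finally show ?thesis .
qed

text \<open>Height and width of the kernel cancel except for a factor \<open>2 * pi * hb\<close> per
  coordinate. The mass is thus independent of \<open>\<epsilon>\<close>, and the Plancherel bound
  obtained from it survives the removal of the regularisation.\<close>

lemma nn_integral_gauss_ker:
  assumes e: "\<epsilon> \<noteq> 0" and hb: "hb > 0"
  shows "(\<integral>\<^sup>+w. ennreal (gauss_ker \<epsilon> (w /\<^sub>R hb)) \<partial>(lborel :: 'a::euclidean_space measure))
    = ennreal ((2 * pi * hb) ^ DIM('a))"
proof -
  define c where "c = sqrt (2 * pi) / \<bar>\<epsilon>\<bar>"
  define k where "k = 1 / (hb * \<epsilon>)"
  have c: "c \<ge> 0" and k: "k \<noteq> 0" using assms by (auto simp: c_def k_def)
  have "(w /\<^sub>R hb) \<bullet> b / \<epsilon> = k * (w \<bullet> b)" for w b :: 'a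
    by (simp add: k_def divide_inverse mult_ac)
  then have "gauss_ker \<epsilon> (w /\<^sub>R hb) = (\<Prod>b\<in>Basis. c * exp (- (k * (w \<bullet> b))\<^sup>2 / 2))" for w :: 'a
    by (simp only: gauss_ker_def c_def)
  then have "(\<integral>\<^sup>+w. ennreal (gauss_ker \<epsilon> (w /\<^sub>R hb)) \<partial>(lborel :: 'a measure)) =
    (\<integral>\<^sup>+w. (\<Prod>b\<in>Basis. ennreal (c * exp (- (k * (w \<bullet> b))\<^sup>2 / 2))) \<partial>(lborel :: 'a measure))"
    using c by (simp add: prod_ennreal)
  also have "\<dots> = (\<Prod>b\<in>(Basis::'a set). \<integral>\<^sup>+t. ennreal (c * exp (- (k * t)\<^sup>2 / 2)) \<partial>lborel)"
    by (rule nn_integral_lborel_prod) simp_all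
  also have "(\<integral>\<^sup>+t. ennreal (c * exp (- (k * t)\<^sup>2 / 2)) \<partial>lborel) = ennreal (2 * pi * hb)"
  proof -
    have "(\<integral>\<^sup>+t. ennreal (c * exp (- (k * t)\<^sup>2 / 2)) \<partial>lborel)
      = (\<integral>\<^sup>+t. ennreal c * ennreal (exp (- (k * t)\<^sup>2 / 2)) \<partial>lborel)"
      using c by (simp only: ennreal_mult exp_ge_zero)
    also have "\<dots> = ennreal c * (\<integral>\<^sup>+t. ennreal (exp (- (k * t)\<^sup>2 / 2)) \<partial>lborel)"
      by (rule nn_integral_cmult) simp
    also have "\<dots> = ennreal (c * (sqrt (2 * pi) / \<bar>k\<bar>))"
      unfolding nn_integral_gaussian[OF k] using c by (intro ennreal_mult[symmetric]) auto
    also have "c * (sqrt (2 * pi) / \<bar>k\<bar>) = (sqrt (2 * pi) * sqrt (2 * pi)) * hb"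
      using e hb by (simp add: c_def k_def abs_mult divide_inverse mult_ac del: real_sqrt_mult_self)
    also have "\<dots> = 2 * pi * hb" by simp
    finally show ?thesis .
  qed
  finally have eq: "(\<integral>\<^sup>+w. ennreal (gauss_ker \<epsilon> (w /\<^sub>R hb)) \<partial>(lborel :: 'a measure))
    = ennreal (2 * pi * hb) ^ DIM('a)" by simp
  have "0 \<le> 2 * pi * hb" using hb by simp
  then show ?thesis unfolding eq by (rule ennreal_power)
qed

section \<open>Tonelli's theorem and integrals of tensor products\<close>

lemma nn_integral_lborel_iterated:
  fixes f :: "'a::euclidean_space \<times> 'b::euclidean_space \<Rightarrow> ennreal"
  assumes "f \<in> borel_measurable borel"
  shows "(\<integral>\<^sup>+z. f z \<partial>lborel) = (\<integral>\<^sup>+x. \<integral>\<^sup>+y. f (x, y) \<partial>lborel \<partial>lborel)"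
    "(\<integral>\<^sup>+z. f z \<partial>lborel) = (\<integral>\<^sup>+y. \<integral>\<^sup>+x. f (x, y) \<partial>lborel \<partial>lborel)"
proof -
  have m: "f \<in> borel_measurable (lborel \<Otimes>\<^sub>M lborel)"
    using assms by (simp add: lborel_prod)
  show "(\<integral>\<^sup>+z. f z \<partial>lborel) = (\<integral>\<^sup>+x. \<integral>\<^sup>+y. f (x, y) \<partial>lborel \<partial>lborel)"
    using lborel.nn_integral_fst[OF m] by (simp add: lborel_prod)
  then show "(\<integral>\<^sup>+z. f z \<partial>lborel) = (\<integral>\<^sup>+y. \<integral>\<^sup>+x. f (x, y) \<partial>lborel \<partial>lborel)"
    using lborel_pair.Fubini[OF m] by simp
qed

lemma integrable_tensor:
  fixes a :: "'a::euclidean_space \<Rightarrow> complex" and b :: "'b::euclidean_space \<Rightarrow> complex"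
  assumes a: "integrable lborel a" and b: "integrable lborel b"
  shows "integrable lborel (\<lambda>p. a (fst p) * b (snd p))"
    "(\<integral>p. a (fst p) * b (snd p) \<partial>lborel) = (\<integral>x. a x \<partial>lborel) * (\<integral>y. b y \<partial>lborel)"
proof -
  have [measurable]: "a \<in> borel_measurable borel" "b \<in> borel_measurable borel"
    using borel_measurable_integrable[OF a] borel_measurable_integrable[OF b] by auto
  have m: "(\<lambda>p. a (fst p) * b (snd p)) \<in> borel_measurable (borel \<Otimes>\<^sub>M borel)" by measurable
  then have m': "(\<lambda>p. a (fst p) * b (snd p)) \<in> borel_measurable borel" by (simp only: borel_prod)
  show i: "integrable lborel (\<lambda>p. a (fst p) * b (snd p))"
  proof (rule integrableI_bounded)
    have "(\<lambda>p. ennreal (norm (a (fst p) * b (snd p)))) \<in> borel_measurable borel" using m' by measurable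
    from nn_integral_lborel_iterated(1)[OF this]
    have "(\<integral>\<^sup>+p. ennreal (norm (a (fst p) * b (snd p))) \<partial>lborel)
      = (\<integral>\<^sup>+x. \<integral>\<^sup>+y. ennreal (norm (a x)) * ennreal (norm (b y)) \<partial>lborel \<partial>lborel)"
      by (simp add: norm_mult ennreal_mult)
    also have "\<dots> = (\<integral>\<^sup>+x. ennreal (norm (a x)) \<partial>lborel) * (\<integral>\<^sup>+y. ennreal (norm (b y)) \<partial>lborel)"
      by (simp add: nn_integral_cmult nn_integral_multc)
    also have "\<dots> < \<infinity>"
      using a b by (simp add: integrable_iff_bounded ennreal_mult_less_top)
    finally show "(\<integral>\<^sup>+p. ennreal (norm (a (fst p) * b (snd p))) \<partial>lborel) < \<infinity>" .
  qed (use m' in simp)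
  have "integrable (lborel \<Otimes>\<^sub>M lborel) (\<lambda>p. a (fst p) * b (snd p))"
    using i by (simp add: lborel_prod)
  from lborel_pair.integral_fst'[OF this]
  show "(\<integral>p. a (fst p) * b (snd p) \<partial>lborel) = (\<integral>x. a x \<partial>lborel) * (\<integral>y. b y \<partial>lborel)"
    by (simp add: lborel_prod)
qed

text \<open>The Gaussian weight makes the triple integral over two positions and a frequency
  absolutely convergent. Integrating out the frequency leaves \<open>gauss_ker\<close> at the
  rescaled difference of the positions, and a Schur-type estimate with the known mass of this kernel
  gives the constant.\<close>

lemma plancherel_regularized:
  fixes F :: "'a::euclidean_space \<Rightarrow> complex"
  assumes F: "integrable lborel F" and hb: "hb > 0" and e: "\<epsilon> \<noteq> 0"
  shows "(\<integral>\<^sup>+\<xi>. ennreal (gauss_wt \<epsilon> \<xi> * (cmod (\<integral>y. F y * cis (- (\<xi> \<bullet> y) / hb) \<partial>lborel))\<^sup>2) \<partial>lborel)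
    \<le> ennreal ((2 * pi * hb) ^ DIM('a)) * (\<integral>\<^sup>+y. ennreal ((cmod (F y))\<^sup>2) \<partial>lborel)"
proof -
  have [measurable]: "F \<in> borel_measurable borel"
    using borel_measurable_integrable[OF F] by simp
  define \<Phi> where "\<Phi> p = F (fst p) * cnj (F (snd p))" for p
  have \<Phi>i: "integrable lborel \<Phi>"
    unfolding \<Phi>_def by (intro integrable_tensor F Bochner_Integration.integrable_cnj)
  have [measurable]: "\<Phi> \<in> borel_measurable borel"
    using borel_measurable_integrable[OF \<Phi>i] by simp
  define k where "k p = (snd p - fst p) /\<^sub>R hb" for p :: "'a \<times> 'a"
  have [measurable]: "k \<in> borel_measurable borel"
    unfolding k_def by (intro borel_measurable_continuous_onI continuous_intros)
  define Fh where "Fh \<xi> = (\<integral>y. F y * cis (- (\<xi> \<bullet> y) / hb) \<partial>lborel)" for \<xi>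
  \<comment> \<open>The squared modulus of an integral is a double integral of a tensor product, and
    the two characters merge into one of the difference.\<close>
  have Fh_sq: "complex_of_real ((cmod (Fh \<xi>))\<^sup>2) = (\<integral>p. \<Phi> p * cis (\<xi> \<bullet> k p) \<partial>lborel)" for \<xi>
  proof -
    have i: "integrable lborel (\<lambda>y. F y * cis (- (\<xi> \<bullet> y) / hb))"
      by (rule Bochner_Integration.integrable_bound[OF integrable_norm[OF F]]) (auto simp: norm_mult)
    have "complex_of_real ((cmod (Fh \<xi>))\<^sup>2) = Fh \<xi> * cnj (Fh \<xi>)"
      by (rule complex_norm_square)
    also have "\<dots> = (\<integral>p. (F (fst p) * cis (- (\<xi> \<bullet> fst p) / hb)) * cnj (F (snd p) * cis (- (\<xi> \<bullet> snd p) / hb)) \<partial>lborel)"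
      by (simp only: integrable_tensor(2)[OF i Bochner_Integration.integrable_cnj[OF i]]
          Bochner_Integration.integral_cnj Fh_def)
    also have "\<dots> = (\<integral>p. \<Phi> p * cis (\<xi> \<bullet> k p) \<partial>lborel)"
    proof (intro Bochner_Integration.integral_cong refl)
      fix p
      have "cis (- (\<xi> \<bullet> fst p) / hb) * cis ((\<xi> \<bullet> snd p) / hb) = cis (\<xi> \<bullet> k p)"
        by (simp add: cis_mult k_def inner_diff_right divide_inverse algebra_simps)
      then show "(F (fst p) * cis (- (\<xi> \<bullet> fst p) / hb)) * cnj (F (snd p) * cis (- (\<xi> \<bullet> snd p) / hb)) = \<Phi> p * cis (\<xi> \<bullet> k p)"
        by (simp add: \<Phi>_def cis_cnj mult_ac flip: mult.assoc[of "cis _" "cis _"])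
    qed
    finally show ?thesis .
  qed
  define H where "H q = complex_of_real (gauss_wt \<epsilon> (fst q)) * \<Phi> (snd q) * cis (fst q \<bullet> k (snd q))" for q :: "'a \<times> 'a \<times> 'a"
  have "H \<in> borel_measurable (borel \<Otimes>\<^sub>M borel)"
    unfolding H_def by measurable
  then have Hm: "H \<in> borel_measurable borel" by (simp only: borel_prod)
  have wi: "integrable lborel (\<lambda>\<xi>::'a. complex_of_real (gauss_wt \<epsilon> \<xi>))"
    by (intro integrable_of_real integrable_gauss_wt e)
  have Hi: "integrable lborel H"
    by (rule Bochner_Integration.integrable_bound[OF integrable_tensor(1)[OF wi \<Phi>i]])
       (auto simp: H_def norm_mult Hm)
  then have Hi': "integrable (lborel \<Otimes>\<^sub>M lborel) (\<lambda>(\<xi>, p). H (\<xi>, p))" by (simp add: lborel_prod)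
  have "(\<integral>\<xi>. complex_of_real (gauss_wt \<epsilon> \<xi> * (cmod (Fh \<xi>))\<^sup>2) \<partial>lborel) = (\<integral>\<xi>. \<integral>p. H (\<xi>, p) \<partial>lborel \<partial>lborel)"
    by (simp add: H_def Fh_sq[symmetric] mult.assoc)
  also have "\<dots> = (\<integral>p. \<integral>\<xi>. H (\<xi>, p) \<partial>lborel \<partial>lborel)"
    using lborel_pair.Fubini_integral[OF Hi'] ..
  also have "\<dots> = (\<integral>p. \<Phi> p * complex_of_real (gauss_ker \<epsilon> (k p)) \<partial>lborel)"
    by (simp add: H_def mult.commute[of _ "\<Phi> _"] mult.assoc gauss_wt_fourier[OF e])
  finally have eq: "complex_of_real (\<integral>\<xi>. gauss_wt \<epsilon> \<xi> * (cmod (Fh \<xi>))\<^sup>2 \<partial>lborel)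
    = (\<integral>p. \<Phi> p * complex_of_real (gauss_ker \<epsilon> (k p)) \<partial>lborel)"
    unfolding integral_complex_of_real .
  have Fi: "integrable lborel (\<lambda>\<xi>. gauss_wt \<epsilon> \<xi> * (cmod (Fh \<xi>))\<^sup>2)"
  proof -
    have "integrable lborel (\<lambda>\<xi>. \<integral>p. H (\<xi>, p) \<partial>lborel)"
      using lborel_pair.integrable_fst'[of H] Hi' by simp
    then have "integrable lborel (\<lambda>\<xi>. complex_of_real (gauss_wt \<epsilon> \<xi> * (cmod (Fh \<xi>))\<^sup>2))"
      by (simp add: H_def Fh_sq[symmetric] mult.assoc)
    from Bochner_Integration.integrable_Re[OF this] show ?thesis by simp
  qed
  have "(\<integral>\<^sup>+\<xi>. ennreal (gauss_wt \<epsilon> \<xi> * (cmod (Fh \<xi>))\<^sup>2) \<partial>lborel) = ennreal (\<integral>\<xi>. gauss_wt \<epsilon> \<xi> * (cmod (Fh \<xi>))\<^sup>2 \<partial>lborel)"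
    by (rule nn_integral_eq_integral[OF Fi]) simp
  also have "\<dots> \<le> ennreal (cmod (\<integral>p. \<Phi> p * complex_of_real (gauss_ker \<epsilon> (k p)) \<partial>lborel))"
    unfolding eq[symmetric] norm_of_real by (intro ennreal_leI abs_ge_self)
  also have "\<dots> \<le> (\<integral>\<^sup>+p. ennreal (cmod (\<Phi> p * complex_of_real (gauss_ker \<epsilon> (k p)))) \<partial>lborel)"
  proof (cases "integrable lborel (\<lambda>p. \<Phi> p * complex_of_real (gauss_ker \<epsilon> (k p)))")
    case True
    then show ?thesis by (rule integral_norm_bound_ennreal)
  qed (simp add: not_integrable_integral_eq)
  \<comment> \<open>The product of moduli is at most the half-sum of their squares, so each term
    keeps one factor of \<open>F\<close> and the kernel is integrated over the other
    variable.\<close>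
  also have "\<dots> \<le> (\<integral>\<^sup>+p. (ennreal ((cmod (F (fst p)))\<^sup>2 / 2) + ennreal ((cmod (F (snd p)))\<^sup>2 / 2)) * ennreal (gauss_ker \<epsilon> (k p)) \<partial>lborel)"
  proof (rule nn_integral_mono)
    fix p
    have "cmod (\<Phi> p) \<le> (cmod (F (fst p)))\<^sup>2 / 2 + (cmod (F (snd p)))\<^sup>2 / 2"
      using sum_squares_bound[of "cmod (F (fst p))" "cmod (F (snd p))"] by (simp add: \<Phi>_def norm_mult)
    then have "cmod (\<Phi> p * complex_of_real (gauss_ker \<epsilon> (k p)))
      \<le> ((cmod (F (fst p)))\<^sup>2 / 2 + (cmod (F (snd p)))\<^sup>2 / 2) * gauss_ker \<epsilon> (k p)"
      by (simp add: norm_mult mult_right_mono)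
    then show "ennreal (cmod (\<Phi> p * complex_of_real (gauss_ker \<epsilon> (k p)))) \<le>
      (ennreal ((cmod (F (fst p)))\<^sup>2 / 2) + ennreal ((cmod (F (snd p)))\<^sup>2 / 2)) * ennreal (gauss_ker \<epsilon> (k p))"
      by (simp add: ennreal_plus[symmetric] ennreal_mult[symmetric] ennreal_leI del: ennreal_plus)
  qed
  also have "\<dots> = (\<integral>\<^sup>+p. ennreal ((cmod (F (fst p)))\<^sup>2 / 2) * ennreal (gauss_ker \<epsilon> (k p)) \<partial>lborel)
    + (\<integral>\<^sup>+p. ennreal ((cmod (F (snd p)))\<^sup>2 / 2) * ennreal (gauss_ker \<epsilon> (k p)) \<partial>lborel)"
  proof -
    have [measurable]: "(\<lambda>p. F (fst p)) \<in> borel_measurable (borel :: ('a \<times> 'a) measure)"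
      "(\<lambda>p. F (snd p)) \<in> borel_measurable (borel :: ('a \<times> 'a) measure)"
      unfolding borel_prod[symmetric] by measurable
    show ?thesis
      unfolding distrib_right by (rule nn_integral_add) measurable
  qed
  also have "(\<integral>\<^sup>+p. ennreal ((cmod (F (fst p)))\<^sup>2 / 2) * ennreal (gauss_ker \<epsilon> (k p)) \<partial>lborel)
    = (\<integral>\<^sup>+y. ennreal ((cmod (F y))\<^sup>2 / 2) \<partial>lborel) * ennreal ((2 * pi * hb) ^ DIM('a))"
  proof -
    have [measurable]: "(\<lambda>p. F (fst p)) \<in> borel_measurable (borel :: ('a \<times> 'a) measure)"
      unfolding borel_prod[symmetric] by measurable
    have "(\<integral>\<^sup>+p. ennreal ((cmod (F (fst p)))\<^sup>2 / 2) * ennreal (gauss_ker \<epsilon> (k p)) \<partial>lborel) =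
      (\<integral>\<^sup>+x. \<integral>\<^sup>+y. ennreal ((cmod (F x))\<^sup>2 / 2) * ennreal (gauss_ker \<epsilon> ((y - x) /\<^sub>R hb)) \<partial>lborel \<partial>lborel)"
    proof -
      have "(\<lambda>p. ennreal ((cmod (F (fst p)))\<^sup>2 / 2) * ennreal (gauss_ker \<epsilon> (k p))) \<in> borel_measurable borel"
        by measurable
      from nn_integral_lborel_iterated(1)[OF this] show ?thesis by (simp add: k_def)
    qed
    also have "\<dots> = (\<integral>\<^sup>+x. ennreal ((cmod (F x))\<^sup>2 / 2) * ennreal ((2 * pi * hb) ^ DIM('a)) \<partial>lborel)"
    proof (intro nn_integral_cong)
      fix x :: 'a
      have "(\<integral>\<^sup>+y. ennreal (gauss_ker \<epsilon> ((y - x) /\<^sub>R hb)) \<partial>lborel) = ennreal ((2 * pi * hb) ^ DIM('a))"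
        using nn_integral_translate[of "\<lambda>y. ennreal (gauss_ker \<epsilon> (y /\<^sub>R hb))" "- x"] nn_integral_gauss_ker[OF e hb, where 'a = 'a]
        by simp
      then show "(\<integral>\<^sup>+y. ennreal ((cmod (F x))\<^sup>2 / 2) * ennreal (gauss_ker \<epsilon> ((y - x) /\<^sub>R hb)) \<partial>lborel)
        = ennreal ((cmod (F x))\<^sup>2 / 2) * ennreal ((2 * pi * hb) ^ DIM('a))"
        by (subst nn_integral_cmult) simp_all
    qed
    also have "\<dots> = (\<integral>\<^sup>+y. ennreal ((cmod (F y))\<^sup>2 / 2) \<partial>lborel) * ennreal ((2 * pi * hb) ^ DIM('a))"
      by (rule nn_integral_multc) simp
    finally show ?thesis .
  qed
  also have "(\<integral>\<^sup>+p. ennreal ((cmod (F (snd p)))\<^sup>2 / 2) * ennreal (gauss_ker \<epsilon> (k p)) \<partial>lborel)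
    = (\<integral>\<^sup>+y. ennreal ((cmod (F y))\<^sup>2 / 2) \<partial>lborel) * ennreal ((2 * pi * hb) ^ DIM('a))"
  proof -
    have [measurable]: "(\<lambda>p. F (snd p)) \<in> borel_measurable (borel :: ('a \<times> 'a) measure)"
      unfolding borel_prod[symmetric] by measurable
    \<comment> \<open>In this term the kernel is integrated over the first variable, which enters
      with a minus sign; evenness brings back a translate of the kernel.\<close>
    have even: "gauss_ker \<epsilon> ((y - x) /\<^sub>R hb) = gauss_ker \<epsilon> ((x - y) /\<^sub>R hb)" for x y :: 'a
    proof -
      have "gauss_ker \<epsilon> (- w) = gauss_ker \<epsilon> w" for w :: 'a by (simp add: gauss_ker_def)
      from this[of "(x - y) /\<^sub>R hb"] show ?thesis
        by (simp only: scaleR_minus_right[symmetric] minus_diff_eq)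
    qed
    have "(\<integral>\<^sup>+p. ennreal ((cmod (F (snd p)))\<^sup>2 / 2) * ennreal (gauss_ker \<epsilon> (k p)) \<partial>lborel) =
      (\<integral>\<^sup>+y. \<integral>\<^sup>+x. ennreal ((cmod (F y))\<^sup>2 / 2) * ennreal (gauss_ker \<epsilon> ((x - y) /\<^sub>R hb)) \<partial>lborel \<partial>lborel)"
    proof -
      have "(\<lambda>p. ennreal ((cmod (F (snd p)))\<^sup>2 / 2) * ennreal (gauss_ker \<epsilon> (k p))) \<in> borel_measurable borel"
        by measurable
      from nn_integral_lborel_iterated(2)[OF this] show ?thesis
        unfolding k_def fst_conv snd_conv by (simp only: even)
    qed
    also have "\<dots> = (\<integral>\<^sup>+x. ennreal ((cmod (F x))\<^sup>2 / 2) * ennreal ((2 * pi * hb) ^ DIM('a)) \<partial>lborel)"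
    proof (intro nn_integral_cong)
      fix x :: 'a
      have "(\<integral>\<^sup>+y. ennreal (gauss_ker \<epsilon> ((y - x) /\<^sub>R hb)) \<partial>lborel) = ennreal ((2 * pi * hb) ^ DIM('a))"
        using nn_integral_translate[of "\<lambda>y. ennreal (gauss_ker \<epsilon> (y /\<^sub>R hb))" "- x"] nn_integral_gauss_ker[OF e hb, where 'a = 'a]
        by simp
      then show "(\<integral>\<^sup>+y. ennreal ((cmod (F x))\<^sup>2 / 2) * ennreal (gauss_ker \<epsilon> ((y - x) /\<^sub>R hb)) \<partial>lborel)
        = ennreal ((cmod (F x))\<^sup>2 / 2) * ennreal ((2 * pi * hb) ^ DIM('a))"
        by (subst nn_integral_cmult) simp_all
    qed
    also have "\<dots> = (\<integral>\<^sup>+y. ennreal ((cmod (F y))\<^sup>2 / 2) \<partial>lborel) * ennreal ((2 * pi * hb) ^ DIM('a))"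
      by (rule nn_integral_multc) simp
    finally show ?thesis .
  qed
  also have "(\<integral>\<^sup>+y. ennreal ((cmod (F y))\<^sup>2 / 2) \<partial>lborel) * ennreal ((2 * pi * hb) ^ DIM('a))
    + (\<integral>\<^sup>+y. ennreal ((cmod (F y))\<^sup>2 / 2) \<partial>lborel) * ennreal ((2 * pi * hb) ^ DIM('a))
    = ennreal ((2 * pi * hb) ^ DIM('a)) * (\<integral>\<^sup>+y. ennreal ((cmod (F y))\<^sup>2 / 2) + ennreal ((cmod (F y))\<^sup>2 / 2) \<partial>lborel)"
    by (subst nn_integral_add) (simp_all add: distrib_left mult.commute)
  also have "\<dots> = ennreal ((2 * pi * hb) ^ DIM('a)) * (\<integral>\<^sup>+y. ennreal ((cmod (F y))\<^sup>2) \<partial>lborel)"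
    by (simp add: ennreal_plus[symmetric] del: ennreal_plus)
  finally show ?thesis unfolding Fh_def .
qed

text \<open>The regularising weight tends to 1 pointwise while the upper bound stays fixed, so
  Fatou's lemma removes it.\<close>

lemma plancherel_ineq:
  fixes F :: "'a::euclidean_space \<Rightarrow> complex"
  assumes F: "integrable lborel F" and hb: "hb > 0"
  shows "(\<integral>\<^sup>+\<xi>. ennreal ((cmod (\<integral>y. F y * cis (- (\<xi> \<bullet> y) / hb) \<partial>lborel))\<^sup>2) \<partial>lborel)
    \<le> ennreal ((2 * pi * hb) ^ DIM('a)) * (\<integral>\<^sup>+y. ennreal ((cmod (F y))\<^sup>2) \<partial>lborel)"
proof -
  define Fh where "Fh \<xi> = (\<integral>y. F y * cis (- (\<xi> \<bullet> y) / hb) \<partial>lborel)" for \<xi>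
  define e where "e n = inverse (real (Suc n))" for n
  have e: "e n \<noteq> 0" for n by (simp add: e_def)
  have e0: "e \<longlonglongrightarrow> 0" unfolding e_def by (rule LIMSEQ_inverse_real_of_nat)
  have [measurable]: "F \<in> borel_measurable borel"
    using borel_measurable_integrable[OF F] by simp
  have "(\<lambda>(\<xi>, y). F y * cis (- (\<xi> \<bullet> y) / hb)) \<in> borel_measurable (borel \<Otimes>\<^sub>M lborel)"
    by measurable
  then have [measurable]: "Fh \<in> borel_measurable borel"
    unfolding Fh_def using lborel.borel_measurable_lebesgue_integral by blast
  have lim: "(\<lambda>n. ennreal (gauss_wt (e n) \<xi> * (cmod (Fh \<xi>))\<^sup>2)) \<longlonglongrightarrow> ennreal ((cmod (Fh \<xi>))\<^sup>2)" for \<xi>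
  proof -
    have "(\<lambda>n. gauss_wt (e n) \<xi>) \<longlonglongrightarrow> (\<Prod>b\<in>(Basis::'a set). exp (- (0 * (\<xi> \<bullet> b))\<^sup>2 / 2))"
      unfolding gauss_wt_def by (intro tendsto_intros e0) simp
    then have "(\<lambda>n. gauss_wt (e n) \<xi> * (cmod (Fh \<xi>))\<^sup>2) \<longlonglongrightarrow> 1 * (cmod (Fh \<xi>))\<^sup>2"
      by (intro tendsto_mult tendsto_const) simp
    then show ?thesis by (intro tendsto_ennrealI) simp
  qed
  have "(\<integral>\<^sup>+\<xi>. ennreal ((cmod (Fh \<xi>))\<^sup>2) \<partial>lborel)
    = (\<integral>\<^sup>+\<xi>. liminf (\<lambda>n. ennreal (gauss_wt (e n) \<xi> * (cmod (Fh \<xi>))\<^sup>2)) \<partial>lborel)"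
    by (intro nn_integral_cong lim_imp_Liminf[symmetric] lim) simp
  also have "\<dots> \<le> liminf (\<lambda>n. \<integral>\<^sup>+\<xi>. ennreal (gauss_wt (e n) \<xi> * (cmod (Fh \<xi>))\<^sup>2) \<partial>lborel)"
    by (rule nn_integral_liminf) measurable
  also have "\<dots> \<le> ennreal ((2 * pi * hb) ^ DIM('a)) * (\<integral>\<^sup>+y. ennreal ((cmod (F y))\<^sup>2) \<partial>lborel)"
    by (rule Liminf_le) (use plancherel_regularized[OF F hb e] in \<open>simp_all add: Fh_def\<close>)
  finally show ?thesis unfolding Fh_def .
qed

lemma nn_integral_L2_sq:
  "f \<in> L2 \<Longrightarrow> (\<integral>\<^sup>+x. ennreal ((cmod (f x))\<^sup>2) \<partial>lborel) = ennreal ((l2norm f)\<^sup>2)"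
  unfolding l2norm_sq by (rule nn_integral_eq_integral) auto

text \<open>At a fixed position \<open>x\<close> the inner product is, up to a phase of modulus 1,
  the semiclassical Fourier transform in \<open>\<xi>\<close> of the integrable function
  \<open>cnj (g y) * f (y + x)\<close>. Plancherel in \<open>\<xi>\<close>, then Tonelli and
  translation invariance in \<open>x\<close>, separate the two norms.\<close>

lemma moyal_ineq:
  fixes f g :: "'d::finite fn"
  assumes f: "f \<in> L2" and g: "g \<in> L2" and hb: "hb > 0"
  shows "(\<integral>\<^sup>+z. ennreal ((cmod (l2inner g (tau_adj hb z f)))\<^sup>2) \<partial>lborel)
    \<le> ennreal (planck hb ^ CARD('d) * ((l2norm g)\<^sup>2 * (l2norm f)\<^sup>2))"
proof -
  have [measurable]: "f \<in> borel_measurable borel" "g \<in> borel_measurable borel"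
    using f g by (auto intro: L2_measurable)
  let ?H = "ennreal ((2 * pi * hb) ^ CARD('d))"
  have inner_eq: "cmod (l2inner g (tau_adj hb (x, \<xi>) f)) =
    cmod (\<integral>y. cnj (g y) * f (y + x) * cis (- (\<xi> \<bullet> y) / hb) \<partial>lborel)" for x \<xi>
  proof -
    have "cis (- (\<xi> \<bullet> (y + (1 / 2) *\<^sub>R x)) / hb) = cis (- (\<xi> \<bullet> ((1 / 2) *\<^sub>R x)) / hb) * cis (- (\<xi> \<bullet> y) / hb)" for y
    proof -
      have "- (\<xi> \<bullet> (y + (1 / 2) *\<^sub>R x)) / hb = - (\<xi> \<bullet> ((1 / 2) *\<^sub>R x)) / hb + - (\<xi> \<bullet> y) / hb"
        by (simp add: inner_add_right add_divide_distrib diff_divide_distrib)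
      then show ?thesis by (simp only: cis_mult)
    qed
    then have "l2inner g (tau_adj hb (x, \<xi>) f) = (\<integral>y. cis (- (\<xi> \<bullet> ((1 / 2) *\<^sub>R x)) / hb) * (cnj (g y) * f (y + x) * cis (- (\<xi> \<bullet> y) / hb)) \<partial>lborel)"
      unfolding l2inner_def tau_adj_def fst_conv snd_conv
      by (intro Bochner_Integration.integral_cong refl) (simp only: mult_ac)
    then show ?thesis by (simp only: integral_mult_right_zero norm_mult norm_cis mult_1)
  qed
  have tr: "(\<lambda>y. f (y + x)) \<in> L2" for x
    by (intro L2I) (use integrable_translate[OF L2_integrable[OF f]] in auto)
  have one: "(\<integral>\<^sup>+\<xi>. ennreal ((cmod (l2inner g (tau_adj hb (x, \<xi>) f)))\<^sup>2) \<partial>lborel)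
    \<le> ?H * (\<integral>\<^sup>+y. ennreal ((cmod (g y))\<^sup>2) * ennreal ((cmod (f (y + x)))\<^sup>2) \<partial>lborel)" for x
    using plancherel_ineq[OF L2_inner_integrable[OF tr[of x] g] hb]
    by (simp add: inner_eq norm_mult power_mult_distrib ennreal_mult)
  have mf: "(\<lambda>p. f (snd p + fst p)) \<in> borel_measurable (borel :: ((real^'d) \<times> (real^'d)) measure)"
    unfolding borel_prod[symmetric] by measurable
  have "(\<lambda>z. ennreal ((cmod (l2inner g (tau_adj hb z f)))\<^sup>2)) \<in> borel_measurable borel"
    using borel_measurable_continuous_onI[OF continuous_on_l2inner_tau_adj(1)[OF f g]] by measurable
  then have "(\<integral>\<^sup>+z. ennreal ((cmod (l2inner g (tau_adj hb z f)))\<^sup>2) \<partial>lborel)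
    = (\<integral>\<^sup>+x. \<integral>\<^sup>+\<xi>. ennreal ((cmod (l2inner g (tau_adj hb (x, \<xi>) f)))\<^sup>2) \<partial>lborel \<partial>lborel)"
    by (rule nn_integral_lborel_iterated(1))
  also have "\<dots> \<le> (\<integral>\<^sup>+x. ?H * (\<integral>\<^sup>+y. ennreal ((cmod (g y))\<^sup>2) * ennreal ((cmod (f (y + x)))\<^sup>2) \<partial>lborel) \<partial>lborel)"
    by (intro nn_integral_mono one)
  also have "\<dots> = ?H * (\<integral>\<^sup>+x. \<integral>\<^sup>+y. ennreal ((cmod (g y))\<^sup>2) * ennreal ((cmod (f (y + x)))\<^sup>2) \<partial>lborel \<partial>lborel)"
    by (rule nn_integral_cmult) measurable
  also have "(\<integral>\<^sup>+x. \<integral>\<^sup>+y. ennreal ((cmod (g y))\<^sup>2) * ennreal ((cmod (f (y + x)))\<^sup>2) \<partial>lborel \<partial>lborel)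
    = (\<integral>\<^sup>+y. \<integral>\<^sup>+x. ennreal ((cmod (g y))\<^sup>2) * ennreal ((cmod (f (y + x)))\<^sup>2) \<partial>lborel \<partial>lborel)"
    by (rule lborel_pair.Fubini') measurable
  also have "\<dots> = (\<integral>\<^sup>+y. ennreal ((cmod (g y))\<^sup>2) * ennreal ((l2norm f)\<^sup>2) \<partial>lborel)"
  proof (intro nn_integral_cong)
    fix y
    have "(\<integral>\<^sup>+x. ennreal ((cmod (f (y + x)))\<^sup>2) \<partial>lborel) = ennreal ((l2norm f)\<^sup>2)"
      using nn_integral_translate[of "\<lambda>x. ennreal ((cmod (f x))\<^sup>2)" y] nn_integral_L2_sq[OF f]
      by (simp add: add.commute)
    then show "(\<integral>\<^sup>+x. ennreal ((cmod (g y))\<^sup>2) * ennreal ((cmod (f (y + x)))\<^sup>2) \<partial>lborel)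
      = ennreal ((cmod (g y))\<^sup>2) * ennreal ((l2norm f)\<^sup>2)"
      by (subst nn_integral_cmult) simp_all
  qed
  also have "\<dots> = ennreal ((l2norm g)\<^sup>2) * ennreal ((l2norm f)\<^sup>2)"
    by (subst nn_integral_multc) (simp_all add: nn_integral_L2_sq[OF g])
  finally show ?thesis
    using hb by (simp add: planck_def ennreal_mult)
qed

subsection \<open>Hilbert--Schmidt bound for finite-rank forms\<close>

lemma l2inner_null_left: "e \<in> L2 \<Longrightarrow> f \<in> L2 \<Longrightarrow> l2norm e = 0 \<Longrightarrow> l2inner e f = 0"
  using l2inner_CS[of f e] by simp

lemma l2inner_null_right: "e \<in> L2 \<Longrightarrow> f \<in> L2 \<Longrightarrow> l2norm e = 0 \<Longrightarrow> l2inner f e = 0"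
  using l2inner_CS[of e f] by simp

text \<open>Null vectors are admitted in the family, so that no rank has to be computed.\<close>
lemma gram_schmidt:
  fixes w :: "nat \<Rightarrow> 'd::finite fn"
  assumes "\<And>i. i < r \<Longrightarrow> w i \<in> L2"
  shows "\<exists>e. (\<forall>j<r. e j \<in> L2 \<and> (l2norm (e j) = 1 \<or> l2norm (e j) = 0)) \<and>
    (\<forall>i<r. \<forall>j<r. i \<noteq> j \<longrightarrow> l2inner (e i) (e j) = 0) \<and>
    (\<forall>i<r. \<forall>g\<in>L2. l2inner g (w i) = (\<Sum>j<r. l2inner g (e j) * l2inner (e j) (w i)))"
  using assms
proof (induction r)
  case 0
  then show ?case by simp
next
  case (Suc r)
  obtain e where E: "(\<forall>j<r. e j \<in> L2 \<and> (l2norm (e j) = 1 \<or> l2norm (e j) = 0)) \<and>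
    (\<forall>i<r. \<forall>j<r. i \<noteq> j \<longrightarrow> l2inner (e i) (e j) = 0) \<and>
    (\<forall>i<r. \<forall>g\<in>L2. l2inner g (w i) = (\<Sum>j<r. l2inner g (e j) * l2inner (e j) (w i)))"
    using Suc.IH[OF Suc.prems[OF less_SucI]] by (rule exE)
  have eL: "\<And>j. j < r \<Longrightarrow> e j \<in> L2"
    and en: "\<And>j. j < r \<Longrightarrow> l2norm (e j) = 1 \<or> l2norm (e j) = 0"
    using E by blast+
  have eo: "\<And>i j. i < r \<Longrightarrow> j < r \<Longrightarrow> i \<noteq> j \<Longrightarrow> l2inner (e i) (e j) = 0"
    using E by blast
  have ew: "\<And>i g. i < r \<Longrightarrow> g \<in> L2 \<Longrightarrow> l2inner g (w i) = (\<Sum>j<r. l2inner g (e j) * l2inner (e j) (w i))"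
    using E by blast
  have wL: "w i \<in> L2" if "i \<le> r" for i using Suc.prems that by simp
  define s where "s x = (\<Sum>j<r. l2inner (e j) (w r) * e j x)" for x
  define w' where "w' x = w r x - s x" for x
  have sL: "s \<in> L2" unfolding s_def using eL by auto
  have w'L: "w' \<in> L2" unfolding w'_def using sL wL[of r] by auto
  have sinner: "l2inner g s = (\<Sum>j<r. l2inner (e j) (w r) * l2inner g (e j))" if "g \<in> L2" for g
    unfolding s_def using that eL by (subst l2inner_sum_right) (auto simp: l2inner_scale_right)
  have w'inner: "l2inner g w' = l2inner g (w r) - l2inner g s" if "g \<in> L2" for g
    unfolding w'_def using that sL wL[of r] by (simp add: l2inner_diff_right)
  have ortho: "l2inner (e k) w' = 0" if k: "k < r" for k
  proof -
    have "(\<Sum>j<r. l2inner (e j) (w r) * l2inner (e k) (e j)) = (\<Sum>j<r. if j = k then l2inner (e k) (w r) * l2inner (e k) (e k) else 0)"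
      by (intro sum.cong refl) (use eo k in auto)
    also have "\<dots> = l2inner (e k) (w r) * l2inner (e k) (e k)" using k by simp
    also have "\<dots> = l2inner (e k) (w r)"
      using en[OF k] l2inner_null_left[OF eL[OF k] wL[of r]] by (auto simp: l2inner_self)
    finally show ?thesis using w'inner[OF eL[OF k]] sinner[OF eL[OF k]] by simp
  qed
  define n where "n = l2norm w'"
  \<comment> \<open>A remainder of norm 0 is replaced by the zero function, which avoids the
    division and keeps one vector for each given one.\<close>
  define er where "er x = (if n = 0 then 0 else of_real (1 / n) * w' x)" for x
  have "er = (\<lambda>x. (if n = 0 then 0 else of_real (1 / n)) * w' x)"
    by (auto simp: er_def)
  then have erL: "er \<in> L2" using L2_scale[OF w'L] by metis
  have er0: "er = (\<lambda>x. 0)" if "n = 0" using that by (auto simp: er_def)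
  have ern1: "l2norm er = 1" if "n \<noteq> 0"
  proof -
    have "l2norm er = \<bar>1 / n\<bar> * n"
      using that unfolding er_def n_def by (simp only: if_False l2norm_scale norm_of_real)
    then show ?thesis using that l2norm_nonneg[of w'] by (simp add: n_def)
  qed
  then have ern: "l2norm er = 1 \<or> l2norm er = 0"
    using er0 by (cases "n = 0") auto
  have w'er: "l2inner g w' = of_real n * l2inner g er" if "g \<in> L2" for g
  proof (cases "n = 0")
    case True
    then show ?thesis using l2inner_null_right[OF w'L that] by (simp add: n_def)
  next
    case False
    have "l2inner g er = of_real (1 / n) * l2inner g w'"
      using False unfolding er_def by (simp only: if_False l2inner_scale_right)
    then show ?thesis using False by simp
  qed
  have ero: "l2inner (e k) er = 0" if "k < r" for k
  proof (cases "n = 0")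
    case False
    then show ?thesis using w'er[OF eL[OF that]] ortho[OF that] by simp
  qed (simp add: er0)
  have ero': "l2inner er (e k) = 0" if "k < r" for k
    using ero[OF that] l2inner_cnj[of "e k" er] by simp
  have erw: "l2inner er (w r) = of_real n"
  proof -
    have "l2inner er s = 0" using sinner[OF erL] ero' by simp
    then have "l2inner er (w r) = l2inner er w'" using w'inner[OF erL] by simp
    also have "\<dots> = of_real n * l2inner er er" by (rule w'er[OF erL])
    also have "\<dots> = of_real n"
      using ern1 by (cases "n = 0") (auto simp: l2inner_self er0)
    finally show ?thesis .
  qed
  \<comment> \<open>The new vector is orthogonal to the earlier given ones, so appending it leaves
    their expansions intact.\<close>
  have erw0: "l2inner er (w i) = 0" if "i < r" for i
    using ew[OF that erL] ero' by simp
  define e' where "e' = e(r := er)"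
  have e'_simps: "e' r = er" "\<And>j. j < r \<Longrightarrow> e' j = e j" by (auto simp: e'_def)
  have sum_e': "(\<Sum>j<Suc r. l2inner g (e' j) * l2inner (e' j) v)
    = (\<Sum>j<r. l2inner g (e j) * l2inner (e j) v) + l2inner g er * l2inner er v" for g v
    by (simp add: e'_simps)
  show ?case
  proof (intro exI[of _ e'] conjI allI impI ballI)
    fix j assume "j < Suc r"
    then show "e' j \<in> L2" "l2norm (e' j) = 1 \<or> l2norm (e' j) = 0"
      using eL[of j] en[of j] erL ern by (auto simp: less_Suc_eq e'_simps)
  next
    fix i j assume "i < Suc r" "j < Suc r" "i \<noteq> j"
    then show "l2inner (e' i) (e' j) = 0"
      using eo ero ero' by (auto simp: less_Suc_eq e'_simps)
  next
    fix i and g :: "'d fn" assume i: "i < Suc r" and g: "g \<in> L2"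
    show "l2inner g (w i) = (\<Sum>j<Suc r. l2inner g (e' j) * l2inner (e' j) (w i))"
    proof (cases "i = r")
      case True
      have "l2inner g (w r) = l2inner g w' + l2inner g s" using w'inner[OF g] by simp
      then show ?thesis
        unfolding sum_e' True erw sinner[OF g] w'er[OF g] by (simp add: mult.commute)
    next
      case False
      then show ?thesis using i ew[of i g] erw0 g unfolding sum_e' by simp
    qed
  qed
qed

lemma bessel_ineq:
  fixes e :: "nat \<Rightarrow> 'd::finite fn"
  assumes eL: "\<And>j. j < r \<Longrightarrow> e j \<in> L2"
    and en: "\<And>j. j < r \<Longrightarrow> l2norm (e j) \<le> 1"
    and eo: "\<And>i j. i < r \<Longrightarrow> j < r \<Longrightarrow> i \<noteq> j \<Longrightarrow> l2inner (e i) (e j) = 0"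
    and g: "g \<in> L2"
  shows "(\<Sum>j<r. (cmod (l2inner g (e j)))\<^sup>2) \<le> (l2norm g)\<^sup>2"
proof -
  define S where "S = (\<Sum>j<r. (cmod (l2inner g (e j)))\<^sup>2)"
  define h where "h x = (\<Sum>j<r. l2inner (e j) g * e j x)" for x
  have S0: "S \<ge> 0" unfolding S_def by (intro sum_nonneg) auto
  have hL: "h \<in> L2" unfolding h_def using eL by auto
  have sq: "l2inner (e j) g * l2inner g (e j) = of_real ((cmod (l2inner g (e j)))\<^sup>2)" for j
    using l2inner_cnj[of g "e j"] complex_norm_square[of "l2inner g (e j)"] by (simp add: mult.commute)
  have hin: "l2inner v h = (\<Sum>j<r. l2inner (e j) g * l2inner v (e j))" if "v \<in> L2" for v
    unfolding h_def using that eL by (subst l2inner_sum_right) (auto simp: l2inner_scale_right)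
  have "l2inner g h = of_real S"
    unfolding hin[OF g] S_def sq by simp
  then have 1: "S \<le> l2norm g * l2norm h"
    using l2inner_CS[OF hL g] S0 by simp
  have "l2inner h h = (\<Sum>j<r. l2inner (e j) g * cnj (l2inner (e j) h))"
    unfolding hin[OF hL] by (simp add: l2inner_cnj)
  also have "\<dots> = (\<Sum>j<r. of_real ((cmod (l2inner g (e j)))\<^sup>2 * (l2norm (e j))\<^sup>2))"
  proof (intro sum.cong refl)
    fix j assume "j \<in> {..<r}"
    then have j: "j < r" by simp
    have "l2inner (e j) h = (\<Sum>i<r. if i = j then l2inner (e j) g * l2inner (e j) (e j) else 0)"
      unfolding hin[OF eL[OF j]] by (intro sum.cong refl) (use eo j in auto)
    also have "\<dots> = l2inner (e j) g * of_real ((l2norm (e j))\<^sup>2)" using j by (simp add: l2inner_self)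
    finally have "cnj (l2inner (e j) h) = l2inner g (e j) * of_real ((l2norm (e j))\<^sup>2)"
      by (simp add: l2inner_cnj)
    then show "l2inner (e j) g * cnj (l2inner (e j) h) = of_real ((cmod (l2inner g (e j)))\<^sup>2 * (l2norm (e j))\<^sup>2)"
      by (simp only: mult.assoc[symmetric] sq of_real_mult)
  qed
  finally have "complex_of_real ((l2norm h)\<^sup>2) = of_real (\<Sum>j<r. (cmod (l2inner g (e j)))\<^sup>2 * (l2norm (e j))\<^sup>2)"
    unfolding l2inner_self by simp
  then have "(l2norm h)\<^sup>2 = (\<Sum>j<r. (cmod (l2inner g (e j)))\<^sup>2 * (l2norm (e j))\<^sup>2)"
    by (simp only: of_real_eq_iff)
  also have "\<dots> \<le> (\<Sum>j<r. (cmod (l2inner g (e j)))\<^sup>2 * 1)"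
    using en by (intro sum_mono mult_left_mono) (auto simp: power_le_one)
  finally have "(l2norm h)\<^sup>2 \<le> S" by (simp add: S_def)
  then have "l2norm h \<le> sqrt S" using real_le_rsqrt by blast
  then have "S \<le> l2norm g * sqrt S"
    using 1 mult_left_mono[of "l2norm h" "sqrt S" "l2norm g"] by simp
  then have "sqrt S * sqrt S \<le> l2norm g * sqrt S" using S0 by simp
  then have "sqrt S \<le> l2norm g"
    using S0 by (cases "S = 0") (simp, intro mult_right_le_imp_le[of "sqrt S" "sqrt S"], auto)
  then have "(sqrt S)\<^sup>2 \<le> (l2norm g)\<^sup>2" using S0 by (intro power_mono) auto
  then show ?thesis using S0 by (simp add: S_def)
qed

lemma dense_L2_seq:
  assumes "dense_L2 D" "f \<in> L2" "l2norm f \<le> 1"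
  obtains F where "\<And>n::nat. F n \<in> D" "\<And>n. F n \<in> L2" "\<And>n. l2norm (F n) \<le> 1"
    "(\<lambda>n. l2norm (\<lambda>x. F n x - f x)) \<longlonglongrightarrow> 0"
proof -
  have "\<forall>n::nat. \<exists>g. g \<in> D \<and> l2norm g \<le> 1 \<and> l2norm (\<lambda>x. f x - g x) < inverse (real (Suc n))"
  proof
    fix n
    have "inverse (real (Suc n)) > 0" by simp
    then show "\<exists>g. g \<in> D \<and> l2norm g \<le> 1 \<and> l2norm (\<lambda>x. f x - g x) < inverse (real (Suc n))"
      using assms unfolding dense_L2_def by blast
  qed
  then obtain F where F: "\<forall>n. F n \<in> D \<and> l2norm (F n) \<le> 1 \<and> l2norm (\<lambda>x. f x - F n x) < inverse (real (Suc n))"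
    by metis
  have "(\<lambda>n. l2norm (\<lambda>x. F n x - f x)) \<longlonglongrightarrow> 0"
    by (rule Lim_null_comparison[OF _ LIMSEQ_inverse_real_of_nat])
       (use F in \<open>auto simp: l2norm_minus_commute[of _ f] intro!: always_eventually less_imp_le\<close>)
  moreover have "D \<subseteq> L2" using assms(1) by (simp add: dense_L2_def)
  ultimately show thesis using that[of F] F by blast
qed

text \<open>In an orthonormal family expanding the \<open>w i\<close>, the operator is a sum of
  \<open>r\<close> terms \<open>l2inner (x j) f\<close> times \<open>e j\<close>, with
  \<open>x j\<close> of norm at most \<open>\<sigma>\<close>. Cauchy-Schwarz and Bessel eliminate
  \<open>g\<close>, and Moyal's inequality is applied to each of the \<open>r\<close> terms.\<close>

lemma finite_rank_hs_bound:
  fixes u w :: "nat \<Rightarrow> 'd::finite fn"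
  assumes u: "\<And>i. i < r \<Longrightarrow> u i \<in> L2" and w: "\<And>i. i < r \<Longrightarrow> w i \<in> L2"
    and D: "dense_L2 D"
    and bound: "\<And>f g. f \<in> D \<Longrightarrow> g \<in> D \<Longrightarrow> l2norm f \<le> 1 \<Longrightarrow> l2norm g \<le> 1 \<Longrightarrow>
      cmod (\<Sum>i<r. l2inner (u i) f * l2inner g (w i)) \<le> \<sigma>"
    and f: "f \<in> L2" "l2norm f \<le> 1" and g: "g \<in> L2" "l2norm g \<le> 1" and hb: "hb > 0"
  shows "(\<integral>\<^sup>+z. ennreal ((cmod (\<Sum>i<r. l2inner (u i) (tau_adj hb z f) * l2inner (tau_adj hb z g) (w i)))\<^sup>2) \<partial>lborel)
    \<le> ennreal (real r * \<sigma>\<^sup>2 * planck hb ^ CARD('d))"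
proof -
  let ?D = "\<lambda>g f. \<Sum>i<r. l2inner (u i) f * l2inner g (w i)"
  \<comment> \<open>The hypothesis speaks of \<open>D\<close>; a finite sum of products of inner
    products is continuous in both arguments, so density extends the bound to the unit ball of
    \<open>L2\<close>.\<close>
  have bound': "cmod (?D g f) \<le> \<sigma>" if L: "f \<in> L2" "g \<in> L2" "l2norm f \<le> 1" "l2norm g \<le> 1" for f g
  proof -
    obtain F where F: "\<And>n. F n \<in> D" "\<And>n. F n \<in> L2" "\<And>n. l2norm (F n) \<le> 1"
      "(\<lambda>n. l2norm (\<lambda>x. F n x - f x)) \<longlonglongrightarrow> 0"
      using dense_L2_seq[OF D L(1,3)] by blast
    obtain G where G: "\<And>n. G n \<in> D" "\<And>n. G n \<in> L2" "\<And>n. l2norm (G n) \<le> 1"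
      "(\<lambda>n. l2norm (\<lambda>x. G n x - g x)) \<longlonglongrightarrow> 0"
      using dense_L2_seq[OF D L(2,4)] by blast
    have c: "(\<lambda>n. l2norm (\<lambda>x. h x - h x)) \<longlonglongrightarrow> 0" for h :: "'d fn" by simp
    have "(\<lambda>n. ?D (G n) (F n)) \<longlonglongrightarrow> ?D g f"
    proof (intro tendsto_sum tendsto_mult)
      fix i assume "i \<in> {..<r}"
      then have i: "i < r" by simp
      show "(\<lambda>n. l2inner (u i) (F n)) \<longlonglongrightarrow> l2inner (u i) f"
        by (rule l2inner_tendsto[OF F(2) u[OF i] L(1) u[OF i] F(4) c])
      show "(\<lambda>n. l2inner (G n) (w i)) \<longlonglongrightarrow> l2inner g (w i)"
        by (rule l2inner_tendsto[OF w[OF i] G(2) w[OF i] L(2) c G(4)])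
    qed
    from tendsto_norm[OF this] show ?thesis
      by (rule Lim_bounded) (use bound F G in auto)
  qed
  have \<sigma>: "\<sigma> \<ge> 0" using bound'[OF f(1) g(1) f(2) g(2)] norm_ge_zero order_trans by blast
  obtain e where E: "(\<forall>j<r. e j \<in> L2 \<and> (l2norm (e j) = 1 \<or> l2norm (e j) = 0)) \<and>
    (\<forall>i<r. \<forall>j<r. i \<noteq> j \<longrightarrow> l2inner (e i) (e j) = 0) \<and>
    (\<forall>i<r. \<forall>g\<in>L2. l2inner g (w i) = (\<Sum>j<r. l2inner g (e j) * l2inner (e j) (w i)))"
    using gram_schmidt[of r w, OF w] by (rule exE)
  have eL: "\<And>j. j < r \<Longrightarrow> e j \<in> L2"
    and en: "\<And>j. j < r \<Longrightarrow> l2norm (e j) = 1 \<or> l2norm (e j) = 0"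
    using E by blast+
  have eo: "\<And>i j. i < r \<Longrightarrow> j < r \<Longrightarrow> i \<noteq> j \<Longrightarrow> l2inner (e i) (e j) = 0"
    using E by blast
  have ew: "\<And>i g. i < r \<Longrightarrow> g \<in> L2 \<Longrightarrow> l2inner g (w i) = (\<Sum>j<r. l2inner g (e j) * l2inner (e j) (w i))"
    using E by blast
  have en1: "l2norm (e j) \<le> 1" if "j < r" for j using en[OF that] by auto
  \<comment> \<open>The adjoint of the finite-rank operator applied to \<open>e j\<close>; its norm
    is found below by testing on its own normalisation.\<close>
  define x where "x j y = (\<Sum>i<r. cnj (l2inner (e j) (w i)) * u i y)" for j y
  have xL: "x j \<in> L2" for j unfolding x_def using u by auto
  have xin: "l2inner (x j) f = ?D (e j) f" if "f \<in> L2" for f j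
    unfolding x_def using that u
    by (subst l2inner_sum_left) (auto simp: l2inner_scale_left intro!: sum.cong)
  have xn: "l2norm (x j) \<le> \<sigma>" if j: "j < r" for j
  proof (cases "l2norm (x j) = 0")
    case False
    then have n: "l2norm (x j) > 0" using l2norm_nonneg[of "x j"] by linarith
    define y where "y t = of_real (1 / l2norm (x j)) * x j t" for t
    have yL: "y \<in> L2" unfolding y_def by (rule L2_scale[OF xL])
    have "l2norm y = 1" unfolding y_def l2norm_scale norm_of_real using n by simp
    then have "cmod (l2inner (x j) y) \<le> \<sigma>"
      using bound'[OF yL eL[OF j] _ en1[OF j]] xin[OF yL] by simp
    moreover have "l2inner (x j) y = of_real (1 / l2norm (x j) * (l2norm (x j))\<^sup>2)"
      unfolding y_def l2inner_scale_right by (simp only: l2inner_self of_real_mult)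
    moreover have "1 / l2norm (x j) * (l2norm (x j))\<^sup>2 = l2norm (x j)"
      using n by (simp add: power2_eq_square)
    ultimately have "cmod (of_real (l2norm (x j))) \<le> \<sigma>" by (simp only:)
    then show ?thesis using n by simp
  qed (use \<sigma> in simp)
  have Dx: "?D g f = (\<Sum>j<r. l2inner g (e j) * l2inner (x j) f)" if L: "f \<in> L2" "g \<in> L2" for f g
  proof -
    have "?D g f = (\<Sum>i<r. \<Sum>j<r. l2inner g (e j) * (l2inner (u i) f * l2inner (e j) (w i)))"
      using ew[OF _ L(2)] by (intro sum.cong refl) (simp add: sum_distrib_left mult_ac)
    also have "\<dots> = (\<Sum>j<r. l2inner g (e j) * l2inner (x j) f)"
      by (subst sum.swap) (simp add: sum_distrib_left xin[OF L(1)])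
    finally show ?thesis .
  qed
  have pw: "(cmod (?D (tau_adj hb z g) (tau_adj hb z f)))\<^sup>2 \<le> (\<Sum>j<r. (cmod (l2inner (x j) (tau_adj hb z f)))\<^sup>2)" for z
  proof -
    let ?a = "\<lambda>j. cmod (l2inner (tau_adj hb z g) (e j))" and ?b = "\<lambda>j. cmod (l2inner (x j) (tau_adj hb z f))"
    have "cmod (?D (tau_adj hb z g) (tau_adj hb z f)) \<le> (\<Sum>j<r. ?a j * ?b j)"
      using f g by (subst Dx) (auto intro!: sum_norm_le simp: norm_mult)
    then have "(cmod (?D (tau_adj hb z g) (tau_adj hb z f)))\<^sup>2 \<le> (\<Sum>j<r. ?a j * ?b j)\<^sup>2"
      by (intro power_mono) auto
    also have "\<dots> \<le> (\<Sum>j<r. (?a j)\<^sup>2) * (\<Sum>j<r. (?b j)\<^sup>2)" by (rule Cauchy_Schwarz_ineq_sum)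
    also have "\<dots> \<le> 1 * (\<Sum>j<r. (?b j)\<^sup>2)"
    proof (intro mult_right_mono sum_nonneg)
      have "(\<Sum>j<r. (?a j)\<^sup>2) \<le> (l2norm (tau_adj hb z g))\<^sup>2"
        by (rule bessel_ineq[OF eL en1 eo]) (use g in auto)
      also have "\<dots> \<le> 1" using g by (simp add: power_le_one)
      finally show "(\<Sum>j<r. (?a j)\<^sup>2) \<le> 1" .
    qed auto
    finally show ?thesis by simp
  qed
  have meas: "(\<lambda>z. (cmod (l2inner (x j) (tau_adj hb z f)))\<^sup>2) \<in> borel_measurable borel" for j
    using borel_measurable_continuous_onI[OF continuous_on_l2inner_tau_adj(1)[OF f(1) xL[of j], of hb]]
    by measurable
  have "(\<integral>\<^sup>+z. ennreal ((cmod (?D (tau_adj hb z g) (tau_adj hb z f)))\<^sup>2) \<partial>lborel)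
    \<le> (\<integral>\<^sup>+z. (\<Sum>j<r. ennreal ((cmod (l2inner (x j) (tau_adj hb z f)))\<^sup>2)) \<partial>lborel)"
    using pw by (intro nn_integral_mono) (simp add: sum_ennreal ennreal_leI)
  also have "\<dots> = (\<Sum>j<r. \<integral>\<^sup>+z. ennreal ((cmod (l2inner (x j) (tau_adj hb z f)))\<^sup>2) \<partial>lborel)"
    using meas by (intro nn_integral_sum) simp
  also have "\<dots> \<le> (\<Sum>j<r. ennreal (planck hb ^ CARD('d) * \<sigma>\<^sup>2))"
  proof (rule sum_mono)
    fix j assume "j \<in> {..<r}"
    then have j: "j < r" by simp
    have "(l2norm (x j))\<^sup>2 * (l2norm f)\<^sup>2 \<le> \<sigma>\<^sup>2 * 1"
      using xn[OF j] f by (intro mult_mono power_mono) (auto simp: power_le_one)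
    then have "ennreal (planck hb ^ CARD('d) * ((l2norm (x j))\<^sup>2 * (l2norm f)\<^sup>2)) \<le> ennreal (planck hb ^ CARD('d) * \<sigma>\<^sup>2)"
      using hb by (intro ennreal_leI mult_left_mono) (auto simp: planck_def)
    then show "(\<integral>\<^sup>+z. ennreal ((cmod (l2inner (x j) (tau_adj hb z f)))\<^sup>2) \<partial>lborel) \<le> ennreal (planck hb ^ CARD('d) * \<sigma>\<^sup>2)"
      using moyal_ineq[OF f(1) xL hb] order_trans by blast
  qed
  also have "\<dots> = ennreal (\<Sum>j<r. planck hb ^ CARD('d) * \<sigma>\<^sup>2)"
    using hb by (intro sum_ennreal) (auto simp: planck_def)
  also have "(\<Sum>j<r. planck hb ^ CARD('d) * \<sigma>\<^sup>2) = real r * \<sigma>\<^sup>2 * planck hb ^ CARD('d)" by simp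
  finally show ?thesis .
qed

lemma sum_lessThan_add:
  fixes F :: "nat \<Rightarrow> 'a::comm_monoid_add"
  shows "(\<Sum>i<m + n. F i) = (\<Sum>i<m. F i) + (\<Sum>i<n. F (m + i))"
  by (induct n) (simp_all add: add.assoc)

text \<open>Concatenating the two families, with a minus sign on the second, writes the difference
  as one operator of rank at most \<open>r + r'\<close>.\<close>

lemma finite_rank_diff_hs_bound:
  fixes u w u' w' :: "nat \<Rightarrow> 'd::finite fn"
  assumes u: "\<And>i. i < r \<Longrightarrow> u i \<in> L2" and w: "\<And>i. i < r \<Longrightarrow> w i \<in> L2"
    and u': "\<And>i. i < r' \<Longrightarrow> u' i \<in> L2" and w': "\<And>i. i < r' \<Longrightarrow> w' i \<in> L2"
    and D: "dense_L2 D"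
    and bound: "\<And>f g. f \<in> D \<Longrightarrow> g \<in> D \<Longrightarrow> l2norm f \<le> 1 \<Longrightarrow> l2norm g \<le> 1 \<Longrightarrow>
      cmod ((\<Sum>i<r. l2inner (u i) f * l2inner g (w i)) - (\<Sum>i<r'. l2inner (u' i) f * l2inner g (w' i))) \<le> \<sigma>"
    and f: "f \<in> L2" "l2norm f \<le> 1" and g: "g \<in> L2" "l2norm g \<le> 1" and hb: "hb > 0"
  shows "(\<integral>\<^sup>+z. ennreal ((cmod ((\<Sum>i<r. l2inner (u i) (tau_adj hb z f) * l2inner (tau_adj hb z g) (w i))
      - (\<Sum>i<r'. l2inner (u' i) (tau_adj hb z f) * l2inner (tau_adj hb z g) (w' i))))\<^sup>2) \<partial>lborel)
    \<le> ennreal (real (r + r') * \<sigma>\<^sup>2 * planck hb ^ CARD('d))"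
proof -
  define U where "U i = (if i < r then u i else u' (i - r))" for i
  define W where "W i = (if i < r then w i else (\<lambda>x. - 1 * w' (i - r) x))" for i
  have UL: "U i \<in> L2" "W i \<in> L2" if "i < r + r'" for i
    using that u w u' w' by (auto simp: U_def W_def simp del: mult_minus1)
  have eq: "(\<Sum>i<r + r'. l2inner (U i) f * l2inner g (W i))
    = (\<Sum>i<r. l2inner (u i) f * l2inner g (w i)) - (\<Sum>i<r'. l2inner (u' i) f * l2inner g (w' i))" for f g
  proof -
    have "(\<Sum>i<r'. l2inner (U (r + i)) f * l2inner g (W (r + i)))
      = (\<Sum>i<r'. - (l2inner (u' i) f * l2inner g (w' i)))"
      by (intro sum.cong refl) (simp only: U_def W_def not_add_less1 if_False diff_add_inverse l2inner_scale_right, simp)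
    moreover have "(\<Sum>i<r. l2inner (U i) f * l2inner g (W i)) = (\<Sum>i<r. l2inner (u i) f * l2inner g (w i))"
      by (intro sum.cong refl) (simp add: U_def W_def)
    ultimately show ?thesis by (simp add: sum_negf sum_lessThan_add)
  qed
  show ?thesis
    by (rule finite_rank_hs_bound[where r = "r + r'" and u = U and w = W and f = f and g = g,
          unfolded eq, OF UL D bound f g hb])
qed

subsection \<open>A weak-type estimate\<close>

lemma ennpowr_mono: "a \<le> b \<Longrightarrow> 0 \<le> q \<Longrightarrow> ennpowr a q \<le> ennpowr b q"
  unfolding ennpowr_def
  by (auto simp: top_unique less_top intro!: ennreal_leI powr_mono2 enn2real_mono)

lemma ennpowr_ennreal: "0 \<le> a \<Longrightarrow> ennpowr (ennreal a) q = ennreal (a powr q)"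
  by (simp add: ennpowr_def)

text \<open>Padding with zero vectors makes every competitor of rank at most \<open>m\<close> a
  competitor for \<open>m'\<close>.\<close>

lemma sval_antimono:
  fixes D :: "'d::finite fn set" and I :: "'i set"
  assumes "m \<le> m'" shows "sval I D B m' \<le> sval I D B m"
  unfolding sval_def
proof (rule INF_mono)
  fix uv :: "(nat \<Rightarrow> 'd fn) \<times> (nat \<Rightarrow> 'i \<Rightarrow> 'd fn)"
  assume uv: "uv \<in> {(u, v). \<forall>i<m. u i \<in> L2 \<and> (\<forall>k\<in>I. v i k \<in> L2)}"
  obtain u v where [simp]: "uv = (u, v)" by (cases uv)
  let ?u = "\<lambda>i. if i < m then u i else (\<lambda>x. 0)" and ?v = "\<lambda>i k. if i < m then v i k else (\<lambda>x. 0)"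
  have eq: "(\<Sum>i<m'. l2inner (?u i) f * (\<Sum>k\<in>I. l2inner (g k) (?v i k)))
    = (\<Sum>i<m. l2inner (u i) f * (\<Sum>k\<in>I. l2inner (g k) (v i k)))" for f g
  proof -
    have "(\<Sum>i<m'. l2inner (?u i) f * (\<Sum>k\<in>I. l2inner (g k) (?v i k)))
      = (\<Sum>i<m. l2inner (?u i) f * (\<Sum>k\<in>I. l2inner (g k) (?v i k)))"
      by (rule sum.mono_neutral_right) (use assms in auto)
    also have "\<dots> = (\<Sum>i<m. l2inner (u i) f * (\<Sum>k\<in>I. l2inner (g k) (v i k)))"
      by (intro sum.cong refl) simp
    finally show ?thesis .
  qed
  show "\<exists>uv'\<in>{(u, v). \<forall>i<m'. u i \<in> L2 \<and> (\<forall>k\<in>I. v i k \<in> L2)}.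
      (SUP fg\<in>{(f, g). f \<in> D \<and> (\<forall>k\<in>I. g k \<in> D) \<and> l2norm f \<le> 1 \<and> (\<Sum>k\<in>I. (l2norm (g k))\<^sup>2) \<le> 1}.
        ennreal (cmod (B (snd fg) (fst fg) - (\<Sum>i<m'. l2inner (fst uv' i) (fst fg) * (\<Sum>k\<in>I. l2inner (snd fg k) (snd uv' i k))))))
    \<le> (SUP fg\<in>{(f, g). f \<in> D \<and> (\<forall>k\<in>I. g k \<in> D) \<and> l2norm f \<le> 1 \<and> (\<Sum>k\<in>I. (l2norm (g k))\<^sup>2) \<le> 1}.
        ennreal (cmod (B (snd fg) (fst fg) - (\<Sum>i<m. l2inner (fst uv i) (fst fg) * (\<Sum>k\<in>I. l2inner (snd fg k) (snd uv i k))))))"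
  proof (rule bexI[of _ "(?u, ?v)"])
    show "(?u, ?v) \<in> {(u, v). \<forall>i<m'. u i \<in> L2 \<and> (\<forall>k\<in>I. v i k \<in> L2)}"
      using uv by auto
  qed (simp only: fst_conv snd_conv eq \<open>uv = (u, v)\<close> order_refl)
qed

text \<open>The approximation numbers decrease, so \<open>m + 1\<close> times the p-th power of the
  m-th one is below a partial sum of the series. This is the passage from summability to weak-type
  decay.\<close>

lemma sval_weak_bound:
  assumes S: "S > 0" and p: "p > 0" and tr: "trace_pow I D B p \<le> ennreal (S powr p)"
  shows "sval I D B m \<le> ennreal (S * (real m + 1) powr (- 1 / p))"
proof -
  let ?s = "sval I D B"
  have "of_nat (Suc m) * ennpowr (?s m) p = (\<Sum>k<Suc m. ennpowr (?s m) p)" by simp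
  also have "\<dots> \<le> (\<Sum>k<Suc m. ennpowr (?s k) p)"
    using p by (intro sum_mono ennpowr_mono sval_antimono) auto
  also have "\<dots> \<le> (\<Sum>k. ennpowr (?s k) p)"
    by (rule sum_le_suminf) auto
  also have "\<dots> \<le> ennreal (S powr p)" using tr by (simp add: trace_pow_def)
  finally have le: "of_nat (Suc m) * ennpowr (?s m) p \<le> ennreal (S powr p)" .
  have fin: "?s m \<noteq> \<infinity>"
  proof
    assume "?s m = \<infinity>"
    then have "of_nat (Suc m) * ennpowr (?s m) p = \<infinity>"
      by (simp add: ennpowr_def ennreal_mult_eq_top_iff)
    with le show False by (simp add: top_unique)
  qed
  define s where "s = enn2real (?s m)"
  have s: "?s m = ennreal s" "s \<ge> 0" using fin by (auto simp: s_def less_top)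
  have "ennreal ((real m + 1) * s powr p) \<le> ennreal (S powr p)"
    using le s by (simp add: ennpowr_ennreal ennreal_mult ennreal_of_nat_eq_real_of_nat add.commute)
  then have "(real m + 1) * s powr p \<le> S powr p"
    by (subst (asm) ennreal_le_iff) auto
  then have "s powr p \<le> S powr p / (real m + 1)"
    by (simp add: field_simps)
  then have "(s powr p) powr (1 / p) \<le> (S powr p / (real m + 1)) powr (1 / p)"
    using p by (intro powr_mono2) auto
  also have "(s powr p) powr (1 / p) = s" using p s by (simp add: powr_powr)
  also have "(S powr p / (real m + 1)) powr (1 / p) = S * (real m + 1) powr (- 1 / p)"
  proof -
    have "(S powr p / (real m + 1)) powr (1 / p) = (S powr p) powr (1 / p) / (real m + 1) powr (1 / p)"
      by (rule powr_divide)
    also have "(S powr p) powr (1 / p) = S" using p S by (simp add: powr_powr)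
    finally show ?thesis by (simp add: powr_minus_divide)
  qed
  finally show ?thesis using s by (simp add: ennreal_leI)
qed

text \<open>The infimum in \<open>sval\<close> may fail to be attained, hence the strict inequality;
  where this is applied, \<open>\<sigma>\<close> is twice the known bound.\<close>

lemma sval_approx:
  assumes "sval I D B m < ennreal \<sigma>"
  shows "\<exists>u v. (\<forall>i<m. u i \<in> L2) \<and> (\<forall>i<m. \<forall>k\<in>I. v i k \<in> L2) \<and>
    (\<forall>f g. f \<in> D \<longrightarrow> (\<forall>k\<in>I. g k \<in> D) \<longrightarrow> l2norm f \<le> 1 \<longrightarrow> (\<Sum>k\<in>I. (l2norm (g k))\<^sup>2) \<le> 1 \<longrightarrow>
      cmod (B g f - (\<Sum>i<m. l2inner (u i) f * (\<Sum>k\<in>I. l2inner (g k) (v i k)))) \<le> \<sigma>)"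
proof -
  have \<sigma>: "\<sigma> > 0" using assms by (metis ennreal_eq_0_iff linorder_not_le not_less_zero)
  obtain uv where uv: "uv \<in> {(u, v). \<forall>i<m. u i \<in> L2 \<and> (\<forall>k\<in>I. v i k \<in> L2)}"
    and lt: "(SUP fg\<in>{(f, g). f \<in> D \<and> (\<forall>k\<in>I. g k \<in> D) \<and> l2norm f \<le> 1 \<and> (\<Sum>k\<in>I. (l2norm (g k))\<^sup>2) \<le> 1}.
        ennreal (cmod (B (snd fg) (fst fg) - (\<Sum>i<m. l2inner (fst uv i) (fst fg) * (\<Sum>k\<in>I. l2inner (snd fg k) (snd uv i k)))))) < ennreal \<sigma>"
    using assms unfolding sval_def INF_less_iff by blast
  show ?thesis
  proof (intro exI[of _ "fst uv"] exI[of _ "snd uv"] conjI allI impI ballI)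
    fix f g assume *: "f \<in> D" "\<forall>k\<in>I. g k \<in> D" "l2norm f \<le> 1" "(\<Sum>k\<in>I. (l2norm (g k))\<^sup>2) \<le> 1"
    have "ennreal (cmod (B (snd (f, g)) (fst (f, g)) - (\<Sum>i<m. l2inner (fst uv i) (fst (f, g)) * (\<Sum>k\<in>I. l2inner (snd (f, g) k) (snd uv i k))))) \<le> ennreal \<sigma>"
      by (rule order_trans[OF _ less_imp_le[OF lt]], rule SUP_upper) (use * in auto)
    then show "cmod (B g f - (\<Sum>i<m. l2inner (fst uv i) f * (\<Sum>k\<in>I. l2inner (g k) (snd uv i k)))) \<le> \<sigma>"
      using \<sigma> by simp
  qed (use uv in auto)
qed

text \<open>The 2 pays for the remainder beyond the last dyadic rank. The fraction comes from a
  geometric sum of ratio \<open>2 powr (1 / 2 - 1 / p)\<close>, larger than 1 for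
  \<open>p > 2\<close>; 97 is 1 + 96, the two terms of a scale, and 96 is 48 times the factor 2 lost
  in rounding \<open>K\<close>.\<close>

definition weak_const :: "real \<Rightarrow> real" where
  "weak_const p = 2 + 97 / (2 powr (1 / 2 - 1 / p) - 1)"

text \<open>Here \<open>N\<close> stands for the number of Planck cells in the set, \<open>K\<close>
  for the number of dyadic scales and \<open>t k\<close> for the level at which scale
  \<open>k\<close> is split between \<open>L^1\<close> and \<open>L^2\<close>. The sum grows
  geometrically, so its last term decides, and stopping when \<open>2 ^ K\<close> is comparable to
  \<open>N\<close> balances it with the remainder.\<close>

lemma weak_type_numeric:
  fixes p N :: real
  assumes p: "p > 2" and N: "N > 0"
  obtains K :: nat and t :: "nat \<Rightarrow> real" where "\<And>k. t k > 0"
    "2 * 2 powr (- real K / p) + (\<Sum>k<K. t k + 48 * 2 ^ k * (2 powr (- real k / p))\<^sup>2 / (N * t k))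
      \<le> weak_const p * N powr (- 1 / p)"
proof (cases "N < 1")
  case True
  \<comment> \<open>With less than one cell no scale is used: the bound at rank 0 suffices.\<close>
  have \<beta>: "2 powr (1 / 2 - 1 / p) > (1::real)" using p by (simp add: field_simps)
  have "N powr (- 1 / p) \<ge> 1 powr (- 1 / p)"
    using True N p by (intro powr_mono2') auto
  then have "2 * 1 \<le> weak_const p * N powr (- 1 / p)"
    using \<beta> unfolding weak_const_def by (intro mult_mono) auto
  then show thesis by (intro that[of "\<lambda>_. 1" 0]) auto
next
  case False
  define \<beta> :: real where "\<beta> = 2 powr (1 / 2 - 1 / p)"
  have \<beta>: "\<beta> > 1" using p by (simp add: \<beta>_def field_simps)
  \<comment> \<open>Rounding the logarithm up gives \<open>N \<le> 2 ^ K \<le> 2 * N\<close>;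
    \<open>q\<close> below is the square root of \<open>2 ^ K\<close>.\<close>
  define K where "K = nat \<lceil>log 2 N\<rceil>"
  define q :: real where "q = 2 powr (real K / 2)"
  have q: "q > 0" by (simp add: q_def)
  have log0: "log 2 N \<ge> 0" using False by simp
  have K1: "real K \<ge> log 2 N" unfolding K_def by (rule real_nat_ceiling_ge)
  have K2: "real K \<le> log 2 N + 1" using log0 by (simp add: K_def)
  have qq: "q\<^sup>2 = 2 powr real K" by (simp add: q_def power2_eq_square flip: powr_add)
  have NK: "N \<le> 2 powr real K" using K1 N by (simp add: log_le_iff)
  have "2 powr real K \<le> 2 powr (log 2 N + 1)" using K2 by simp
  then have KN: "q\<^sup>2 \<le> 2 * N" using N qq by (simp add: powr_add)
  \<comment> \<open>Up to a constant this equalises the two terms of a scale, with \<open>q\<close>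
    in place of the square root of \<open>N\<close>.\<close>
  define t where "t k = \<beta> ^ k / q" for k
  have t: "t k > 0" for k using \<beta> q by (simp add: t_def)
  have \<beta>k: "\<beta> ^ k = 2 powr ((1 / 2 - 1 / p) * real k)" for k
    using \<beta> by (simp add: \<beta>_def powr_powr flip: powr_realpow)
  have \<beta>sq: "2 ^ k * (2 powr (- real k / p))\<^sup>2 = (\<beta> ^ k)\<^sup>2" for k
  proof -
    have "(2::real) ^ k * (2 powr (- real k / p))\<^sup>2 = 2 powr (real k + 2 * (- real k / p))"
    proof -
      have "(2::real) ^ k * (2 powr x)\<^sup>2 = 2 powr (real k + 2 * x)" for x
      proof -
        have "(2::real) ^ k = 2 powr real k" by (simp add: powr_realpow)
        then show ?thesis by (simp only: power2_eq_square powr_add[symmetric] mult_2)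
      qed
      then show ?thesis .
    qed
    also have "real k + 2 * (- real k / p) = (1 / 2 - 1 / p) * real k + (1 / 2 - 1 / p) * real k"
      by (simp add: algebra_simps)
    also have "2 powr \<dots> = (\<beta> ^ k)\<^sup>2"
      by (simp only: powr_add power2_eq_square \<beta>k)
    finally show ?thesis .
  qed
  have term_le: "t k + 48 * 2 ^ k * (2 powr (- real k / p))\<^sup>2 / (N * t k) \<le> 97 / q * \<beta> ^ k" for k
  proof -
    have "48 * 2 ^ k * (2 powr (- real k / p))\<^sup>2 / (N * t k) = 48 * (\<beta> ^ k)\<^sup>2 / (N * t k)"
      using \<beta>sq[of k] by (simp add: mult.assoc)
    also have "\<dots> = 48 * \<beta> ^ k * q / N"
      using \<beta> q N by (simp add: t_def power2_eq_square field_simps)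
    also have "\<dots> \<le> 96 * \<beta> ^ k / q"
    proof -
      have "48 * \<beta> ^ k * q\<^sup>2 \<le> 48 * \<beta> ^ k * (2 * N)"
        using KN \<beta> by (intro mult_left_mono) auto
      then show ?thesis using q N by (simp add: field_simps power2_eq_square)
    qed
    finally show ?thesis by (simp add: t_def)
  qed
  have "(\<Sum>k<K. t k + 48 * 2 ^ k * (2 powr (- real k / p))\<^sup>2 / (N * t k)) \<le> (\<Sum>k<K. 97 / q * \<beta> ^ k)"
    by (intro sum_mono term_le)
  also have "\<dots> = 97 / q * ((\<beta> ^ K - 1) / (\<beta> - 1))"
  proof -
    have "(\<Sum>k<K. \<beta> ^ k) = (\<beta> ^ K - 1) / (\<beta> - 1)" using \<beta> by (intro geometric_sum) auto
    then show ?thesis by (simp only: sum_distrib_left[symmetric])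
  qed
  also have "\<dots> \<le> 97 / q * (\<beta> ^ K / (\<beta> - 1))"
    using \<beta> q by (intro mult_left_mono divide_right_mono) auto
  also have "\<dots> = 97 / (\<beta> - 1) * 2 powr (- real K / p)"
  proof -
    have "\<beta> ^ K / q = 2 powr ((1 / 2 - 1 / p) * real K - real K / 2)"
      by (simp only: \<beta>k q_def powr_diff)
    also have "(1 / 2 - 1 / p) * real K - real K / 2 = - real K / p" by (simp add: algebra_simps)
    finally have "\<beta> ^ K / q = 2 powr (- real K / p)" .
    moreover have "97 / q * (\<beta> ^ K / (\<beta> - 1)) = 97 / (\<beta> - 1) * (\<beta> ^ K / q)"
      by (simp only: divide_inverse mult_ac)
    ultimately show ?thesis by (simp only:)
  qed
  finally have "2 * 2 powr (- real K / p) + (\<Sum>k<K. t k + 48 * 2 ^ k * (2 powr (- real k / p))\<^sup>2 / (N * t k))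
    \<le> (2 + 97 / (\<beta> - 1)) * 2 powr (- real K / p)"
    by (simp add: distrib_right)
  also have "\<dots> \<le> (2 + 97 / (\<beta> - 1)) * N powr (- 1 / p)"
  proof (rule mult_left_mono)
    have "2 powr (- real K / p) = (2 powr real K) powr (- 1 / p)" by (simp add: powr_powr)
    also have "\<dots> \<le> N powr (- 1 / p)" using NK N p by (intro powr_mono2') auto
    finally show "2 powr (- real K / p) \<le> N powr (- 1 / p)" .
  qed (use \<beta> in auto)
  finally show thesis using that[of t K] t by (simp add: \<beta>_def weak_const_def)
qed

text \<open>Approximants \<open>A k\<close> of rank at most \<open>2 ^ k - 1\<close> split the form
  into the remainder after \<open>A K\<close> and differences of consecutive approximants. The
  remainder is bounded pointwise by \<open>2 * \<sigma> K\<close> and integrated over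
  \<open>E\<close>. A difference has rank at most \<open>3 * 2 ^ k\<close> and norm at most
  \<open>4 * \<sigma> k\<close>, so it is controlled in \<open>L^2\<close> over all of phase space
  and brought down to \<open>L^1\<close> on \<open>E\<close>. The coefficients \<open>c\<close>
  contract a column of operators to a single one without increasing its approximation
  numbers.\<close>

lemma weak_type_estimate:
  fixes B :: "('i \<Rightarrow> 'd::finite fn) \<Rightarrow> 'd fn \<Rightarrow> complex" and E :: "((real^'d) \<times> (real^'d)) set"
  assumes p: "p > 2" and S: "S > 0" and hb: "hb > 0" and I: "finite I"
    and D: "dense_L2 D" and Dtau: "\<And>f z. f \<in> D \<Longrightarrow> tau_adj hb z f \<in> D"
    and Dscale: "\<And>f a. f \<in> D \<Longrightarrow> (\<lambda>x. complex_of_real a * f x) \<in> D"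
    and tr: "trace_pow I D B p \<le> ennreal (S powr p)"
    and c: "(\<Sum>k\<in>I. (c k)\<^sup>2) \<le> 1"
    and f: "f \<in> D" "l2norm f \<le> 1" and g: "g \<in> D" "l2norm g \<le> 1"
    and E[measurable]: "E \<in> sets borel" and V: "emeasure lborel E = ennreal V" "V > 0"
  shows "(\<integral>\<^sup>+z. ennreal (cmod (B (\<lambda>k x. complex_of_real (c k) * tau_adj hb z g x) (tau_adj hb z f))) * indicator E z \<partial>lborel)
    \<le> ennreal (weak_const p * (S * V * (V / planck hb ^ CARD('d)) powr (- 1 / p)))"
proof -
  define H where "H = planck hb ^ CARD('d)"
  have H: "H > 0" using hb by (simp add: H_def planck_def)
  define N where "N = V / H"
  have N: "N > 0" using V H by (simp add: N_def)
  obtain K :: nat and t :: "nat \<Rightarrow> real" where t: "\<And>k. t k > 0"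
    and num: "2 * 2 powr (- real K / p) + (\<Sum>k<K. t k + 48 * 2 ^ k * (2 powr (- real k / p))\<^sup>2 / (N * t k))
      \<le> weak_const p * N powr (- 1 / p)"
    using weak_type_numeric[OF p N] by blast
  define \<sigma> where "\<sigma> k = S * 2 powr (- real k / p)" for k
  have \<sigma>: "\<sigma> k > 0" for k using S by (simp add: \<sigma>_def)
  have DL: "D \<subseteq> L2" using D by (simp add: dense_L2_def)
  \<comment> \<open>The decay bound at index \<open>r k\<close> involves \<open>r k + 1\<close>, an
    exact power of 2, and \<open>r 0 = 0\<close> makes \<open>A 0\<close> vanish, so the telescoping
    sum starts at zero.\<close>
  define r where "r k = (2::nat) ^ k - 1" for k
  have r: "real (r k) + 1 = 2 ^ k" for k by (simp add: r_def of_nat_diff)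
  have "\<exists>u w. (\<forall>i<r k. u i \<in> L2 \<and> w i \<in> L2) \<and> (\<forall>f g. f \<in> D \<longrightarrow> g \<in> D \<longrightarrow> l2norm f \<le> 1 \<longrightarrow> l2norm g \<le> 1 \<longrightarrow>
     cmod (B (\<lambda>k x. complex_of_real (c k) * g x) f - (\<Sum>i<r k. l2inner (u i) f * l2inner g (w i))) \<le> 2 * \<sigma> k)" for k
  proof -
    have "sval I D B (r k) \<le> ennreal (S * (real (r k) + 1) powr (- 1 / p))"
      by (rule sval_weak_bound) (use S p tr in auto)
    also have "(real (r k) + 1) powr (- 1 / p) = 2 powr (- real k / p)"
      unfolding r by (simp add: powr_powr flip: powr_realpow)
    finally have "sval I D B (r k) \<le> ennreal (\<sigma> k)" by (simp add: \<sigma>_def)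
    also have "\<dots> < ennreal (2 * \<sigma> k)" using \<sigma>[of k] by (intro ennreal_lessI) auto
    finally have "sval I D B (r k) < ennreal (2 * \<sigma> k)" .
    from sval_approx[OF this] obtain u v where
      uv: "(\<forall>i<r k. u i \<in> L2) \<and> (\<forall>i<r k. \<forall>l\<in>I. v i l \<in> L2) \<and>
        (\<forall>f g. f \<in> D \<longrightarrow> (\<forall>l\<in>I. g l \<in> D) \<longrightarrow> l2norm f \<le> 1 \<longrightarrow> (\<Sum>l\<in>I. (l2norm (g l))\<^sup>2) \<le> 1 \<longrightarrow>
        cmod (B g f - (\<Sum>i<r k. l2inner (u i) f * (\<Sum>l\<in>I. l2inner (g l) (v i l)))) \<le> 2 * \<sigma> k)"
      by (elim exE)
    then have uL: "\<And>i. i < r k \<Longrightarrow> u i \<in> L2" and vL: "\<And>i l. i < r k \<Longrightarrow> l \<in> I \<Longrightarrow> v i l \<in> L2"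
      by blast+
    \<comment> \<open>Testing with the multiples \<open>c l\<close> of one function folds the
      components of each approximant into a single vector.\<close>
    define w where "w i x = (\<Sum>l\<in>I. complex_of_real (c l) * v i l x)" for i x
    have wL: "w i \<in> L2" if "i < r k" for i unfolding w_def using vL[OF that] by auto
    have main: "cmod (B (\<lambda>k x. complex_of_real (c k) * g x) f - (\<Sum>i<r k. l2inner (u i) f * l2inner g (w i))) \<le> 2 * \<sigma> k"
      if fg: "f \<in> D" "g \<in> D" "l2norm f \<le> 1" "l2norm g \<le> 1" for f g
    proof -
      have gL: "g \<in> L2" using fg DL by auto
      have "(\<Sum>l\<in>I. (l2norm (\<lambda>x. complex_of_real (c l) * g x))\<^sup>2) = (\<Sum>l\<in>I. (c l)\<^sup>2) * (l2norm g)\<^sup>2"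
        by (simp add: l2norm_scale power_mult_distrib sum_distrib_right)
      also have "\<dots> \<le> 1 * 1"
        using c fg by (intro mult_mono) (auto simp: power_le_one)
      finally have "cmod (B (\<lambda>l x. complex_of_real (c l) * g x) f
         - (\<Sum>i<r k. l2inner (u i) f * (\<Sum>l\<in>I. l2inner (\<lambda>x. complex_of_real (c l) * g x) (v i l)))) \<le> 2 * \<sigma> k"
        using uv[THEN conjunct2, THEN conjunct2, rule_format, of f "\<lambda>l x. complex_of_real (c l) * g x"]
          Dscale[OF fg(2)] fg by simp
      also have "(\<Sum>i<r k. l2inner (u i) f * (\<Sum>l\<in>I. l2inner (\<lambda>x. complex_of_real (c l) * g x) (v i l)))
        = (\<Sum>i<r k. l2inner (u i) f * l2inner g (w i))"
      proof (intro sum.cong refl)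
        fix i assume "i \<in> {..<r k}"
        then have "l2inner g (w i) = (\<Sum>l\<in>I. l2inner g (\<lambda>x. complex_of_real (c l) * v i l x))"
          unfolding w_def using vL by (intro l2inner_sum_right gL) auto
        then show "l2inner (u i) f * (\<Sum>l\<in>I. l2inner (\<lambda>x. complex_of_real (c l) * g x) (v i l)) = l2inner (u i) f * l2inner g (w i)"
          by (simp add: l2inner_scale_left l2inner_scale_right)
      qed
      finally show ?thesis .
    qed
    show ?thesis
    proof (rule exI[of _ u], rule exI[of _ w], intro conjI allI impI)
      fix f g assume "f \<in> D" "g \<in> D" "l2norm f \<le> 1" "l2norm g \<le> 1"
      then show "cmod (B (\<lambda>k x. complex_of_real (c k) * g x) f - (\<Sum>i<r k. l2inner (u i) f * l2inner g (w i))) \<le> 2 * \<sigma> k"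
        by (rule main)
    qed (use uL wL in auto)
  qed
  from choice[OF allI[OF this]] obtain u where
    "\<forall>k. \<exists>w. (\<forall>i<r k. u k i \<in> L2 \<and> w i \<in> L2) \<and> (\<forall>f g. f \<in> D \<longrightarrow> g \<in> D \<longrightarrow> l2norm f \<le> 1 \<longrightarrow> l2norm g \<le> 1 \<longrightarrow>
     cmod (B (\<lambda>k x. complex_of_real (c k) * g x) f - (\<Sum>i<r k. l2inner (u k i) f * l2inner g (w i))) \<le> 2 * \<sigma> k)"
    by (rule exE)
  from choice[OF this] obtain w where uw: "\<forall>k. (\<forall>i<r k. u k i \<in> L2 \<and> w k i \<in> L2) \<and> (\<forall>f g. f \<in> D \<longrightarrow> g \<in> D \<longrightarrow> l2norm f \<le> 1 \<longrightarrow> l2norm g \<le> 1 \<longrightarrow>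
     cmod (B (\<lambda>k x. complex_of_real (c k) * g x) f - (\<Sum>i<r k. l2inner (u k i) f * l2inner g (w k i))) \<le> 2 * \<sigma> k)"
    by (rule exE)
  then have uL: "\<And>k i. i < r k \<Longrightarrow> u k i \<in> L2" and wL: "\<And>k i. i < r k \<Longrightarrow> w k i \<in> L2"
    by blast+
  have approx: "\<And>k f g. f \<in> D \<Longrightarrow> g \<in> D \<Longrightarrow> l2norm f \<le> 1 \<Longrightarrow> l2norm g \<le> 1 \<Longrightarrow>
     cmod (B (\<lambda>k x. complex_of_real (c k) * g x) f - (\<Sum>i<r k. l2inner (u k i) f * l2inner g (w k i))) \<le> 2 * \<sigma> k"
    using uw by blast
  define A where "A k g f = (\<Sum>i<r k. l2inner (u k i) f * l2inner g (w k i))" for k g f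
  define a where "a k z = cmod (A (Suc k) (tau_adj hb z g) (tau_adj hb z f) - A k (tau_adj hb z g) (tau_adj hb z f))" for k z
  have fL: "f \<in> L2" and gL: "g \<in> L2" using f g DL by auto
  have am[measurable]: "a k \<in> borel_measurable borel" for k
    unfolding a_def A_def
    by (intro borel_measurable_continuous_onI continuous_intros continuous_on_l2inner_tau_adj fL gL) (auto intro: uL wL)
  have a_sq: "(\<integral>\<^sup>+z. ennreal ((a k z)\<^sup>2) \<partial>lborel) \<le> ennreal (48 * 2 ^ k * (\<sigma> k)\<^sup>2 * H)" for k
  proof -
    have "(\<integral>\<^sup>+z. ennreal ((a k z)\<^sup>2) \<partial>lborel) \<le> ennreal (real (r (Suc k) + r k) * (4 * \<sigma> k)\<^sup>2 * planck hb ^ CARD('d))"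
      unfolding a_def A_def
    proof (rule finite_rank_diff_hs_bound[OF uL wL uL wL D _ fL f(2) gL g(2) hb])
      fix f g assume fg: "f \<in> D" "g \<in> D" "l2norm f \<le> 1" "l2norm g \<le> 1"
      have "\<sigma> (Suc k) \<le> \<sigma> k" using S p by (simp add: \<sigma>_def field_simps)
      then show "cmod ((\<Sum>i<r (Suc k). l2inner (u (Suc k) i) f * l2inner g (w (Suc k) i)) - (\<Sum>i<r k. l2inner (u k i) f * l2inner g (w k i))) \<le> 4 * \<sigma> k"
        using approx[OF fg, of k] approx[OF fg, of "Suc k"]
          norm_triangle_ineq4[of "B (\<lambda>k x. complex_of_real (c k) * g x) f - (\<Sum>i<r k. l2inner (u k i) f * l2inner g (w k i))"
            "B (\<lambda>k x. complex_of_real (c k) * g x) f - (\<Sum>i<r (Suc k). l2inner (u (Suc k) i) f * l2inner g (w (Suc k) i))"]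
        by simp
    qed
    also have "\<dots> \<le> ennreal (48 * 2 ^ k * (\<sigma> k)\<^sup>2 * H)"
    proof (rule ennreal_leI)
      \<comment> \<open>Ranks \<open>2 ^ (k + 1) - 1\<close> and \<open>2 ^ k - 1\<close> add up to
        less than \<open>3 * 2 ^ k\<close>; with the square of \<open>4 * \<sigma> k\<close> this is
        the origin of the factor 48.\<close>
      have "real (r (Suc k) + r k) \<le> 3 * 2 ^ k" using r[of k] r[of "Suc k"] by simp
      then have "real (r (Suc k) + r k) * ((4 * \<sigma> k)\<^sup>2 * H) \<le> 3 * 2 ^ k * ((4 * \<sigma> k)\<^sup>2 * H)"
        using H by (intro mult_right_mono) auto
      then show "real (r (Suc k) + r k) * (4 * \<sigma> k)\<^sup>2 * planck hb ^ CARD('d) \<le> 48 * 2 ^ k * (\<sigma> k)\<^sup>2 * H"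
        by (simp add: H_def power_mult_distrib mult_ac)
    qed
    finally show ?thesis .
  qed
  define T where "T k = S * t k" for k
  have T: "T k > 0" for k using S t by (simp add: T_def)
  have "cmod (B (\<lambda>k x. complex_of_real (c k) * tau_adj hb z g x) (tau_adj hb z f))
      \<le> 2 * \<sigma> K + (\<Sum>k<K. T k + (a k z)\<^sup>2 / T k)" for z
  proof -
    let ?g = "tau_adj hb z g" and ?f = "tau_adj hb z f"
    have "B (\<lambda>k x. complex_of_real (c k) * ?g x) ?f =
      (B (\<lambda>k x. complex_of_real (c k) * ?g x) ?f - A K ?g ?f) + (\<Sum>k<K. A (Suc k) ?g ?f - A k ?g ?f)"
    proof -
      have "A 0 ?g ?f = 0" by (simp add: A_def r_def)
      then have tele: "(\<Sum>k<K. A (Suc k) ?g ?f - A k ?g ?f) = A K ?g ?f"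
        by (simp only: sum_lessThan_telescope[of "\<lambda>k. A k ?g ?f" K] diff_zero)
      show ?thesis unfolding tele diff_add_cancel ..
    qed
    then have "cmod (B (\<lambda>k x. complex_of_real (c k) * ?g x) ?f) \<le>
      cmod (B (\<lambda>k x. complex_of_real (c k) * ?g x) ?f - A K ?g ?f) + cmod (\<Sum>k<K. A (Suc k) ?g ?f - A k ?g ?f)"
      by (rule ord_eq_le_trans[OF arg_cong[where f = cmod] norm_triangle_ineq])
    also have "\<dots> \<le> 2 * \<sigma> K + (\<Sum>k<K. a k z)"
      unfolding a_def
      by (intro add_mono norm_sum) (auto simp: A_def intro!: approx Dtau f g simp: fL gL)
    also have "\<dots> \<le> 2 * \<sigma> K + (\<Sum>k<K. T k + (a k z)\<^sup>2 / T k)"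
    proof (intro add_left_mono sum_mono)
      fix k
      have "a k z \<ge> 0" by (simp add: a_def)
      \<comment> \<open>With \<open>T k\<close> free this trades a value for its square; the levels
        \<open>t\<close> of the numeric lemma balance the outcome.\<close>
      moreover have "2 * a k z \<le> T k + (a k z)\<^sup>2 / T k"
      proof -
        have "0 \<le> (T k - a k z)\<^sup>2 / T k" using T[of k] by simp
        also have "\<dots> = T k + (a k z)\<^sup>2 / T k - 2 * a k z" using T[of k] by (simp add: field_simps power2_eq_square)
        finally show ?thesis by simp
      qed
      ultimately show "a k z \<le> T k + (a k z)\<^sup>2 / T k" by simp
    qed
    finally show ?thesis .
  qed
  then have "(\<integral>\<^sup>+z. ennreal (cmod (B (\<lambda>k x. complex_of_real (c k) * tau_adj hb z g x) (tau_adj hb z f))) * indicator E z \<partial>lborel)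
    \<le> (\<integral>\<^sup>+z. ennreal (2 * \<sigma> K + (\<Sum>k<K. T k)) * indicator E z + (\<Sum>k<K. ennreal (1 / T k) * ennreal ((a k z)\<^sup>2)) \<partial>lborel)"
  proof (intro nn_integral_mono)
    fix z
    assume *: "\<And>z. cmod (B (\<lambda>k x. complex_of_real (c k) * tau_adj hb z g x) (tau_adj hb z f))
      \<le> 2 * \<sigma> K + (\<Sum>k<K. T k + (a k z)\<^sup>2 / T k)"
    have nn: "0 \<le> 2 * \<sigma> K + (\<Sum>k<K. T k)" using \<sigma>[of K] T by (intro add_nonneg_nonneg sum_nonneg) (auto intro: less_imp_le)
    have "(\<Sum>k<K. ennreal (1 / T k) * ennreal ((a k z)\<^sup>2)) = ennreal (\<Sum>k<K. (a k z)\<^sup>2 / T k)"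
      using T by (subst sum_ennreal[symmetric]) (auto simp: less_imp_le divide_inverse mult.commute intro!: sum.cong simp flip: ennreal_mult)
    moreover have "0 \<le> (\<Sum>k<K. (a k z)\<^sup>2 / T k)" using T by (intro sum_nonneg divide_nonneg_pos) auto
    ultimately have "ennreal (2 * \<sigma> K + (\<Sum>k<K. T k)) + (\<Sum>k<K. ennreal (1 / T k) * ennreal ((a k z)\<^sup>2))
       = ennreal (2 * \<sigma> K + (\<Sum>k<K. T k + (a k z)\<^sup>2 / T k))"
      using nn by (simp add: sum.distrib add.assoc flip: ennreal_plus)
    then have "ennreal (cmod (B (\<lambda>k x. complex_of_real (c k) * tau_adj hb z g x) (tau_adj hb z f)))
      \<le> ennreal (2 * \<sigma> K + (\<Sum>k<K. T k)) + (\<Sum>k<K. ennreal (1 / T k) * ennreal ((a k z)\<^sup>2))"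
      using *[of z] by (simp add: ennreal_leI)
    then show "ennreal (cmod (B (\<lambda>k x. complex_of_real (c k) * tau_adj hb z g x) (tau_adj hb z f))) * indicator E z
      \<le> ennreal (2 * \<sigma> K + (\<Sum>k<K. T k)) * indicator E z + (\<Sum>k<K. ennreal (1 / T k) * ennreal ((a k z)\<^sup>2))"
      by (auto split: split_indicator)
  qed
  also have "\<dots> = ennreal (2 * \<sigma> K + (\<Sum>k<K. T k)) * ennreal V + (\<Sum>k<K. ennreal (1 / T k) * (\<integral>\<^sup>+z. ennreal ((a k z)\<^sup>2) \<partial>lborel))"
    by (simp add: nn_integral_add nn_integral_sum nn_integral_cmult nn_integral_cmult_indicator V(1))
  also have "\<dots> \<le> ennreal (2 * \<sigma> K + (\<Sum>k<K. T k)) * ennreal V + (\<Sum>k<K. ennreal (1 / T k) * ennreal (48 * 2 ^ k * (\<sigma> k)\<^sup>2 * H))"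
    by (intro add_left_mono sum_mono mult_left_mono a_sq) simp
  also have "\<dots> = ennreal ((2 * \<sigma> K + (\<Sum>k<K. T k)) * V + (\<Sum>k<K. 1 / T k * (48 * 2 ^ k * (\<sigma> k)\<^sup>2 * H)))"
  proof -
    have "(\<Sum>k<K. ennreal (1 / T k) * ennreal (48 * 2 ^ k * (\<sigma> k)\<^sup>2 * H)) = (\<Sum>k<K. ennreal (1 / T k * (48 * 2 ^ k * (\<sigma> k)\<^sup>2 * H)))"
      using T H by (intro sum.cong refl ennreal_mult[symmetric]) (auto simp: less_imp_le)
    also have "\<dots> = ennreal (\<Sum>k<K. 1 / T k * (48 * 2 ^ k * (\<sigma> k)\<^sup>2 * H))"
      using T H by (intro sum_ennreal mult_nonneg_nonneg) (auto simp: less_imp_le)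
    finally have eq: "(\<Sum>k<K. ennreal (1 / T k) * ennreal (48 * 2 ^ k * (\<sigma> k)\<^sup>2 * H)) = ennreal (\<Sum>k<K. 1 / T k * (48 * 2 ^ k * (\<sigma> k)\<^sup>2 * H))" .
    have nn: "0 \<le> 2 * \<sigma> K + (\<Sum>k<K. T k)" using \<sigma>[of K] T by (intro add_nonneg_nonneg sum_nonneg) (auto intro: less_imp_le)
    have nn2: "0 \<le> (\<Sum>k<K. 1 / T k * (48 * 2 ^ k * (\<sigma> k)\<^sup>2 * H))"
      using T H by (intro sum_nonneg mult_nonneg_nonneg) (auto simp: less_imp_le)
    show ?thesis unfolding eq
      using nn nn2 V by (subst ennreal_mult[symmetric]) (auto simp: less_imp_le simp flip: ennreal_plus)
  qed
  finally have le: "(\<integral>\<^sup>+z. ennreal (cmod (B (\<lambda>k x. complex_of_real (c k) * tau_adj hb z g x) (tau_adj hb z f))) * indicator E z \<partial>lborel)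
    \<le> ennreal ((2 * \<sigma> K + (\<Sum>k<K. T k)) * V + (\<Sum>k<K. 1 / T k * (48 * 2 ^ k * (\<sigma> k)\<^sup>2 * H)))" .
  have "(2 * \<sigma> K + (\<Sum>k<K. T k)) * V + (\<Sum>k<K. 1 / T k * (48 * 2 ^ k * (\<sigma> k)\<^sup>2 * H))
    = S * V * (2 * 2 powr (- real K / p) + (\<Sum>k<K. t k + 48 * 2 ^ k * (2 powr (- real k / p))\<^sup>2 / (N * t k)))"
  proof -
    have "1 / T k * (48 * 2 ^ k * (\<sigma> k)\<^sup>2 * H) = S * V * (48 * 2 ^ k * (2 powr (- real k / p))\<^sup>2 / (N * t k))" for k
      using S V H t[of k] by (simp add: T_def \<sigma>_def N_def power2_eq_square field_simps)
    then show ?thesis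
      by (simp add: \<sigma>_def T_def sum.distrib distrib_left sum_distrib_left sum_distrib_right algebra_simps)
  qed
  also have "\<dots> \<le> S * V * (weak_const p * N powr (- 1 / p))"
    using S V by (intro mult_left_mono num) auto
  also have "\<dots> = weak_const p * (S * V * (V / planck hb ^ CARD('d)) powr (- 1 / p))"
    by (simp only: N_def H_def mult_ac)
  finally show ?thesis by (rule order_trans[OF le ennreal_leI])
qed

subsection \<open>Hoelder continuity from averaged differences\<close>

text \<open>Iterating the halving step bounds \<open>A r\<close> by a geometric series of ratio
  \<open>2 powr (- \<theta>)\<close> plus a tail value that tends to 0.\<close>

lemma telescope_powr_bound:
  fixes A :: "real \<Rightarrow> real"
  assumes \<theta>: "\<theta> > 0" and K: "K \<ge> 0" and r: "r > 0"
    and step: "\<And>\<rho>. \<rho> > 0 \<Longrightarrow> A \<rho> \<le> K * \<rho> powr \<theta> + A (\<rho> / 2)"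
    and lim: "(\<lambda>m. A (r / 2 ^ m)) \<longlonglongrightarrow> 0"
  shows "A r \<le> K / (1 - 2 powr (- \<theta>)) * r powr \<theta>"
proof -
  define q where "q = 2 powr (- \<theta>)"
  have q: "q > 0" "q < 1" using \<theta> by (simp_all add: q_def powr_less_one)
  have ind: "A r \<le> K * r powr \<theta> * (\<Sum>k<m. q ^ k) + A (r / 2 ^ m)" for m
  proof (induction m)
    case (Suc m)
    have "(r / 2 ^ m) powr \<theta> = r powr \<theta> / (2 ^ m) powr \<theta>"
      by (rule powr_divide)
    also have "(2 ^ m :: real) powr \<theta> = (2 powr \<theta>) ^ m"
      by (simp add: powr_powr mult.commute flip: powr_realpow)
    also have "r powr \<theta> / (2 powr \<theta>) ^ m = r powr \<theta> * q ^ m"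
      by (simp add: q_def powr_minus divide_inverse power_inverse)
    finally have eq: "(r / 2 ^ m) powr \<theta> = r powr \<theta> * q ^ m" .
    have "A (r / 2 ^ m) \<le> K * (r / 2 ^ m) powr \<theta> + A (r / 2 ^ m / 2)"
      using r by (intro step) simp
    moreover have "r / 2 ^ m / 2 = r / 2 ^ Suc m" by simp
    ultimately show ?case using Suc unfolding eq by (simp add: algebra_simps)
  qed simp
  have "A r \<le> K * r powr \<theta> * (1 / (1 - q)) + A (r / 2 ^ m)" for m
  proof -
    have "(\<Sum>k<m. q ^ k) = (1 - q ^ m) / (1 - q)" using q by (simp add: sum_gp_strict)
    also have "\<dots> \<le> 1 / (1 - q)" using q by (intro divide_right_mono) auto
    finally have "K * r powr \<theta> * (\<Sum>k<m. q ^ k) \<le> K * r powr \<theta> * (1 / (1 - q))"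
      using K by (intro mult_left_mono) auto
    then show ?thesis using ind[of m] by linarith
  qed
  moreover have "(\<lambda>m. K * r powr \<theta> * (1 / (1 - q)) + A (r / 2 ^ m)) \<longlonglongrightarrow> K * r powr \<theta> * (1 / (1 - q)) + 0"
    by (intro tendsto_add tendsto_const lim)
  ultimately have "A r \<le> K * r powr \<theta> * (1 / (1 - q)) + 0"
    by (intro tendsto_lowerbound[of _ _ sequentially]) auto
  then show ?thesis by (simp add: q_def)
qed

text \<open>These integrals are not divided by volumes, so a bound on \<open>mean_diff\<close> of
  Hoelder type carries \<open>2 * DIM\<close> extra powers of \<open>r\<close>, one
  \<open>DIM\<close> for each integration. The shifts of \<open>mean_diff\<close> run over radius
  \<open>2 * r\<close> because two points of a ball of radius \<open>r\<close> can be that far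
  apart.\<close>

abbreviation ball_diff :: "('a::euclidean_space \<Rightarrow> complex) \<Rightarrow> 'a \<Rightarrow> real \<Rightarrow> 'a \<Rightarrow> ennreal" where
  "ball_diff u a r y \<equiv> \<integral>\<^sup>+z. ennreal (cmod (u (z + y) - u z)) * indicator (cball a r) z \<partial>lborel"

abbreviation mean_diff :: "('a::euclidean_space \<Rightarrow> complex) \<Rightarrow> 'a \<Rightarrow> real \<Rightarrow> ennreal" where
  "mean_diff u a r \<equiv> \<integral>\<^sup>+y. ball_diff u a r y * indicator (cball 0 (2 * r)) y \<partial>lborel"

abbreviation osc :: "('a::euclidean_space \<Rightarrow> complex) \<Rightarrow> 'a set \<Rightarrow> 'a set \<Rightarrow> ennreal" where
  "osc u E F \<equiv> \<integral>\<^sup>+z. (\<integral>\<^sup>+w. ennreal (cmod (u w - u z)) * indicator F w \<partial>lborel) * indicator E z \<partial>lborel"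

text \<open>The triangle inequality between \<open>u z\<close>, \<open>u w\<close> and the constant,
  integrated over \<open>z\<close> in \<open>E\<close> and \<open>w\<close> in \<open>F\<close>. It
  compares deviations from \<open>c\<close> on two sets without introducing mean values of
  \<open>u\<close>.\<close>

lemma averaged_triangle:
  fixes u :: "'a::euclidean_space \<Rightarrow> complex"
  assumes [measurable]: "u \<in> borel_measurable borel" "E \<in> sets borel" "F \<in> sets borel"
    and e: "emeasure lborel E = ennreal e" and f: "emeasure lborel F = ennreal f"
  shows "ennreal f * (\<integral>\<^sup>+z. ennreal (cmod (u z - c)) * indicator E z \<partial>lborel)
    \<le> osc u E F
      + ennreal e * (\<integral>\<^sup>+w. ennreal (cmod (u w - c)) * indicator F w \<partial>lborel)"
proof -
  let ?I = "\<integral>\<^sup>+w. ennreal (cmod (u w - c)) * indicator F w \<partial>lborel"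
  have inner: "ennreal (cmod (u z - c)) * ennreal f
    \<le> (\<integral>\<^sup>+w. ennreal (cmod (u w - u z)) * indicator F w \<partial>lborel) + ?I" for z
  proof -
    have "ennreal (cmod (u z - c)) * ennreal f = (\<integral>\<^sup>+w. ennreal (cmod (u z - c)) * indicator F w \<partial>lborel)"
      by (simp add: nn_integral_cmult_indicator f)
    also have "\<dots> \<le> (\<integral>\<^sup>+w. ennreal (cmod (u w - u z)) * indicator F w + ennreal (cmod (u w - c)) * indicator F w \<partial>lborel)"
    proof (rule nn_integral_mono)
      fix w
      have "cmod (u z - c) \<le> cmod (u w - u z) + cmod (u w - c)"
        using norm_triangle_ineq4[of "u w - c" "u w - u z"] by simp
      then have "ennreal (cmod (u z - c)) \<le> ennreal (cmod (u w - u z)) + ennreal (cmod (u w - c))"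
        by (simp add: ennreal_leI flip: ennreal_plus)
      then show "ennreal (cmod (u z - c)) * indicator F w
        \<le> ennreal (cmod (u w - u z)) * indicator F w + ennreal (cmod (u w - c)) * indicator F w"
        by (auto split: split_indicator)
    qed
    also have "\<dots> = (\<integral>\<^sup>+w. ennreal (cmod (u w - u z)) * indicator F w \<partial>lborel) + ?I"
      by (rule nn_integral_add) measurable
    finally show ?thesis .
  qed
  have "ennreal f * (\<integral>\<^sup>+z. ennreal (cmod (u z - c)) * indicator E z \<partial>lborel)
    = (\<integral>\<^sup>+z. ennreal f * (ennreal (cmod (u z - c)) * indicator E z) \<partial>lborel)"
    by (rule nn_integral_cmult[symmetric]) measurable
  also have "\<dots> \<le> (\<integral>\<^sup>+z. (\<integral>\<^sup>+w. ennreal (cmod (u w - u z)) * indicator F w \<partial>lborel) * indicator E z + ?I * indicator E z \<partial>lborel)"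
  proof (rule nn_integral_mono)
    fix z
    show "ennreal f * (ennreal (cmod (u z - c)) * indicator E z)
      \<le> (\<integral>\<^sup>+w. ennreal (cmod (u w - u z)) * indicator F w \<partial>lborel) * indicator E z + ?I * indicator E z"
      using inner[of z] by (auto split: split_indicator simp: mult.commute)
  qed
  also have "\<dots> = osc u E F + (\<integral>\<^sup>+z. ?I * indicator E z \<partial>lborel)"
    by (rule nn_integral_add) measurable
  also have "(\<integral>\<^sup>+z. ?I * indicator E z \<partial>lborel) = ennreal e * ?I"
    by (subst nn_integral_cmult_indicator) (simp_all add: e mult.commute)
  finally show ?thesis .
qed

text \<open>Substituting \<open>w = z + y\<close> replaces pairs of points by a base point and a
  shift; the domain is then enlarged to the whole ball and to every shift that can occur.\<close>

lemma oscillation_le_averaged_differences: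
  fixes u :: "'a::euclidean_space \<Rightarrow> complex"
  assumes [measurable]: "u \<in> borel_measurable borel" "E \<in> sets borel" "F \<in> sets borel"
    and sub: "E \<subseteq> cball a r" "F \<subseteq> cball a r"
  shows "osc u E F
    \<le> mean_diff u a r"
proof -
  have [measurable]: "cball x \<rho> \<in> sets borel" for x :: 'a and \<rho> by simp
  have "osc u E F
    \<le> (\<integral>\<^sup>+z. (\<integral>\<^sup>+y. ennreal (cmod (u (z + y) - u z)) * indicator (cball a r) z * indicator (cball 0 (2 * r)) y \<partial>lborel) \<partial>lborel)"
  proof (rule nn_integral_mono)
    fix z
    show "(\<integral>\<^sup>+w. ennreal (cmod (u w - u z)) * indicator F w \<partial>lborel) * indicator E z
      \<le> (\<integral>\<^sup>+y. ennreal (cmod (u (z + y) - u z)) * indicator (cball a r) z * indicator (cball 0 (2 * r)) y \<partial>lborel)"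
    proof (cases "z \<in> E")
      case True
      then have z: "z \<in> cball a r" using sub by auto
      have "(\<lambda>w. ennreal (cmod (u w - u z)) * indicator F w) \<in> borel_measurable borel" by measurable
      from nn_integral_translate[OF this, of z]
      have "(\<integral>\<^sup>+w. ennreal (cmod (u w - u z)) * indicator F w \<partial>lborel)
        = (\<integral>\<^sup>+y. ennreal (cmod (u (z + y) - u z)) * indicator F (z + y) \<partial>lborel)"
        by (simp add: add.commute)
      also have "\<dots> \<le> (\<integral>\<^sup>+y. ennreal (cmod (u (z + y) - u z)) * indicator (cball a r) z * indicator (cball 0 (2 * r)) y \<partial>lborel)"
      proof (rule nn_integral_mono)
        fix y
        have "y \<in> cball 0 (2 * r)" if "z + y \<in> F"
        proof -
          have "dist a (z + y) \<le> r" "dist a z \<le> r" using that sub z by auto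
          then have "dist z (z + y) \<le> 2 * r" using dist_triangle3[of z "z + y" a] by simp
          then show ?thesis by (simp add: dist_norm)
        qed
        then show "ennreal (cmod (u (z + y) - u z)) * indicator F (z + y)
          \<le> ennreal (cmod (u (z + y) - u z)) * indicator (cball a r) z * indicator (cball 0 (2 * r)) y"
          using z by (auto split: split_indicator)
      qed
      finally show ?thesis using True by simp
    qed simp
  qed
  also have "\<dots> = (\<integral>\<^sup>+y. (\<integral>\<^sup>+z. ennreal (cmod (u (z + y) - u z)) * indicator (cball a r) z * indicator (cball 0 (2 * r)) y \<partial>lborel) \<partial>lborel)"
    by (rule lborel_pair.Fubini') measurable
  also have "\<dots> = mean_diff u a r"
    by (intro nn_integral_cong nn_integral_multc) measurable
  finally show ?thesis .
qed

text \<open>\<open>A x r\<close> is the mean distance of \<open>u\<close> to the value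
  \<open>u x\<close>, not to a mean of \<open>u\<close>. Passing to half the radius costs a multiple
  of \<open>r powr \<theta>\<close>, and continuity makes \<open>A\<close> vanish in the limit, so
  \<open>A\<close> is itself of that order. Two points are then joined through the balls of radius
  \<open>norm (a - b)\<close> around them, both inside the ball of twice the radius around
  \<open>a\<close>.\<close>

lemma campanato_holder:
  fixes \<theta> :: real
  assumes \<theta>: "\<theta> > 0"
  obtains C where "C > 0"
    "\<And>(u :: 'a::euclidean_space \<Rightarrow> complex) M a b. continuous_on UNIV u \<Longrightarrow> M > 0 \<Longrightarrow>
      (\<And>a r. r > 0 \<Longrightarrow>
        mean_diff u a r
          \<le> ennreal (M * r powr (2 * real DIM('a) + \<theta>))) \<Longrightarrow>
      cmod (u a - u b) \<le> C * M * norm (a - b) powr \<theta>"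
proof -
  define n where "n = DIM('a)"
  define v where "v = unit_ball_vol (real n)"
  have v: "v > 0" by (simp add: v_def)
  define \<kappa> where "\<kappa> = 2 * real n + \<theta>"
  define L where "L = 1 / (1 - 2 powr (- \<theta>))"
  have L: "L > 0" using \<theta> by (simp add: L_def powr_less_one)
  \<comment> \<open>Twice \<open>2 ^ n * L\<close> for the telescoped means at the two points,
    \<open>2 powr \<kappa>\<close> for comparing their balls inside one of twice the radius; every
    contribution is divided by two volumes.\<close>
  define C where "C = (2 * 2 ^ n * L + 2 powr \<kappa>) / v\<^sup>2"
  have C: "C > 0" using v L by (simp add: C_def add_pos_pos)
  have vol: "emeasure lborel (cball a r :: 'a set) = ennreal (v * r ^ n)" if "r \<ge> 0" for a r
    using emeasure_cball[OF that, of a] by (simp add: v_def n_def)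
  have quot_le: "i / e \<le> m / (e * f) + i' / f" if "e > 0" "f > 0" "f * i \<le> m + e * i'" for e f i i' m :: real
  proof -
    have "f * i / (e * f) \<le> (m + e * i') / (e * f)" using that by (intro divide_right_mono) auto
    then show ?thesis using that by (simp add: add_divide_distrib)
  qed
  show thesis
  proof (rule that[OF C])
    fix u :: "'a \<Rightarrow> complex" and M :: real and a b :: 'a
    assume uc: "continuous_on UNIV u" and M: "M > 0"
    assume hyp: "\<And>a r. r > 0 \<Longrightarrow>
        mean_diff u a r
          \<le> ennreal (M * r powr (2 * real DIM('a) + \<theta>))"
    have [measurable]: "cball x \<rho> \<in> sets borel" for x :: 'a and \<rho> by simp
    have um[measurable]: "u \<in> borel_measurable borel" using uc by (rule borel_measurable_continuous_onI)
    define J where "J E F = osc u E F" for E F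
    have J: "J E F \<le> ennreal (M * r powr \<kappa>)"
      if "E \<in> sets borel" "F \<in> sets borel" "E \<subseteq> cball a r" "F \<subseteq> cball a r" "r > 0" for E F a r
      unfolding J_def \<kappa>_def n_def
      using oscillation_le_averaged_differences[OF um that(1-4)] hyp[OF that(5), of a] by (rule order_trans)
    define I where "I E c = (\<integral>\<^sup>+z. ennreal (cmod (u z - c)) * indicator E z \<partial>lborel)" for E c
    have tri: "ennreal f * I E c \<le> J E F + ennreal e * I F c"
      if "E \<in> sets borel" "F \<in> sets borel" "emeasure lborel E = ennreal e" "emeasure lborel F = ennreal f" for E F e f c
      unfolding I_def J_def by (rule averaged_triangle[OF um that])
    have I_le: "I (cball x r) c \<le> ennreal (B * (v * r ^ n))"
      if "r \<ge> 0" "B \<ge> 0" "\<And>z. z \<in> cball x r \<Longrightarrow> cmod (u z - c) \<le> B" for x r c B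
    proof -
      have "I (cball x r) c \<le> (\<integral>\<^sup>+z. ennreal B * indicator (cball x r) z \<partial>lborel)"
        unfolding I_def using that by (intro nn_integral_mono) (auto split: split_indicator intro: ennreal_leI)
      also have "\<dots> = ennreal B * ennreal (v * r ^ n)"
        by (simp add: nn_integral_cmult_indicator vol[OF that(1)])
      finally show ?thesis using that v by (simp add: ennreal_mult)
    qed
    \<comment> \<open>\<open>u\<close> is bounded on a compact ball, so these integrals are finite
      and the inequalities can be moved to the reals, where division is available.\<close>
    have I_fin: "I (cball x r) c = ennreal (enn2real (I (cball x r) c))" if r: "r > 0" for x r c
    proof -
      have "compact ((\<lambda>z. cmod (u z - c)) ` cball x r)"
        by (intro compact_continuous_image continuous_intros continuous_on_subset[OF uc]) auto
      then obtain B where "\<forall>y\<in>(\<lambda>z. cmod (u z - c)) ` cball x r. norm y \<le> B"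
        using compact_imp_bounded bounded_iff by metis
      then have B: "cmod (u z - c) \<le> max B 0" if "z \<in> cball x r" for z
        using that by (auto simp: le_max_iff_disj)
      have "I (cball x r) c < \<infinity>"
        using I_le[OF less_imp_le[OF r] _ B] by (rule le_less_trans) auto
      then show ?thesis by (simp add: less_top)
    qed
    define A where "A x r = enn2real (I (cball x r) (u x)) / (v * r ^ n)" for x r
    have A_nn: "A x r \<ge> 0" if "r > 0" for x r using that v by (simp add: A_def)
    have A_step: "A x \<rho> \<le> M * 2 ^ n / v\<^sup>2 * \<rho> powr \<theta> + A x (\<rho> / 2)" if \<rho>: "\<rho> > 0" for x \<rho>
    proof -
      let ?e = "v * \<rho> ^ n" and ?f = "v * (\<rho> / 2) ^ n"
      have ef: "?e > 0" "?f > 0" using v \<rho> by auto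
      let ?i = "enn2real (I (cball x \<rho>) (u x))" and ?i' = "enn2real (I (cball x (\<rho> / 2)) (u x))"
      have "ennreal ?f * I (cball x \<rho>) (u x) \<le> J (cball x \<rho>) (cball x (\<rho> / 2)) + ennreal ?e * I (cball x (\<rho> / 2)) (u x)"
        using \<rho> by (intro tri vol) auto
      also have "J (cball x \<rho>) (cball x (\<rho> / 2)) \<le> ennreal (M * \<rho> powr \<kappa>)"
        using \<rho> by (intro J[where a = x]) auto
      finally have "ennreal ?f * ennreal ?i \<le> ennreal (M * \<rho> powr \<kappa>) + ennreal ?e * ennreal ?i'"
        using I_fin[OF \<rho>, of x "u x"] I_fin[of "\<rho> / 2" x "u x"] \<rho> by simp
      then have "ennreal (?f * ?i) \<le> ennreal (M * \<rho> powr \<kappa> + ?e * ?i')"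
        using ef M by (simp add: ennreal_mult ennreal_plus)
      then have "?f * ?i \<le> M * \<rho> powr \<kappa> + ?e * ?i'"
        using ef M by (subst (asm) ennreal_le_iff) auto
      then have "?i / ?e \<le> M * \<rho> powr \<kappa> / (?e * ?f) + ?i' / ?f"
        by (rule quot_le[OF ef])
      moreover have "M * \<rho> powr \<kappa> / (?e * ?f) = M * 2 ^ n / v\<^sup>2 * \<rho> powr \<theta>"
      proof -
        have "\<rho> powr \<kappa> = \<rho> ^ n * \<rho> ^ n * \<rho> powr \<theta>"
          by (simp only: \<kappa>_def mult_2 powr_add powr_realpow[OF \<rho>])
        then show ?thesis using \<rho> v by (simp add: power_divide power2_eq_square field_simps)
      qed
      ultimately show ?thesis by (simp add: A_def)
    qed
    have A_lim: "(\<lambda>m. A x (r / 2 ^ m)) \<longlonglongrightarrow> 0" if r: "r > 0" for x r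
    proof (rule LIMSEQ_I)
      fix e :: real assume e: "e > 0"
      have "isCont u x" using uc by (simp add: continuous_on_eq_continuous_at)
      then obtain d where d: "d > 0" "\<And>z. dist z x < d \<Longrightarrow> dist (u z) (u x) < e / 2"
        using e unfolding continuous_at_eps_delta by (metis half_gt_zero)
      have "(\<lambda>m. r * (1 / 2) ^ m) \<longlonglongrightarrow> r * 0" by (intro tendsto_mult tendsto_const LIMSEQ_realpow_zero) auto
      then have "(\<lambda>m. r / 2 ^ m) \<longlonglongrightarrow> 0" by (simp add: power_divide)
      then have "eventually (\<lambda>m. r / 2 ^ m < d) sequentially"
        using d(1) by (rule order_tendstoD)
      then obtain N where N: "\<And>m. m \<ge> N \<Longrightarrow> r / 2 ^ m < d"
        by (auto simp: eventually_sequentially)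
      have "norm (A x (r / 2 ^ m) - 0) < e" if m: "m \<ge> N" for m
      proof -
        let ?r = "r / 2 ^ m"
        have r': "?r > 0" using r by simp
        have "I (cball x ?r) (u x) \<le> ennreal (e / 2 * (v * ?r ^ n))"
        proof (rule I_le)
          fix z assume "z \<in> cball x ?r"
          then have "dist z x < d" using N[OF m] by (simp add: dist_commute)
          then show "cmod (u z - u x) \<le> e / 2" using d(2) by (simp add: dist_norm less_imp_le)
        qed (use r' e in auto)
        then have "enn2real (I (cball x ?r) (u x)) \<le> e / 2 * (v * ?r ^ n)"
          using e v r' by (intro enn2real_leI) auto
        moreover have "v * ?r ^ n > 0" using v r' by simp
        ultimately have "A x ?r \<le> e / 2" unfolding A_def by (simp only: pos_divide_le_eq)
        then show ?thesis using A_nn[OF r', of x] e by simp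
      qed
      then show "\<exists>N. \<forall>m\<ge>N. norm (A x (r / 2 ^ m) - 0) < e" by blast
    qed
    have A_bound: "A x r \<le> M * 2 ^ n / v\<^sup>2 * L * r powr \<theta>" if "r > 0" for x r
      using telescope_powr_bound[OF \<theta> _ that A_step A_lim[OF that]] M v by (simp add: L_def)
    show "cmod (u a - u b) \<le> C * M * norm (a - b) powr \<theta>"
    proof (cases "a = b")
      case False
      define r where "r = norm (a - b)"
      have r: "r > 0" using False by (simp add: r_def)
      let ?E = "cball a r" and ?F = "cball b r" and ?e = "v * r ^ n"
      have e: "?e > 0" using v r by simp
      let ?i = "enn2real (I ?E (u b))"
      have "ennreal ?e * I ?E (u b) \<le> J ?E ?F + ennreal ?e * I ?F (u b)"
        using r by (intro tri vol) auto
      also have "J ?E ?F \<le> ennreal (M * (2 * r) powr \<kappa>)"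
      proof (rule J[where a = a])
        show "?F \<subseteq> cball a (2 * r)"
        proof
          fix z assume "z \<in> ?F"
          then show "z \<in> cball a (2 * r)"
            using dist_triangle[of a z b] by (simp add: r_def dist_norm)
        qed
      qed (use r in auto)
      finally have "ennreal ?e * ennreal ?i \<le> ennreal (M * (2 * r) powr \<kappa>) + ennreal ?e * ennreal (enn2real (I ?F (u b)))"
        using I_fin[OF r, of a "u b"] I_fin[OF r, of b "u b"] by simp
      then have "ennreal (?e * ?i) \<le> ennreal (M * (2 * r) powr \<kappa> + ?e * enn2real (I ?F (u b)))"
        using e M by (simp add: ennreal_mult ennreal_plus)
      then have 1: "?e * ?i \<le> M * (2 * r) powr \<kappa> + ?e * enn2real (I ?F (u b))"
        using e M by (subst (asm) ennreal_le_iff) auto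
      have "ennreal (cmod (u a - u b)) * ennreal ?e = (\<integral>\<^sup>+z. ennreal (cmod (u a - u b)) * indicator ?E z \<partial>lborel)"
        using r by (simp add: nn_integral_cmult_indicator vol)
      also have "\<dots> \<le> (\<integral>\<^sup>+z. ennreal (cmod (u z - u a)) * indicator ?E z + ennreal (cmod (u z - u b)) * indicator ?E z \<partial>lborel)"
      proof (rule nn_integral_mono)
        fix z
        have "cmod (u a - u b) \<le> cmod (u z - u a) + cmod (u z - u b)"
          using norm_triangle_ineq4[of "u z - u b" "u z - u a"] by simp
        then have "ennreal (cmod (u a - u b)) \<le> ennreal (cmod (u z - u a)) + ennreal (cmod (u z - u b))"
          by (simp add: ennreal_leI flip: ennreal_plus)
        then show "ennreal (cmod (u a - u b)) * indicator ?E z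
          \<le> ennreal (cmod (u z - u a)) * indicator ?E z + ennreal (cmod (u z - u b)) * indicator ?E z"
          by (auto split: split_indicator)
      qed
      also have "\<dots> = I ?E (u a) + I ?E (u b)"
        unfolding I_def by (rule nn_integral_add) measurable
      finally have "ennreal (cmod (u a - u b) * ?e) \<le> ennreal (enn2real (I ?E (u a)) + ?i)"
        using I_fin[OF r, of a "u a"] I_fin[OF r, of a "u b"] e by (simp add: ennreal_mult ennreal_plus)
      then have "cmod (u a - u b) * ?e \<le> enn2real (I ?E (u a)) + ?i"
        by (subst (asm) ennreal_le_iff) auto
      then have "cmod (u a - u b) \<le> (enn2real (I ?E (u a)) + ?i) / ?e"
        using e by (simp only: pos_le_divide_eq)
      also have "\<dots> = A a r + ?i / ?e" by (simp add: A_def add_divide_distrib)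
      finally have le1: "cmod (u a - u b) \<le> A a r + ?i / ?e" .
      have le2: "?i / ?e \<le> M * (2 * r) powr \<kappa> / (?e * ?e) + A b r"
      proof -
        show ?thesis unfolding A_def by (rule quot_le[OF e e 1])
      qed
      have eq3: "M * (2 * r) powr \<kappa> / (?e * ?e) = M * 2 powr \<kappa> / v\<^sup>2 * r powr \<theta>"
      proof -
        have "r powr \<kappa> = r ^ n * r ^ n * r powr \<theta>"
          by (simp only: \<kappa>_def mult_2 powr_add powr_realpow[OF r])
        then have "(2 * r) powr \<kappa> = 2 powr \<kappa> * (r ^ n * r ^ n * r powr \<theta>)"
          using r by (simp add: powr_mult)
        then show ?thesis using r v by (simp add: power2_eq_square field_simps)
      qed
      have lin: "x \<le> 2 * k + m" if "x \<le> A1 + q" "q \<le> m + A2" "A1 \<le> k" "A2 \<le> k" for x k m q A1 A2 :: real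
        using that by linarith
      have "cmod (u a - u b) \<le> 2 * (M * 2 ^ n / v\<^sup>2 * L * r powr \<theta>) + M * 2 powr \<kappa> / v\<^sup>2 * r powr \<theta>"
        by (rule lin[OF le1 le2[unfolded eq3] A_bound[OF r] A_bound[OF r]])
      also have "\<dots> = C * M * r powr \<theta>"
        using v by (simp add: C_def field_simps)
      finally show ?thesis by (simp add: r_def)
    qed (use C M in simp)
  qed
qed

subsection \<open>Bounded operators and their phase space orbits\<close>

definition bdd_op :: "real \<Rightarrow> ('d::finite fn \<Rightarrow> 'd fn) \<Rightarrow> bool" where
  "bdd_op R \<rho> \<longleftrightarrow> is_operator \<rho> \<and> 0 \<le> R \<and> (\<forall>f\<in>L2. l2norm (\<rho> f) \<le> R * l2norm f)"

lemma is_operator_L2: "is_operator \<rho> \<Longrightarrow> f \<in> L2 \<Longrightarrow> \<rho> f \<in> L2"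
  by (simp add: is_operator_def)

lemma is_operator_lin:
  assumes "is_operator \<rho>" "f \<in> L2" "g \<in> L2"
  shows "AE x in lborel. \<rho> (\<lambda>y. a * f y + b * g y) x = a * \<rho> f x + b * \<rho> g x"
  using assms unfolding is_operator_def by blast

lemma is_operator_cong:
  assumes "is_operator \<rho>" "f \<in> L2" "g \<in> L2" "AE x in lborel. f x = g x"
  shows "AE x in lborel. \<rho> f x = \<rho> g x"
  using assms unfolding is_operator_def by blast

lemma is_operator_scale:
  assumes "is_operator \<rho>" "f \<in> L2"
  shows "AE x in lborel. \<rho> (\<lambda>y. a * f y) x = a * \<rho> f x"
  using is_operator_lin[OF assms assms(2), of a 0] by simp

lemma is_operator_diff:
  assumes "is_operator \<rho>" "f \<in> L2" "g \<in> L2"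
  shows "AE x in lborel. \<rho> (\<lambda>y. f y - g y) x = \<rho> f x - \<rho> g x"
  using is_operator_lin[OF assms, of 1 "-1"] by simp

lemma l2inner_op_scale:
  assumes "is_operator \<rho>" "f \<in> L2" "h \<in> L2"
  shows "l2inner h (\<rho> (\<lambda>y. a * f y)) = a * l2inner h (\<rho> f)"
proof -
  have "l2inner h (\<rho> (\<lambda>y. a * f y)) = l2inner h (\<lambda>x. a * \<rho> f x)"
    by (rule l2inner_cong_AE) (use assms is_operator_scale[OF assms(1,2)] in \<open>auto intro: is_operator_L2\<close>)
  then show ?thesis by (simp add: l2inner_scale_right)
qed

lemma l2inner_op_add:
  assumes "is_operator \<rho>" "f \<in> L2" "g \<in> L2" "h \<in> L2"
  shows "l2inner h (\<rho> (\<lambda>y. f y + g y)) = l2inner h (\<rho> f) + l2inner h (\<rho> g)"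
proof -
  have "l2inner h (\<rho> (\<lambda>y. f y + g y)) = l2inner h (\<lambda>x. \<rho> f x + \<rho> g x)"
    by (rule l2inner_cong_AE)
       (use assms is_operator_lin[OF assms(1,2,3), of 1 1] in \<open>auto intro: is_operator_L2\<close>)
  then show ?thesis using assms by (simp add: l2inner_add_right is_operator_L2)
qed

lemma l2norm_op_diff:
  assumes "is_operator \<rho>" "f \<in> L2" "g \<in> L2"
  shows "l2norm (\<lambda>x. \<rho> f x - \<rho> g x) = l2norm (\<rho> (\<lambda>x. f x - g x))"
  by (rule l2norm_cong_AE)
     (use assms is_operator_diff[OF assms] in \<open>auto intro: is_operator_L2\<close>)

lemma l2norm_op_scale:
  assumes "is_operator \<rho>" "f \<in> L2"
  shows "l2norm (\<rho> (\<lambda>x. a * f x)) = cmod a * l2norm (\<rho> f)"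
proof -
  have "l2norm (\<rho> (\<lambda>x. a * f x)) = l2norm (\<lambda>x. a * \<rho> f x)"
    by (rule l2norm_cong_AE)
       (use assms is_operator_scale[OF assms] in \<open>auto intro: is_operator_L2\<close>)
  then show ?thesis by (simp add: l2norm_scale)
qed

text \<open>Functions are not identified almost everywhere, so a vector of norm 0 need not be the
  zero function; an operator respects almost-everywhere equality, which allows the comparison with a
  zero multiple.\<close>

lemma l2norm_op_null:
  assumes \<rho>: "is_operator \<rho>" and f: "f \<in> L2" "l2norm f = 0"
  shows "l2norm (\<rho> f) = 0"
proof -
  have "AE x in lborel. f x = 0 * f x" using l2norm_eq_0_AE[OF f] by simp
  then have "AE x in lborel. \<rho> f x = \<rho> (\<lambda>x. 0 * f x) x"
    using is_operator_cong[OF \<rho> f(1) L2_scale[OF f(1)]] by blast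
  then have "l2norm (\<rho> f) = l2norm (\<rho> (\<lambda>x. 0 * f x))"
    by (intro l2norm_cong_AE is_operator_L2[OF \<rho>] f L2_scale)
  then show ?thesis using l2norm_op_scale[OF \<rho> f(1), of 0] by simp
qed

text \<open>Otherwise there are vectors of norm at most 1 whose images have norm above
  \<open>n\<close>, for every \<open>n\<close>. A subsequence with Cauchy images has bounded images,
  against this growth.\<close>

lemma compact_op_bounded:
  assumes "compact_op \<rho>" shows "\<exists>R. bdd_op R \<rho>"
proof (rule ccontr)
  assume no: "\<not> (\<exists>R. bdd_op R \<rho>)"
  have \<rho>: "is_operator \<rho>" using assms by (simp add: compact_op_def)
  have "\<exists>F. F \<in> L2 \<and> l2norm F \<le> 1 \<and> l2norm (\<rho> F) > real n" for n
  proof -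
    have "\<not> bdd_op (real n) \<rho>" using no by blast
    then obtain f where f: "f \<in> L2" "l2norm (\<rho> f) > real n * l2norm f"
      using \<rho> by (auto simp: bdd_op_def not_le)
    have nz: "l2norm f \<noteq> 0" using f l2norm_op_null[OF \<rho> f(1)] by auto
    then have pos: "l2norm f > 0" using l2norm_nonneg[of f] by linarith
    define F where "F x = of_real (1 / l2norm f) * f x" for x
    have "l2norm F \<le> 1" unfolding F_def l2norm_scale norm_of_real using pos by simp
    moreover have "l2norm (\<rho> F) = l2norm (\<rho> f) / l2norm f"
      unfolding F_def l2norm_op_scale[OF \<rho> f(1)] norm_of_real using pos by simp
    then have "l2norm (\<rho> F) > real n" using f(2) pos by (simp add: pos_less_divide_eq)
    moreover have "F \<in> L2" unfolding F_def by (rule L2_scale[OF f(1)])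
    ultimately show ?thesis by blast
  qed
  from choice[OF allI[OF this]] obtain F where F: "\<forall>n. F n \<in> L2 \<and> l2norm (F n) \<le> 1 \<and> l2norm (\<rho> (F n)) > real n"
    by (rule exE)
  then have "\<exists>r::nat \<Rightarrow> nat. strict_mono r \<and>
    (\<forall>e>0. \<exists>N. \<forall>m\<ge>N. \<forall>n\<ge>N. l2norm (\<lambda>x. \<rho> (F (r m)) x - \<rho> (F (r n)) x) < e)"
    using assms unfolding compact_op_def by blast
  then obtain r :: "nat \<Rightarrow> nat" where r: "strict_mono r"
    and cauchy: "\<forall>e>0. \<exists>N. \<forall>m\<ge>N. \<forall>n\<ge>N. l2norm (\<lambda>x. \<rho> (F (r m)) x - \<rho> (F (r n)) x) < e"
    by blast
  from cauchy[rule_format, of 1] obtain N where N: "\<And>m n. m \<ge> N \<Longrightarrow> n \<ge> N \<Longrightarrow> l2norm (\<lambda>x. \<rho> (F (r m)) x - \<rho> (F (r n)) x) < 1"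
    by auto
  define m where "m = max N (nat \<lceil>l2norm (\<rho> (F (r N))) + 1\<rceil>)"
  have "l2norm (\<rho> (F (r m))) \<le> l2norm (\<rho> (F (r N))) + l2norm (\<lambda>x. \<rho> (F (r m)) x - \<rho> (F (r N)) x)"
    by (intro l2norm_diff_le is_operator_L2[OF \<rho>]) (use F in auto)
  also have "\<dots> < l2norm (\<rho> (F (r N))) + 1" using N[of m N] by (simp add: m_def)
  also have "\<dots> \<le> real (nat \<lceil>l2norm (\<rho> (F (r N))) + 1\<rceil>)" by (rule real_nat_ceiling_ge)
  also have "\<dots> \<le> real m" unfolding m_def by (intro of_nat_mono max.cobounded2)
  also have "\<dots> \<le> real (r m)" using seq_suble[OF r, of m] by simp
  finally have "l2norm (\<rho> (F (r m))) < real (r m)" .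
  moreover have "real (r m) < l2norm (\<rho> (F (r m)))" using F by blast
  ultimately show False by (rule order_less_asym)
qed

lemma bdd_op_tendsto:
  assumes \<rho>: "bdd_op R \<rho>" and L: "\<And>n. f n \<in> L2" "f0 \<in> L2"
    and lim: "(\<lambda>n. l2norm (\<lambda>x. f n x - f0 x)) \<longlonglongrightarrow> 0"
  shows "(\<lambda>n. l2norm (\<lambda>x. \<rho> (f n) x - \<rho> f0 x)) \<longlonglongrightarrow> 0"
proof (rule Lim_null_comparison)
  have op: "is_operator \<rho>" using \<rho> by (simp add: bdd_op_def)
  show "\<forall>\<^sub>F n in sequentially. norm (l2norm (\<lambda>x. \<rho> (f n) x - \<rho> f0 x)) \<le> R * l2norm (\<lambda>x. f n x - f0 x)"
    using \<rho> L by (intro always_eventually allI) (simp add: l2norm_op_diff[OF op] bdd_op_def)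
  show "(\<lambda>n. R * l2norm (\<lambda>x. f n x - f0 x)) \<longlonglongrightarrow> 0"
    using tendsto_mult_right_zero[OF lim] .
qed

text \<open>The matrix element of \<open>Tz hb z \<rho>\<close> between \<open>g\<close> and
  \<open>f\<close>, with both shifts moved onto the vectors. In this form \<open>z\<close> enters
  only through shifted vectors, which remain test functions if \<open>f\<close> and \<open>g\<close>
  are.\<close>

definition orbit :: "real \<Rightarrow> ('d::finite fn \<Rightarrow> 'd fn) \<Rightarrow> 'd fn \<Rightarrow> 'd fn \<Rightarrow> (real^'d) \<times> (real^'d) \<Rightarrow> complex" where
  "orbit hb \<rho> g f z = l2inner (tau_adj hb z g) (\<rho> (tau_adj hb z f))"

lemma continuous_orbit:
  fixes \<rho> :: "'d::finite fn \<Rightarrow> 'd fn"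
  assumes \<rho>: "bdd_op R \<rho>" and f: "f \<in> L2" and g: "g \<in> L2"
  shows "continuous_on UNIV (orbit hb \<rho> g f)"
  unfolding continuous_on_sequentially o_def
proof (intro allI ballI impI)
  fix z :: "(real^'d) \<times> (real^'d)" and Z assume "(\<forall>n. Z n \<in> UNIV) \<and> Z \<longlonglongrightarrow> z"
  then have Z: "Z \<longlonglongrightarrow> z" by blast
  have op: "is_operator \<rho>" using \<rho> by (simp add: bdd_op_def)
  have "(\<lambda>n. l2norm (\<lambda>x. \<rho> (tau_adj hb (Z n) f) x - \<rho> (tau_adj hb z f) x)) \<longlonglongrightarrow> 0"
    by (rule bdd_op_tendsto[OF \<rho> _ _ tau_adj_tendsto[OF f Z]]) (use f in auto)
  from l2inner_tendsto[OF _ _ _ _ this tau_adj_tendsto[OF g Z]]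
  show "(\<lambda>n. orbit hb \<rho> g f (Z n)) \<longlonglongrightarrow> orbit hb \<rho> g f z"
    unfolding orbit_def using f g is_operator_L2[OF op] by simp
qed

text \<open>Shifts compose up to a phase of modulus 1, which occurs once conjugated and once not,
  and cancels. So the orbit is covariant although the shifts form only a projective
  representation.\<close>

lemma orbit_add:
  assumes op: "is_operator \<rho>" and f: "f \<in> L2" and g: "g \<in> L2"
  shows "orbit hb \<rho> g f (z + y) = orbit hb \<rho> (tau_adj hb z g) (tau_adj hb z f) y"
proof -
  obtain c where c: "cmod c = 1" "\<forall>f. tau_adj hb (z + y) f = (\<lambda>x. c * tau_adj hb y (tau_adj hb z f) x)"
    using tau_adj_add[of hb z y] by (elim exE conjE)
  have "cnj c * c = 1" using c(1) by (metis complex_mod_mult_cnj mult.commute of_real_1 complex_norm_square power_one)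
  then have "cnj c * (c * t) = t" for t by (metis mult.assoc mult_1)
  then show ?thesis
    unfolding orbit_def c(2)[rule_format] l2inner_scale_left
    by (subst l2inner_op_scale[OF op]) (use f g in auto)
qed

lemma l2inner_Tz_diff:
  assumes op: "is_operator \<rho>" and f: "f \<in> L2" and g: "g \<in> L2"
  shows "l2inner g (op_diff (Tz hb z \<rho>) \<rho> f) = orbit hb \<rho> g f z - orbit hb \<rho> g f 0"
proof -
  have L: "\<rho> (tau_adj hb z f) \<in> L2" "\<rho> f \<in> L2" using f is_operator_L2[OF op] by auto
  show ?thesis
    unfolding op_diff_def Tz_def orbit_def
    by (subst l2inner_diff_right) (use L g in \<open>auto simp: l2inner_tau\<close>)
qed

lemma orbit_diff_eq:
  assumes op: "is_operator \<rho>" and f: "f \<in> L2" and g: "g \<in> L2"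
  shows "orbit hb \<rho> g f (z + y) - orbit hb \<rho> g f z
    = l2inner (tau_adj hb z g) (op_diff (Tz hb y \<rho>) \<rho> (tau_adj hb z f))"
  using orbit_add[OF op f g, of hb z y] orbit_add[OF op f g, of hb z 0]
  by (subst l2inner_Tz_diff[OF op]) (use f g in auto)

text \<open>The operator norm is recovered by duality, with the normalised image of \<open>f\<close>
  as \<open>g\<close>; bounds on a dense set pass to \<open>L2\<close> since the orbit depends
  continuously on both vectors.\<close>

lemma W_inf_le:
  fixes \<rho> :: "'d::finite fn \<Rightarrow> 'd fn"
  assumes \<rho>: "bdd_op R \<rho>" and D: "dense_L2 D" and c: "c \<ge> 0"
    and bound: "\<And>f g z. f \<in> D \<Longrightarrow> g \<in> D \<Longrightarrow> l2norm f \<le> 1 \<Longrightarrow> l2norm g \<le> 1 \<Longrightarrow>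
      cmod (orbit hb \<rho> g f z - orbit hb \<rho> g f 0) \<le> c * norm z powr \<theta>"
  shows "W_inf hb \<theta> \<rho> \<le> ennreal c"
proof -
  have op: "is_operator \<rho>" using \<rho> by (simp add: bdd_op_def)
  have bound': "cmod (orbit hb \<rho> g f z - orbit hb \<rho> g f 0) \<le> c * norm z powr \<theta>"
    if L: "f \<in> L2" "g \<in> L2" "l2norm f \<le> 1" "l2norm g \<le> 1" for f g z
  proof -
    obtain F where F: "\<And>n::nat. F n \<in> D" "\<And>n. F n \<in> L2" "\<And>n. l2norm (F n) \<le> 1"
      "(\<lambda>n. l2norm (\<lambda>x. F n x - f x)) \<longlonglongrightarrow> 0"
      using dense_L2_seq[OF D L(1,3)] by blast
    obtain G where G: "\<And>n::nat. G n \<in> D" "\<And>n. G n \<in> L2" "\<And>n. l2norm (G n) \<le> 1"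
      "(\<lambda>n. l2norm (\<lambda>x. G n x - g x)) \<longlonglongrightarrow> 0"
      using dense_L2_seq[OF D L(2,4)] by blast
    have tau_lim: "(\<lambda>n. l2norm (\<lambda>x. tau_adj hb w (h n) x - tau_adj hb w h0 x)) \<longlonglongrightarrow> 0"
      if "\<And>n. h n \<in> L2" "h0 \<in> L2" "(\<lambda>n. l2norm (\<lambda>x. h n x - h0 x)) \<longlonglongrightarrow> 0"
      for w and h :: "nat \<Rightarrow> 'd fn" and h0
      using that l2norm_tau_adj[OF L2_diff[OF that(1,2)]] by (simp add: tau_adj_diff)
    have lim: "(\<lambda>n. orbit hb \<rho> (G n) (F n) w) \<longlonglongrightarrow> orbit hb \<rho> g f w" for w
    proof -
      have "(\<lambda>n. l2norm (\<lambda>x. \<rho> (tau_adj hb w (F n)) x - \<rho> (tau_adj hb w f) x)) \<longlonglongrightarrow> 0"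
        by (rule bdd_op_tendsto[OF \<rho> _ _ tau_lim[OF F(2) L(1) F(4)]]) (use F L in auto)
      from l2inner_tendsto[OF _ _ _ _ this tau_lim[OF G(2) L(2) G(4)]]
      show ?thesis
        unfolding orbit_def using F(2) G(2) L is_operator_L2[OF op] by simp
    qed
    show ?thesis
      by (rule Lim_bounded[OF tendsto_norm[OF tendsto_diff[OF lim lim]]]) (use bound F G in auto)
  qed
  have "opnorm (op_diff (Tz hb z \<rho>) \<rho>) \<le> ennreal (c * norm z powr \<theta>)" for z
    unfolding opnorm_def
  proof (rule SUP_least)
    fix f :: "'d fn" assume "f \<in> {f \<in> L2. l2norm f \<le> 1}"
    then have f: "f \<in> L2" "l2norm f \<le> 1" by auto
    let ?X = "op_diff (Tz hb z \<rho>) \<rho> f"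
    have XL: "?X \<in> L2"
      unfolding op_diff_def Tz_def using f is_operator_L2[OF op] by auto
    have "l2norm ?X \<le> c * norm z powr \<theta>"
    proof (cases "l2norm ?X = 0")
      case False
      then have n: "l2norm ?X > 0" using l2norm_nonneg[of ?X] by linarith
      define g where "g t = of_real (1 / l2norm ?X) * ?X t" for t
      have gL: "g \<in> L2" unfolding g_def by (rule L2_scale[OF XL])
      have g1: "l2norm g \<le> 1" unfolding g_def l2norm_scale norm_of_real using n by simp
      have "l2inner g ?X = of_real (1 / l2norm ?X * (l2norm ?X)\<^sup>2)"
        unfolding g_def l2inner_scale_left complex_cnj_complex_of_real by (simp only: l2inner_self of_real_mult)
      also have "1 / l2norm ?X * (l2norm ?X)\<^sup>2 = l2norm ?X" using n by (simp add: power2_eq_square)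
      finally have "cmod (of_real (l2norm ?X)) \<le> c * norm z powr \<theta>"
        using bound'[OF f(1) gL f(2) g1, of z] l2inner_Tz_diff[OF op f(1) gL, of hb z] by (simp only:)
      then show ?thesis by simp
    qed (use c in simp)
    then show "ennreal (l2norm ?X) \<le> ennreal (c * norm z powr \<theta>)" by (rule ennreal_leI)
  qed
  note opn = this
  show ?thesis
    unfolding W_inf_def
  proof (rule SUP_least)
    fix z :: "(real^'d) \<times> (real^'d)" assume "z \<in> UNIV - {0}"
    then have z: "norm z powr \<theta> > 0" by simp
    have "opnorm (op_diff (Tz hb z \<rho>) \<rho>) / ennreal (norm z powr \<theta>) \<le> ennreal (c * norm z powr \<theta>) / ennreal (norm z powr \<theta>)"
      by (rule divide_right_mono_ennreal[OF opn])
    also have "\<dots> = ennreal (c * norm z powr \<theta> / norm z powr \<theta>)"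
      using z c by (intro divide_ennreal) auto
    also have "c * norm z powr \<theta> / norm z powr \<theta> = c" using z by simp
    finally show "opnorm (op_diff (Tz hb z \<rho>) \<rho>) / ennreal (norm z powr \<theta>) \<le> ennreal c" .
  qed
qed

text \<open>Norms take values in \<open>ennreal\<close>. Restricting to positive real majorants lets
  the estimates assume a positive finite norm and leaves the values 0 and infinity to this
  lemma.\<close>

lemma ennreal_bound_from_real_bounds:
  assumes C: "C > 0" and *: "\<And>w. w > 0 \<Longrightarrow> W \<le> ennreal w \<Longrightarrow> X \<le> ennreal (C * w)"
  shows "X \<le> ennreal C * W"
proof (cases "W = \<infinity>")
  case True
  then show ?thesis using C by (simp add: ennreal_mult_top)
next
  case False
  then obtain w where w: "W = ennreal w" "w \<ge> 0" by (cases W) auto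
  show ?thesis
  proof (rule ennreal_le_epsilon)
    fix e :: real assume e: "0 < e"
    \<comment> \<open>Adding \<open>e / C\<close> makes the majorant positive even when
      \<open>w = 0\<close>.\<close>
    have "X \<le> ennreal (C * (w + e / C))"
      using w e C by (intro *) (auto intro!: ennreal_leI add_nonneg_pos)
    also have "C * (w + e / C) = C * w + e" using C by (simp add: distrib_left)
    also have "ennreal (C * w + e) = ennreal C * W + ennreal e"
      using w e C by (simp add: ennreal_mult)
    finally show "X \<le> ennreal C * W + ennreal e" .
  qed
qed

lemma ennpowr_le_imp:
  assumes "ennpowr X (1 / p) \<le> ennreal w" "p > 0" "w \<ge> 0"
  shows "X \<le> ennreal (w powr p)"
proof (cases "X = \<infinity>")
  case False
  then obtain x where x: "X = ennreal x" "x \<ge> 0" by (cases X) auto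
  have "x powr (1 / p) \<le> w"
    using assms x by (simp add: ennpowr_ennreal)
  then have "(x powr (1 / p)) powr p \<le> w powr p" using assms by (intro powr_mono2) auto
  then have "x \<le> w powr p" using x assms by (simp add: powr_powr)
  then show ?thesis using x by (simp add: ennreal_leI)
next
  case True
  then have "ennpowr X (1 / p) = \<infinity>" by (simp add: ennpowr_def)
  then show ?thesis using assms(1) by (simp add: top_unique)
qed

subsection \<open>The fractional case\<close>

lemma gamma_sp_pos:
  assumes "0 < s" "s < 1" "0 < p" "0 < d"
  shows "gamma_sp d s p > 0"
proof -
  \<comment> \<open>At its poles \<open>Gamma\<close> has the value 0 by convention;
    \<open>- s\<close> lies strictly between -1 and 0, hence is not a pole.\<close>
  have "Gamma (- s) \<noteq> 0"
  proof -
    have "- s \<notin> \<int>\<^sub>\<le>\<^sub>0"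
    proof
      assume "- s \<in> \<int>\<^sub>\<le>\<^sub>0"
      then obtain n :: int where "- s = of_int n" by (auto elim!: nonpos_Ints_cases)
      then have "- 1 < real_of_int n" "real_of_int n < 0" using assms by linarith+
      then show False by simp
    qed
    then show ?thesis by (simp add: Gamma_eq_zero_iff)
  qed
  then have "omega (- 2 * s) \<noteq> 0" by (simp add: omega_def)
  moreover have "omega (2 * real d + s * p) > 0" "omega (p + 1) > 0"
    using assms by (auto simp: omega_def intro!: divide_pos_pos mult_pos_pos Gamma_real_pos add_pos_pos)
  ultimately show ?thesis
    using assms unfolding gamma_sp_def by (auto intro!: mult_pos_pos divide_pos_pos)
qed

text \<open>The hypothesis bounds \<open>G\<close> by \<open>\<kappa>\<close> times the p-th root of
  \<open>N\<close>, whereas only a weighted integral of \<open>N\<close> itself is known. If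
  \<open>N\<close> is at most \<open>t powr p\<close> the root is at most \<open>t\<close>;
  otherwise it is at most \<open>t powr (1 - p) * N\<close>. The sum of both bounds is affine in
  \<open>N\<close>.\<close>

lemma young_type_bound:
  assumes p: "p > 1" and \<kappa>: "\<kappa> > 0" and t: "t > 0"
    and G: "\<And>S. S > 0 \<Longrightarrow> N \<le> ennreal (S powr p) \<Longrightarrow> G \<le> ennreal (\<kappa> * S)"
  shows "G \<le> ennreal (\<kappa> * t) + ennreal (\<kappa> * t powr (1 - p)) * N"
proof (cases "N = \<infinity>")
  case True
  then show ?thesis using \<kappa> t by (simp add: ennreal_mult_top)
next
  case False
  then obtain n where n: "N = ennreal n" "n \<ge> 0" by (cases N) auto
  show ?thesis
  proof (cases "n \<le> t powr p")
    case True
    then have "G \<le> ennreal (\<kappa> * t)" using n t by (intro G) (auto intro: ennreal_leI)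
    then show ?thesis by (rule order_trans) simp
  next
    case False
    define S where "S = n powr (1 / p)"
    have npos: "n > 0" using False powr_ge_zero[of t p] by linarith
    have Sp: "S powr p = n" using npos p by (simp add: S_def powr_powr)
    have S: "S > 0" using npos by (simp add: S_def)
    have St: "t < S"
    proof (rule ccontr)
      assume "\<not> t < S"
      then have "S powr p \<le> t powr p" using S p by (intro powr_mono2) auto
      then show False using False Sp by simp
    qed
    have "G \<le> ennreal (\<kappa> * S)" using S Sp n by (intro G) auto
    also have "\<dots> \<le> ennreal (\<kappa> * t powr (1 - p) * n)"
    proof (rule ennreal_leI)
      have "S = S powr (1 - p) * S powr p" using S by (simp flip: powr_add)
      also have "\<dots> \<le> t powr (1 - p) * S powr p"
        using St t p by (intro mult_right_mono powr_mono2') auto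
      finally show "\<kappa> * S \<le> \<kappa> * t powr (1 - p) * n" using \<kappa> Sp by (simp add: mult.assoc)
    qed
    also have "\<dots> = ennreal (\<kappa> * t powr (1 - p)) * N" using n \<kappa> by (simp add: ennreal_mult)
    finally show ?thesis by (rule order_trans) simp
  qed
qed

text \<open>\<open>N\<close> is not assumed measurable: the measurable function \<open>G - \<kappa> t\<close> is compared with it pointwise.\<close>
lemma truncated_integral_bound:
  fixes G N :: "'a::euclidean_space \<Rightarrow> ennreal"
  assumes Gm[measurable]: "G \<in> borel_measurable borel"
    and le: "\<And>y. G y \<le> ennreal a + ennreal b * N y" and ab: "a > 0" "b > 0"
    and q: "q > 0" and r: "r > 0"
    and J: "(\<integral>\<^sup>+y. N y / ennreal (norm y powr q) \<partial>lborel) \<le> ennreal j" and j: "j \<ge> 0"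
    and vol: "emeasure lborel (cball (0::'a) r) = ennreal V" and V: "V \<ge> 0"
  shows "(\<integral>\<^sup>+y. G y * indicator (cball 0 r) y \<partial>lborel) \<le> ennreal (a * V + b * r powr q * j)"
proof -
  have [measurable]: "cball x \<rho> \<in> sets borel" for x :: 'a and \<rho> by simp
  let ?k = "1 / (b * r powr q)"
  have k: "?k > 0" using ab r by simp
  define N' where "N' y = ennreal ?k * ((G y - ennreal a) * indicator (cball 0 r) y)" for y
  have [measurable]: "N' \<in> borel_measurable borel" unfolding N'_def by measurable
  have N'_le: "N' y \<le> N y / ennreal (norm y powr q)" for y
  proof (cases "y \<in> cball 0 r \<and> G y - ennreal a \<noteq> 0")
    case False
    then show ?thesis by (auto simp: N'_def)
  next
    case True
    then have y: "norm y \<le> r" by simp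
    have "G y - ennreal a \<le> ennreal b * N y"
      using le[of y] by (simp add: ennreal_minus_le_iff)
    then have "N' y \<le> ennreal ?k * (ennreal b * N y)"
      unfolding N'_def using True by (auto intro!: mult_left_mono)
    also have "\<dots> = ennreal (1 / r powr q) * N y"
      using ab r by (simp add: ennreal_mult[symmetric] mult.assoc[symmetric])
    also have "\<dots> \<le> N y / ennreal (norm y powr q)"
    \<comment> \<open>At the origin the divisor vanishes, so the quotient is infinite unless
      \<open>N y = 0\<close>.\<close>
    proof (cases "norm y = 0")
      case True
      then show ?thesis by (cases "N y = 0") simp_all
    next
      case False
      then have yp: "norm y powr q > 0" by simp
      have "1 / r powr q \<le> inverse (norm y powr q)"
        using y q yp r unfolding inverse_eq_divide by (intro divide_left_mono powr_mono2 mult_pos_pos) auto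
      then have "ennreal (1 / r powr q) \<le> inverse (ennreal (norm y powr q))"
        using yp by (simp add: inverse_ennreal ennreal_leI)
      then show ?thesis by (simp add: divide_ennreal_def mult.commute mult_left_mono)
    qed
    finally show ?thesis .
  qed
  have "(\<integral>\<^sup>+y. G y * indicator (cball 0 r) y \<partial>lborel)
    \<le> (\<integral>\<^sup>+y. ennreal a * indicator (cball 0 r) y + ennreal (b * r powr q) * N' y \<partial>lborel)"
  proof (rule nn_integral_mono)
    fix y :: 'a
    have "G y \<le> ennreal a + (G y - ennreal a)"
      by (metis ennreal_minus_le_iff order_refl)
    moreover have "ennreal (b * r powr q) * (ennreal ?k * t) = t" for t
      using ab r by (simp add: ennreal_mult[symmetric] mult.assoc[symmetric])
    ultimately show "G y * indicator (cball 0 r) y \<le> ennreal a * indicator (cball 0 r) y + ennreal (b * r powr q) * N' y"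
      unfolding N'_def by (auto split: split_indicator)
  qed
  also have "\<dots> = ennreal a * ennreal V + ennreal (b * r powr q) * (\<integral>\<^sup>+y. N' y \<partial>lborel)"
    by (simp add: nn_integral_add nn_integral_cmult nn_integral_cmult_indicator vol)
  also have "\<dots> \<le> ennreal a * ennreal V + ennreal (b * r powr q) * ennreal j"
    using order_trans[OF nn_integral_mono[OF N'_le] J] by (intro add_left_mono mult_left_mono) auto
  also have "\<dots> = ennreal (a * V + b * r powr q * j)"
    using ab V j by (simp add: ennreal_mult ennreal_plus)
  finally show ?thesis .
qed

text \<open>What remains of \<open>V * (V / H) powr (- 1 / p)\<close> for
  \<open>V = unit_ball_vol n * r powr n\<close> once the powers of \<open>r\<close> are split off,
  times the constant of the weak-type estimate.\<close>

definition ball_wt :: "real \<Rightarrow> real \<Rightarrow> real \<Rightarrow> real" where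
  "ball_wt p n H = weak_const p *
     (unit_ball_vol n powr (1 - 1 / p) * H powr (1 / p))"

lemma ball_wt_pos:
  assumes "p > 2" "H > 0" "n \<ge> 0"
  shows "ball_wt p n H > 0"
proof -
  have "2 powr (1 / 2 - 1 / p) > (1::real)" using assms by (simp add: field_simps)
  moreover have "unit_ball_vol n powr (1 - 1 / p) > 0"
    using less_imp_neq[OF unit_ball_vol_pos[OF assms(3)]] by simp
  ultimately show ?thesis
    unfolding ball_wt_def weak_const_def using assms(2) by (intro mult_pos_pos add_pos_pos divide_pos_pos) auto
qed

lemma emeasure_cball_phase:
  fixes a :: "(real^'d::finite) \<times> (real^'d)"
  assumes r: "r > 0"
  shows "emeasure lborel (cball a r) = ennreal (unit_ball_vol (2 * real CARD('d)) * r powr (2 * real CARD('d)))"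
proof -
  have D: "DIM((real^'d) \<times> (real^'d)) = 2 * CARD('d)" by simp
  have "r powr real (2 * CARD('d)) = r ^ (2 * CARD('d))" using r by (rule powr_realpow)
  then show ?thesis
    using emeasure_cball[OF less_imp_le[OF r], of a] unfolding D by (simp only: of_nat_mult of_nat_numeral)
qed

lemma weak_type_ball:
  fixes B :: "('i \<Rightarrow> 'd::finite fn) \<Rightarrow> 'd fn \<Rightarrow> complex"
  assumes p: "p > 2" and S: "S > 0" and hb: "hb > 0" and I: "finite I"
    and D: "dense_L2 D" and Dtau: "\<And>f z. f \<in> D \<Longrightarrow> tau_adj hb z f \<in> D"
    and Dscale: "\<And>f a. f \<in> D \<Longrightarrow> (\<lambda>x. complex_of_real a * f x) \<in> D"
    and tr: "trace_pow I D B p \<le> ennreal (S powr p)"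
    and c: "(\<Sum>k\<in>I. (c k)\<^sup>2) \<le> 1"
    and f: "f \<in> D" "l2norm f \<le> 1" and g: "g \<in> D" "l2norm g \<le> 1" and r: "r > 0"
  shows "(\<integral>\<^sup>+z. ennreal (cmod (B (\<lambda>k x. complex_of_real (c k) * tau_adj hb z g x) (tau_adj hb z f))) * indicator (cball a r) z \<partial>lborel)
    \<le> ennreal (ball_wt p (2 * real CARD('d)) (planck hb ^ CARD('d)) * r powr (2 * real CARD('d) * (1 - 1 / p)) * S)"
proof -
  define n where "n = 2 * real CARD('d)"
  define v where "v = unit_ball_vol n"
  define H where "H = planck hb ^ CARD('d)"
  have v: "v > 0" by (simp add: v_def n_def)
  have H: "H > 0" using hb by (simp add: H_def planck_def)
  have V: "emeasure lborel (cball a r) = ennreal (v * r powr n)" "v * r powr n > 0"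
    using emeasure_cball_phase[OF r, of a] r v by (simp_all add: v_def n_def)
  have eq: "weak_const p * (S * (v * r powr n) * (v * r powr n / H) powr (- 1 / p))
    = ball_wt p n H * r powr (n * (1 - 1 / p)) * S"
  proof -
    have "(v * r powr n / H) powr (- 1 / p) = v powr (- 1 / p) * r powr (- n / p) / H powr (- 1 / p)"
      using v r H by (simp add: powr_divide powr_mult powr_powr)
    also have "\<dots> = v powr (- 1 / p) * r powr (- n / p) * H powr (1 / p)"
      by (simp add: powr_minus field_simps)
    finally have "v * r powr n * (v * r powr n / H) powr (- 1 / p)
      = (v * v powr (- 1 / p)) * (r powr n * r powr (- n / p)) * H powr (1 / p)" by (simp only: mult_ac)
    also have "v * v powr (- 1 / p) = v powr (1 - 1 / p)"
      using v by (simp add: powr_diff powr_minus divide_inverse)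
    also have "r powr n * r powr (- n / p) = r powr (n * (1 - 1 / p))"
      by (simp add: right_diff_distrib flip: powr_add)
    finally have "v * r powr n * (v * r powr n / H) powr (- 1 / p) = v powr (1 - 1 / p) * r powr (n * (1 - 1 / p)) * H powr (1 / p)" .
    then show ?thesis by (simp only: ball_wt_def v_def[symmetric] mult_ac)
  qed
  note main = weak_type_estimate[OF p S hb I D Dtau Dscale tr c f g borel_closed[OF closed_cball] V, folded H_def, unfolded eq]
  show ?thesis using main unfolding H_def n_def .
qed

text \<open>The constant is fixed before \<open>hb\<close>, \<open>\<rho>\<close> and the dense set:
  it comes from the Campanato argument on phase space, of dimension \<open>2 * CARD('d)\<close>,
  whence the exponent \<open>4 * CARD('d) + \<theta>\<close>. The set \<open>D\<close> stays free
  because the fractional case tests on \<open>L2\<close> and the gradient case on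
  \<open>test_fn\<close>.\<close>

lemma holder_constant:
  assumes "0 < \<theta>"
  obtains C where "C > 0"
    "\<And>hb R (\<rho> :: 'd::finite fn \<Rightarrow> 'd fn) D K. bdd_op R \<rho> \<Longrightarrow> dense_L2 D \<Longrightarrow> K > 0 \<Longrightarrow>
      (\<And>f g a r. f \<in> D \<Longrightarrow> g \<in> D \<Longrightarrow> l2norm f \<le> 1 \<Longrightarrow> l2norm g \<le> 1 \<Longrightarrow> r > 0 \<Longrightarrow>
        mean_diff (orbit hb \<rho> g f) a r
          \<le> ennreal (K * r powr (4 * real CARD('d) + \<theta>))) \<Longrightarrow>
      W_inf hb \<theta> \<rho> \<le> ennreal (C * K)"
proof -
  obtain C where C: "C > 0"
    and camp: "\<And>(u :: (real^'d) \<times> (real^'d) \<Rightarrow> complex) M a b. continuous_on UNIV u \<Longrightarrow> M > 0 \<Longrightarrow>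
      (\<And>a r. r > 0 \<Longrightarrow>
        mean_diff u a r
          \<le> ennreal (M * r powr (2 * real DIM((real^'d) \<times> (real^'d)) + \<theta>))) \<Longrightarrow>
      cmod (u a - u b) \<le> C * M * norm (a - b) powr \<theta>"
    using campanato_holder[OF assms, where 'a = "(real^'d) \<times> (real^'d)"] by blast
  show thesis
  proof (rule that[OF C])
    fix hb R and \<rho> :: "'d fn \<Rightarrow> 'd fn" and D and K :: real
    assume \<rho>: "bdd_op R \<rho>" and D: "dense_L2 D" and K: "K > 0"
      and hyp: "\<And>f g a r. f \<in> D \<Longrightarrow> g \<in> D \<Longrightarrow> l2norm f \<le> 1 \<Longrightarrow> l2norm g \<le> 1 \<Longrightarrow> r > 0 \<Longrightarrow>
        mean_diff (orbit hb \<rho> g f) a r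
          \<le> ennreal (K * r powr (4 * real CARD('d) + \<theta>))"
    show "W_inf hb \<theta> \<rho> \<le> ennreal (C * K)"
    proof (rule W_inf_le[OF \<rho> D])
      fix f g :: "'d fn" and z assume fg: "f \<in> D" "g \<in> D" "l2norm f \<le> 1" "l2norm g \<le> 1"
      then have L: "f \<in> L2" "g \<in> L2" using D by (auto simp: dense_L2_def)
      have dim: "2 * real DIM((real^'d) \<times> (real^'d)) = 4 * real CARD('d)" by simp
      have "cmod (orbit hb \<rho> g f z - orbit hb \<rho> g f 0) \<le> C * K * norm (z - 0) powr \<theta>"
        by (rule camp[OF continuous_orbit[OF \<rho> L] K, unfolded dim, OF hyp[OF fg]])
      then show "cmod (orbit hb \<rho> g f z - orbit hb \<rho> g f 0) \<le> C * K * norm z powr \<theta>" by simp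
    qed (use C K in simp)
  qed
qed

lemma op_form_scaled:
  "op_form A (\<lambda>k x. complex_of_real 1 * g x) f = l2inner g (A f)"
  by (simp add: op_form_def)

text \<open>For each shift \<open>y\<close> the weak-type bound controls the averaged difference by
  the p-th root of the trace occurring in the seminorm; linearised at the level \<open>t\<close>, it
  can be integrated over \<open>y\<close> against the weight. The exponents add up since \<theta> is
  s - 2d/p, and the powers of \<open>H\<close> cancel between \<open>ball_wt\<close> and
  \<open>t\<close>.\<close>

lemma fractional_averaged_bound:
  fixes \<rho> :: "'d::finite fn \<Rightarrow> 'd fn" and s p hb w :: real
  assumes s: "0 < s" "s < 1" and p: "p > 2" and \<theta>: "\<theta> = s - 2 * real CARD('d) / p"
    and hb: "hb > 0" and op: "is_operator \<rho>" and w: "w > 0" and W: "W_sp hb s p \<rho> \<le> ennreal w"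
    and f: "f \<in> L2" "l2norm f \<le> 1" and g: "g \<in> L2" "l2norm g \<le> 1" and r: "r > 0"
    and om: "continuous_on UNIV (orbit hb \<rho> g f)"
  shows "mean_diff (orbit hb \<rho> g f) a r
    \<le> ennreal (ball_wt p (2 * real CARD('d)) 1 * (unit_ball_vol (2 * real CARD('d)) * 2 powr (2 * real CARD('d))
        + 2 powr (2 * real CARD('d) + s * p) / gamma_sp CARD('d) s p) * w * r powr (4 * real CARD('d) + \<theta>))"
proof -
  define n where "n = 2 * real CARD('d)"
  define v where "v = unit_ball_vol n"
  define H where "H = planck hb ^ CARD('d)"
  define \<gamma> where "\<gamma> = gamma_sp CARD('d) s p"
  have v: "v > 0" by (simp add: v_def n_def)
  have H: "H > 0" using hb by (simp add: H_def planck_def)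
  have n: "n > 0" by (simp add: n_def)
  have \<gamma>: "\<gamma> > 0" unfolding \<gamma>_def using s p by (intro gamma_sp_pos) auto
  define N where "N y = trace_pow (UNIV :: unit set) L2 (op_form (op_diff (Tz hb y \<rho>) \<rho>)) p" for y
  define J where "J = (\<integral>\<^sup>+ z. N z / ennreal (norm z powr (n + s * p)) \<partial>lborel)"
  have "ennpowr (ennreal \<gamma> * ennreal H * J) (1 / p) \<le> ennreal w"
    using W s by (simp add: W_sp_def J_def N_def n_def \<gamma>_def H_def)
  then have "ennreal \<gamma> * ennreal H * J \<le> ennreal (w powr p)"
    using p w by (intro ennpowr_le_imp) auto
  then have "ennreal (1 / (\<gamma> * H)) * (ennreal \<gamma> * ennreal H * J) \<le> ennreal (1 / (\<gamma> * H)) * ennreal (w powr p)"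
    by (rule mult_left_mono) simp
  moreover have "ennreal (1 / (\<gamma> * H)) * (ennreal \<gamma> * ennreal H * J) = J"
    using \<gamma> H by (simp add: mult.assoc[symmetric] ennreal_mult[symmetric])
  moreover have "ennreal (1 / (\<gamma> * H)) * ennreal (w powr p) = ennreal (w powr p / (\<gamma> * H))"
    using \<gamma> H by (simp add: ennreal_mult[symmetric])
  ultimately have J: "J \<le> ennreal (w powr p / (\<gamma> * H))" by (simp only:)
  define G where "G y = ball_diff (orbit hb \<rho> g f) a r y" for y
  have [measurable]: "orbit hb \<rho> g f \<in> borel_measurable borel" using om by (rule borel_measurable_continuous_onI)
  have [measurable]: "cball x \<rho> \<in> sets borel" for x :: "(real^'d) \<times> (real^'d)" and \<rho> by simp
  have Gm: "G \<in> borel_measurable borel" unfolding G_def by measurable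
  define \<kappa> where "\<kappa> = ball_wt p n H * r powr (n * (1 - 1 / p))"
  have \<kappa>: "\<kappa> > 0" unfolding \<kappa>_def using ball_wt_pos[OF p H] n r by simp
  have G_weak: "G y \<le> ennreal (\<kappa> * S)" if "S > 0" "N y \<le> ennreal (S powr p)" for y S
  proof -
    have "(\<integral>\<^sup>+z. ennreal (cmod (op_form (op_diff (Tz hb y \<rho>) \<rho>) (\<lambda>k x. complex_of_real 1 * tau_adj hb z g x) (tau_adj hb z f))) * indicator (cball a r) z \<partial>lborel)
      \<le> ennreal (\<kappa> * S)"
      unfolding \<kappa>_def n_def H_def
      by (rule weak_type_ball[OF p that(1) hb _ dense_L2_L2 _ _ that(2)[unfolded N_def] _ f g r, where c = "\<lambda>k. 1"]) auto
    then show ?thesis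
      unfolding G_def op_form_scaled orbit_diff_eq[OF op f(1) g(1)] .
  qed
  \<comment> \<open>The size expected of the p-th root of \<open>N y\<close> for shifts of length
    about \<open>r\<close>: \<open>w powr p / (H * t powr p)\<close> becomes
    \<open>r powr (- s * p)\<close>, so both terms of the integrated bound carry the same power of
    \<open>r\<close>.\<close>
  define t where "t = w * r powr s / H powr (1 / p)"
  have t: "t > 0" using w r H by (simp add: t_def)
  have G_le: "G y \<le> ennreal (\<kappa> * t) + ennreal (\<kappa> * t powr (1 - p)) * N y" for y
    using p by (intro young_type_bound \<kappa> t G_weak) auto
  have vol: "emeasure lborel (cball (0 :: (real^'d) \<times> (real^'d)) (2 * r)) = ennreal (v * (2 * r) powr n)"
    unfolding v_def n_def using r by (intro emeasure_cball_phase) simp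
  have "(\<integral>\<^sup>+y. G y * indicator (cball 0 (2 * r)) y \<partial>lborel)
    \<le> ennreal (\<kappa> * t * (v * (2 * r) powr n) + \<kappa> * t powr (1 - p) * (2 * r) powr (n + s * p) * (w powr p / (\<gamma> * H)))"
  proof (rule truncated_integral_bound[OF Gm G_le _ _ _ _ J[unfolded J_def] _ vol])
    show "0 < n + s * p" using n s p by (intro add_pos_pos) auto
  qed (use \<kappa> t r v \<gamma> H w in auto)
  also have "\<kappa> * t * (v * (2 * r) powr n) + \<kappa> * t powr (1 - p) * (2 * r) powr (n + s * p) * (w powr p / (\<gamma> * H))
    = ball_wt p n 1 * (v * 2 powr n + 2 powr (n + s * p) / \<gamma>) * w * r powr (2 * n + \<theta>)"
  proof -
    have \<kappa>t: "\<kappa> * t = ball_wt p n 1 * w * r powr (n + \<theta>)"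
    proof -
      have "r powr (n * (1 - 1 / p)) * r powr s = r powr (n + \<theta>)"
        by (simp add: \<theta> n_def right_diff_distrib algebra_simps flip: powr_add)
      moreover have "ball_wt p n H = ball_wt p n 1 * H powr (1 / p)" by (simp add: ball_wt_def)
      moreover have "\<kappa> * t = ball_wt p n H * w * (r powr (n * (1 - 1 / p)) * r powr s) / H powr (1 / p)"
        by (simp only: \<kappa>_def t_def times_divide_eq_right mult_ac)
      ultimately show ?thesis using H by simp
    qed
    have tp: "t powr (1 - p) = t * (H / (w powr p * r powr (s * p)))"
    proof -
      have "t powr p = w powr p * r powr (s * p) / H"
        using w r H p by (simp add: t_def powr_divide powr_mult powr_powr)
      then show ?thesis using t by (simp add: powr_diff)
    qed
    have r2: "(2 * r) powr n = 2 powr n * r powr n" "(2 * r) powr (n + s * p) = 2 powr (n + s * p) * (r powr n * r powr (s * p))"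
      using r by (simp_all add: powr_mult powr_add)
    have "t * (H / (w powr p * r powr (s * p))) * (2 powr (n + s * p) * (r powr n * r powr (s * p))) * (w powr p / (\<gamma> * H))
      = t * (2 powr (n + s * p) / \<gamma>) * r powr n"
      using w r H \<gamma> by (simp add: field_simps)
    then have "\<kappa> * t * (v * (2 * r) powr n) + \<kappa> * t powr (1 - p) * (2 * r) powr (n + s * p) * (w powr p / (\<gamma> * H))
      = \<kappa> * t * (v * 2 powr n + 2 powr (n + s * p) / \<gamma>) * r powr n"
      unfolding r2 tp by (simp only: distrib_left distrib_right mult.assoc)
    also have "\<dots> = ball_wt p n 1 * (v * 2 powr n + 2 powr (n + s * p) / \<gamma>) * w * (r powr (n + \<theta>) * r powr n)"
      unfolding \<kappa>t by (simp only: mult_ac)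
    also have "r powr (n + \<theta>) * r powr n = r powr (2 * n + \<theta>)" by (simp add: add_ac flip: powr_add)
    finally show ?thesis .
  qed
  also have "2 * n + \<theta> = 4 * real CARD('d) + \<theta>" by (simp add: n_def)
  finally show ?thesis by (simp only: G_def v_def n_def \<gamma>_def)
qed

lemma fractional_embedding:
  fixes \<theta> s p :: real
  assumes \<theta>: "0 < \<theta>" and s: "0 < s" "s < 1" and p: "p > 2" and eq: "\<theta> = s - 2 * real CARD('d::finite) / p"
  shows "\<exists>C::real. \<forall>hb>0. \<forall>\<rho> :: 'd fn \<Rightarrow> 'd fn. compact_op \<rho> \<longrightarrow> W_inf hb \<theta> \<rho> \<le> ennreal C * W_sp hb s p \<rho>"
proof -
  obtain C where C: "C > 0"
    and hold: "\<And>hb R (\<rho> :: 'd fn \<Rightarrow> 'd fn) D K. bdd_op R \<rho> \<Longrightarrow> dense_L2 D \<Longrightarrow> K > 0 \<Longrightarrow>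
      (\<And>f g a r. f \<in> D \<Longrightarrow> g \<in> D \<Longrightarrow> l2norm f \<le> 1 \<Longrightarrow> l2norm g \<le> 1 \<Longrightarrow> r > 0 \<Longrightarrow>
        mean_diff (orbit hb \<rho> g f) a r
          \<le> ennreal (K * r powr (4 * real CARD('d) + \<theta>))) \<Longrightarrow>
      W_inf hb \<theta> \<rho> \<le> ennreal (C * K)"
    using holder_constant[OF \<theta>, where 'd = 'd] by blast
  \<comment> \<open>All powers of \<open>H\<close> have cancelled, so this constant does not involve
    \<open>hb\<close>.\<close>
  define K where "K = ball_wt p (2 * real CARD('d)) 1 * (unit_ball_vol (2 * real CARD('d)) * 2 powr (2 * real CARD('d))
        + 2 powr (2 * real CARD('d) + s * p) / gamma_sp CARD('d) s p)"
  have K: "K > 0"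
    unfolding K_def using gamma_sp_pos[of s p "CARD('d)"] s p
    by (intro mult_pos_pos ball_wt_pos add_pos_pos divide_pos_pos) auto
  show ?thesis
  proof (intro exI[of _ "C * K"] allI impI)
    fix hb :: real and \<rho> :: "'d fn \<Rightarrow> 'd fn" assume hb: "0 < hb" and "compact_op \<rho>"
    then obtain R where \<rho>: "bdd_op R \<rho>" using compact_op_bounded by blast
    have op: "is_operator \<rho>" using \<rho> by (simp add: bdd_op_def)
    show "W_inf hb \<theta> \<rho> \<le> ennreal (C * K) * W_sp hb s p \<rho>"
    proof (rule ennreal_bound_from_real_bounds)
      fix w assume w: "w > 0" "W_sp hb s p \<rho> \<le> ennreal w"
      have "W_inf hb \<theta> \<rho> \<le> ennreal (C * (K * w))"
      proof (rule hold[OF \<rho> dense_L2_L2])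
        fix f g :: "'d fn" and a :: "(real^'d) \<times> (real^'d)" and r :: real
        assume fg: "f \<in> L2" "g \<in> L2" "l2norm f \<le> 1" "l2norm g \<le> 1" and r: "r > 0"
        show "mean_diff (orbit hb \<rho> g f) a r
          \<le> ennreal (K * w * r powr (4 * real CARD('d) + \<theta>))"
          unfolding K_def
          by (rule fractional_averaged_bound[OF s p eq hb op w fg(1,3,2,4) r continuous_orbit[OF \<rho> fg(1,2)]])
      qed (use K w in simp)
      then show "W_inf hb \<theta> \<rho> \<le> ennreal (C * K * w)" by (simp only: mult.assoc)
    qed (use C K in simp)
  qed
qed

subsection \<open>The gradient case\<close>

lemma test_fn_partial_continuous: "f \<in> test_fn \<Longrightarrow> continuous_on UNIV (partial j f)"
  by (simp add: test_fn_def)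

lemma test_fn_partial_support:
  fixes f :: "'d::finite fn"
  assumes "\<And>x. norm x > R \<Longrightarrow> f x = 0" "norm x > R"
  shows "partial j f x = 0"
proof -
  have "((\<lambda>x. 0) has_derivative (\<lambda>h. 0)) (at x)" by simp
  then have "(f has_derivative (\<lambda>h. 0)) (at x)"
  proof (rule has_derivative_transform_within_open)
    show "open {x::real^'d. norm x > R}" by (intro open_Collect_less continuous_intros)
  qed (use assms in auto)
  from frechet_derivative_at[OF this] show ?thesis by (metis partial_def)
qed

lemma partial_scale:
  assumes "f \<in> test_fn" shows "partial j (\<lambda>x. c * f x) = (\<lambda>x. c * partial j f x)"
proof
  fix x
  have "f differentiable (at x)" using assms by (auto simp: test_fn_def differentiable_on_def)
  then have D: "(f has_derivative frechet_derivative f (at x)) (at x)" by (simp add: frechet_derivative_works)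
  from frechet_derivative_at[OF has_derivative_mult_right[OF D, of c]]
  show "partial j (\<lambda>x. c * f x) x = c * partial j f x" by (metis partial_def)
qed

lemma test_fn_partial_L2[simp, intro]:
  assumes "f \<in> test_fn" shows "partial j f \<in> L2"
proof -
  obtain R where "\<And>x. norm x > R \<Longrightarrow> f x = 0" using test_fn_support[OF assms] by blast
  then show ?thesis
    by (intro continuous_compact_support_L2[OF test_fn_partial_continuous[OF assms]] test_fn_partial_support)
qed

lemma test_fn_coord_L2[simp, intro]:
  assumes "f \<in> test_fn" shows "(\<lambda>x. complex_of_real (x $ j) * f x) \<in> L2"
proof -
  obtain R where R: "\<And>x. norm x > R \<Longrightarrow> f x = 0" using test_fn_support[OF assms] by blast
  have "continuous_on UNIV f" by (intro C1_continuous test_fn_C1 assms)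
  then show ?thesis
    by (intro continuous_compact_support_L2[where R = R] continuous_intros) (simp_all add: R)
qed

text \<open>The partial derivatives are continuous with bounded support, hence bounded, and the mean
  value inequality applies. The constant will dominate difference quotients of translations.\<close>

lemma test_fn_lipschitz:
  fixes f :: "'d::finite fn"
  assumes f: "f \<in> test_fn"
  obtains L where "L > 0" "\<And>x y. cmod (f x - f y) \<le> L * norm (x - y)"
proof -
  obtain R where R: "\<And>x. norm x > R \<Longrightarrow> f x = 0" using test_fn_support[OF f] by blast
  have "\<exists>B>0. \<forall>x. cmod (partial j f x) \<le> B" for j
  proof -
    have s: "partial j f x = 0" if "norm x > R" for x
      by (rule test_fn_partial_support[OF R that])
    obtain B where "B > 0" "\<And>x. norm (partial j f x) \<le> B"
      using continuous_compact_support_bounded[OF test_fn_partial_continuous[OF f, of j] s] by blast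
    then show ?thesis by blast
  qed
  then have "\<forall>j. \<exists>B. B > 0 \<and> (\<forall>x. cmod (partial j f x) \<le> B)" by blast
  from choice[OF this] obtain B where B: "\<forall>j. B j > 0 \<and> (\<forall>x. cmod (partial j f x) \<le> B j)"
    by (rule exE)
  define L where "L = (\<Sum>j\<in>UNIV. B j) + 1"
  have L: "L > 0" unfolding L_def using B by (intro add_nonneg_pos sum_nonneg) (auto intro: less_imp_le)
  show thesis
  proof (rule that[OF L])
    fix x y
    show "cmod (f x - f y) \<le> L * norm (x - y)"
    proof (rule differentiable_bound[of UNIV])
      fix z :: "real^'d"
      show "(f has_derivative (\<lambda>h. \<Sum>j\<in>UNIV. complex_of_real (h $ j) * partial j f z)) (at z within UNIV)"
        using test_fn_derivative[OF f] by simp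
      show "onorm (\<lambda>h. \<Sum>j\<in>UNIV. complex_of_real (h $ j) * partial j f z) \<le> L"
      proof (rule onorm_le)
        fix h :: "real^'d"
        have "cmod (\<Sum>j\<in>UNIV. complex_of_real (h $ j) * partial j f z) \<le> (\<Sum>j\<in>UNIV. norm h * B j)"
        proof (rule sum_norm_le)
          fix j
          show "cmod (complex_of_real (h $ j) * partial j f z) \<le> norm h * B j"
            unfolding norm_mult norm_of_real
            using B component_le_norm_cart[of h j] by (intro mult_mono) auto
        qed
        also have "\<dots> \<le> L * norm h"
          unfolding L_def sum_distrib_left[symmetric] by (subst mult.commute) (intro mult_right_mono; simp)
        finally show "cmod (\<Sum>j\<in>UNIV. complex_of_real (h $ j) * partial j f z) \<le> L * norm h" .
      qed
    qed auto
  qed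
qed

text \<open>The generator of \<open>t \<mapsto> tau_adj hb (t e)\<close> for the direction \<open>e\<close> with coordinates \<open>c\<close>.\<close>

definition dir :: "('d::finite \<times> bool \<Rightarrow> real) \<Rightarrow> (real^'d) \<times> (real^'d)" where
  "dir c = (\<chi> j. c (j, False), \<chi> j. c (j, True))"

definition gen :: "real \<Rightarrow> ('d::finite \<times> bool \<Rightarrow> real) \<Rightarrow> 'd fn \<Rightarrow> 'd fn" where
  "gen hb c f x = (\<Sum>j\<in>UNIV. complex_of_real (c (j, False)) * partial j f x)
     + (\<Sum>j\<in>UNIV. (- \<i> * complex_of_real (c (j, True) / hb)) * (complex_of_real (x $ j) * f x))"

lemma gen_L2: assumes "f \<in> test_fn" shows "gen hb c f \<in> L2"
  unfolding gen_def using assms by (intro L2_add L2_sum L2_scale) auto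

lemma cmod_cis_minus_1: "cmod (cis a - 1) \<le> \<bar>a\<bar>"
  using iexp_approx1[of a 0] by (simp add: cis_conv_exp)

text \<open>Along a line through the origin the phase of \<open>tau_adj\<close> is linear plus
  quadratic in \<open>t\<close>; the quadratic part stems from the shift to the midpoint and drops
  out at first order.\<close>

lemma phase_derivative:
  fixes \<beta> \<gamma> k :: real
  shows "((\<lambda>t. - (t * \<beta> + t\<^sup>2 * \<gamma> / 2) / k) has_derivative (\<lambda>h. - h * \<beta> / k)) (at 0)"
proof -
  have "((\<lambda>t. - (t * \<beta> + t\<^sup>2 * \<gamma> / 2)) has_field_derivative - \<beta>) (at 0)"
    by (auto intro!: derivative_eq_intros)
  from DERIV_cdivide[OF this, of k] show ?thesis
    by (rule has_derivative_eq_rhs[OF has_field_derivative_imp_has_derivative]) (simp add: fun_eq_iff mult.commute)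
qed

text \<open>Along the line the shifted function is a phase times a translate, so the product and
  chain rules at 0 give \<open>gen\<close>; the limit is then specialised to the sequence
  \<open>T\<close>.\<close>

lemma tau_adj_derivative_pointwise:
  fixes f :: "'d::finite fn"
  assumes f: "f \<in> test_fn" and t: "T \<longlonglongrightarrow> 0" "\<And>n. T n \<noteq> (0::real)"
  shows "(\<lambda>n. complex_of_real (1 / T n) * (tau_adj hb (T n *\<^sub>R dir c) f x - f x)) \<longlonglongrightarrow> gen hb c f x"
proof -
  let ?a = "fst (dir c)" and ?b = "snd (dir c)"
  let ?ph = "\<lambda>t. - (t * (?b \<bullet> x) + t\<^sup>2 * (?b \<bullet> ?a) / 2) / hb"
  let ?\<phi> = "\<lambda>t. cis (?ph t) * f (x + t *\<^sub>R ?a)"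
  have tau: "tau_adj hb (t *\<^sub>R dir c) f x = ?\<phi> t" for t
    by (simp add: tau_adj_def inner_add_right power2_eq_square algebra_simps)
  have d1: "((\<lambda>t. cis (?ph t)) has_derivative (\<lambda>h. (- h * (?b \<bullet> x) / hb) *\<^sub>R (\<i> * cis (?ph 0)))) (at 0)"
    by (rule has_derivative_cis[OF phase_derivative])
  have "((\<lambda>t. x + t *\<^sub>R ?a) has_derivative (\<lambda>h. h *\<^sub>R ?a)) (at 0)"
    by (auto intro!: derivative_eq_intros)
  from has_derivative_compose[OF this, of f "\<lambda>h. \<Sum>j\<in>UNIV. complex_of_real (h $ j) * partial j f x"]
  have d2: "((\<lambda>t. f (x + t *\<^sub>R ?a)) has_derivative (\<lambda>h. \<Sum>j\<in>UNIV. complex_of_real ((h *\<^sub>R ?a) $ j) * partial j f x)) (at 0)"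
    using test_fn_derivative[OF f, of x] by simp
  have "(?\<phi> has_derivative (\<lambda>h. cis (?ph 0) * (\<Sum>j\<in>UNIV. complex_of_real ((h *\<^sub>R ?a) $ j) * partial j f x)
     + (- h * (?b \<bullet> x) / hb) *\<^sub>R (\<i> * cis (?ph 0)) * f (x + 0 *\<^sub>R ?a))) (at 0)"
    by (rule has_derivative_mult[OF d1 d2])
  moreover have "(\<lambda>h. cis (?ph 0) * (\<Sum>j\<in>UNIV. complex_of_real ((h *\<^sub>R ?a) $ j) * partial j f x)
     + (- h * (?b \<bullet> x) / hb) *\<^sub>R (\<i> * cis (?ph 0)) * f (x + 0 *\<^sub>R ?a)) = (\<lambda>h. h *\<^sub>R gen hb c f x)"
  proof
    fix h :: real
    have 1: "(\<Sum>j\<in>UNIV. complex_of_real ((h *\<^sub>R ?a) $ j) * partial j f x) = h *\<^sub>R (\<Sum>j\<in>UNIV. complex_of_real (c (j, False)) * partial j f x)"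
      unfolding vector_scaleR_component by (simp add: dir_def sum_distrib_left scaleR_conv_of_real mult.assoc)
    have "complex_of_real (?b \<bullet> x) = (\<Sum>j\<in>UNIV. complex_of_real (c (j, True)) * complex_of_real (x $ j))"
      by (simp add: dir_def inner_vec_def)
    then have 2: "(\<Sum>j\<in>UNIV. (- \<i> * complex_of_real (c (j, True) / hb)) * (complex_of_real (x $ j) * f x))
      = - \<i> * complex_of_real (?b \<bullet> x) / complex_of_real hb * f x"
      by (simp add: sum_distrib_left sum_distrib_right sum_divide_distrib sum_negf mult_ac)
    show "cis (?ph 0) * (\<Sum>j\<in>UNIV. complex_of_real ((h *\<^sub>R ?a) $ j) * partial j f x)
     + (- h * (?b \<bullet> x) / hb) *\<^sub>R (\<i> * cis (?ph 0)) * f (x + 0 *\<^sub>R ?a) = h *\<^sub>R gen hb c f x"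
      unfolding 1 gen_def 2 by (simp add: scaleR_conv_of_real algebra_simps)
  qed
  ultimately have D: "(?\<phi> has_derivative (\<lambda>h. h *\<^sub>R gen hb c f x)) (at 0)" by (simp only:)
  have Tat: "filterlim T (at 0) sequentially"
    using t by (intro filterlim_atI) auto
  have "((\<lambda>h. norm (?\<phi> (0 + h) - ?\<phi> 0 - h *\<^sub>R gen hb c f x) / norm h) \<longlongrightarrow> 0) (at 0)"
    using D unfolding has_derivative_at by (rule conjunct2)
  from filterlim_compose[OF this Tat]
  have lim: "(\<lambda>n. norm (?\<phi> (0 + T n) - ?\<phi> 0 - T n *\<^sub>R gen hb c f x) / norm (T n)) \<longlonglongrightarrow> 0" .
  have "norm (?\<phi> (0 + T n) - ?\<phi> 0 - T n *\<^sub>R gen hb c f x) / norm (T n)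
    = norm (complex_of_real (1 / T n) * (tau_adj hb (T n *\<^sub>R dir c) f x - f x) - gen hb c f x)" for n
  proof -
    have eq: "?\<phi> (0 + T n) = tau_adj hb (T n *\<^sub>R dir c) f x" "?\<phi> 0 = f x"
      using tau[of "T n"] by simp_all
    have "complex_of_real (1 / T n) * (A - B) - G = (1 / T n) *\<^sub>R (A - B - T n *\<^sub>R G)" for A B G :: complex
      using t(2)[of n] by (simp add: scaleR_conv_of_real right_diff_distrib flip: of_real_mult mult.assoc)
    then show ?thesis unfolding eq by simp
  qed
  with lim have "(\<lambda>n. norm (complex_of_real (1 / T n) * (tau_adj hb (T n *\<^sub>R dir c) f x - f x) - gen hb c f x)) \<longlonglongrightarrow> 0"
    by (simp only:)
  then have "(\<lambda>n. complex_of_real (1 / T n) * (tau_adj hb (T n *\<^sub>R dir c) f x - f x) - gen hb c f x) \<longlonglongrightarrow> 0"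
    by (rule tendsto_norm_zero_cancel)
  then show ?thesis by (rule LIM_zero_cancel)
qed

text \<open>Pointwise convergence is upgraded by dominated convergence: the difference quotients
  have one bound \<open>Q\<close> and vanish outside one ball of radius \<open>S\<close>, and the
  limit inherits both.\<close>

lemma tau_adj_derivative_L2:
  fixes f :: "'d::finite fn"
  assumes f: "f \<in> test_fn" and hb: "hb > 0" and t: "T \<longlonglongrightarrow> 0" "\<And>n. T n \<noteq> (0::real)"
  shows "(\<lambda>n. l2norm (\<lambda>x. complex_of_real (1 / T n) * (tau_adj hb (T n *\<^sub>R dir c) f x - f x) - gen hb c f x)) \<longlonglongrightarrow> 0"
proof -
  define a where "a = fst (dir c)"
  define b where "b = snd (dir c)"
  obtain R where R: "R > 0" "\<And>x. norm x > R \<Longrightarrow> f x = 0" using test_fn_support[OF f] by blast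
  obtain B where B: "B > 0" "\<And>x. norm (f x) \<le> B"
    using continuous_compact_support_bounded[OF C1_continuous[OF test_fn_C1[OF f]] R(2)] by blast
  obtain L where L: "L > 0" "\<And>x y. cmod (f x - f y) \<le> L * norm (x - y)"
    using test_fn_lipschitz[OF f] by blast
  obtain K where K: "K > 0" "\<And>n. norm (T n) \<le> K"
    using convergent_imp_Bseq[OF convergentI[OF t(1)]] by (auto simp: Bseq_def)
  \<comment> \<open>The first summand bounds the quotient of the phase factor, as
    \<open>cis a\<close> differs from 1 by at most the modulus of \<open>a\<close>; the second
    bounds that of the translation. \<open>R + 2 * K * norm a\<close> covers the midpoints for
    \<open>x\<close> in the ball of radius \<open>S\<close>.\<close>
  define Q where "Q = norm b * (R + 2 * K * norm a) / hb * B + L * norm a"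
  define S where "S = R + K * norm a"
  have Q: "Q \<ge> 0" unfolding Q_def using R K hb B L by auto
  define F where "F n x = complex_of_real (1 / T n) * (tau_adj hb (T n *\<^sub>R dir c) f x - f x)" for n x
  have Ka: "norm (T n *\<^sub>R a) \<le> K * norm a" for n
    using K by (simp add: mult_right_mono)
  have far: "f (x + T n *\<^sub>R a) = 0" if "norm x > S" for x n
  proof -
    have "norm x - norm (T n *\<^sub>R a) \<le> norm (x + T n *\<^sub>R a)"
      using norm_triangle_ineq4[of "x + T n *\<^sub>R a" "T n *\<^sub>R a"] by simp
    then show ?thesis using Ka[of n] that by (intro R) (simp add: S_def)
  qed
  have F0: "F n x = 0" if "norm x > S" for n x
  proof -
    have "0 \<le> K * norm a" using K by simp
    then have "f x = 0" using that by (intro R) (simp add: S_def)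
    then show ?thesis using far[OF that, of n] by (simp add: F_def tau_adj_def a_def)
  qed
  have FQ: "cmod (F n x) \<le> Q" for n x
  proof -
    let ?th = "- (b \<bullet> (x + (T n / 2) *\<^sub>R a)) * T n / hb"
    have tau: "tau_adj hb (T n *\<^sub>R dir c) f x - f x = (cis ?th - 1) * f (x + T n *\<^sub>R a) + (f (x + T n *\<^sub>R a) - f x)"
      by (simp add: tau_adj_def a_def b_def algebra_simps)
    have 1: "cmod ((cis ?th - 1) * f (x + T n *\<^sub>R a)) \<le> \<bar>T n\<bar> * (norm b * (R + 2 * K * norm a) / hb * B)"
    proof (cases "norm x > S")
      case True
      then show ?thesis using far[OF True, of n] R K hb B by simp
    next
      case False
      have "\<bar>T n / 2\<bar> \<le> K" using K(1) K(2)[of n] by simp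
      then have "norm ((T n / 2) *\<^sub>R a) \<le> K * norm a"
        unfolding norm_scaleR by (rule mult_right_mono) simp
      then have "norm (x + (T n / 2) *\<^sub>R a) \<le> R + 2 * K * norm a"
        using norm_triangle_ineq[of x "(T n / 2) *\<^sub>R a"] False unfolding S_def by linarith
      then have "\<bar>b \<bullet> (x + (T n / 2) *\<^sub>R a)\<bar> \<le> norm b * (R + 2 * K * norm a)"
        using Cauchy_Schwarz_ineq2[of b "x + (T n / 2) *\<^sub>R a"] by (meson mult_left_mono norm_ge_zero order_trans)
      then have "\<bar>?th\<bar> \<le> norm b * (R + 2 * K * norm a) * \<bar>T n\<bar> / hb"
        using hb by (simp add: abs_mult divide_right_mono mult_right_mono)
      then have "cmod (cis ?th - 1) \<le> norm b * (R + 2 * K * norm a) * \<bar>T n\<bar> / hb"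
        using cmod_cis_minus_1[of ?th] by linarith
      then have "cmod ((cis ?th - 1) * f (x + T n *\<^sub>R a)) \<le> norm b * (R + 2 * K * norm a) * \<bar>T n\<bar> / hb * B"
        unfolding norm_mult using B R K hb by (intro mult_mono) auto
      then show ?thesis by (simp add: mult_ac)
    qed
    have 2: "cmod (f (x + T n *\<^sub>R a) - f x) \<le> \<bar>T n\<bar> * (L * norm a)"
      using L(2)[of "x + T n *\<^sub>R a" x] by (simp add: mult_ac)
    have "cmod (tau_adj hb (T n *\<^sub>R dir c) f x - f x) \<le> \<bar>T n\<bar> * Q"
      unfolding tau Q_def distrib_left[of "\<bar>T n\<bar>"] by (rule order_trans[OF norm_triangle_ineq add_mono[OF 1 2]])
    then show ?thesis
      unfolding F_def norm_mult norm_of_real using t(2)[of n] by (simp add: abs_divide field_simps)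
  qed
  have lim: "(\<lambda>n. F n x) \<longlonglongrightarrow> gen hb c f x" for x
    unfolding F_def by (rule tau_adj_derivative_pointwise[OF f t])
  have gQ: "cmod (gen hb c f x) \<le> Q" for x
    by (rule Lim_bounded[OF tendsto_norm[OF lim]]) (use FQ in auto)
  have g0: "gen hb c f x = 0" if "norm x > S" for x
    using lim[of x] F0[OF that] by (simp add: LIMSEQ_const_iff)
  have FL: "F n \<in> L2" for n
    unfolding F_def using test_fn_L2[OF f] by (intro L2_scale L2_diff tau_adj_L2)
  have "(\<lambda>n. l2norm (\<lambda>x. F n x - gen hb c f x)) \<longlonglongrightarrow> 0"
  proof (rule l2norm_dominated_convergence[where G = "\<lambda>x. (2 * Q)\<^sup>2 * indicator (cball 0 S) x"])
    show "(cmod (F n x - gen hb c f x))\<^sup>2 \<le> (2 * Q)\<^sup>2 * indicator (cball 0 S) x" for n x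
    proof (cases "norm x \<le> S")
      case True
      have "cmod (F n x - gen hb c f x) \<le> 2 * Q"
        using norm_triangle_ineq4[of "F n x" "gen hb c f x"] FQ[of n x] gQ[of x] by linarith
      then have "(cmod (F n x - gen hb c f x))\<^sup>2 \<le> (2 * Q)\<^sup>2" by (intro power_mono) auto
      then show ?thesis using True by simp
    next
      case False
      then show ?thesis using F0[of x n] g0[of x] by simp
    qed
  qed (use FL gen_L2[OF f] lim in auto)
  then show ?thesis by (simp only: F_def)
qed

text \<open>The derivative of the orbit at the origin in the direction \<open>dir c\<close>, in weak
  form: both generators act on test functions, so that \<open>\<rho> f\<close> has only to be square
  integrable.\<close>

definition orbit_deriv :: "real \<Rightarrow> ('d::finite fn \<Rightarrow> 'd fn) \<Rightarrow> ('d \<times> bool \<Rightarrow> real) \<Rightarrow> 'd fn \<Rightarrow> 'd fn \<Rightarrow> complex" where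
  "orbit_deriv hb \<rho> c g f = l2inner (gen hb c g) (\<rho> f) + l2inner g (\<rho> (gen hb c f))"

lemma orbit_difference_quotient:
  fixes f g :: "'d::finite fn"
  assumes \<rho>: "bdd_op R \<rho>" and f: "f \<in> test_fn" and g: "g \<in> test_fn" and hb: "hb > 0"
    and t: "T \<longlonglongrightarrow> 0" "\<And>n. T n \<noteq> (0::real)"
  shows "(\<lambda>n. complex_of_real (1 / T n) * (orbit hb \<rho> g f (T n *\<^sub>R dir c) - orbit hb \<rho> g f 0)) \<longlonglongrightarrow> orbit_deriv hb \<rho> c g f"
proof -
  have op: "is_operator \<rho>" using \<rho> by (simp add: bdd_op_def)
  have fL: "f \<in> L2" and gL: "g \<in> L2" using f g test_fn_L2 by auto
  define q where "q h n x = complex_of_real (1 / T n) * (tau_adj hb (T n *\<^sub>R dir c) h x - h x)" for h :: "'d fn" and n x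
  have qL: "q h n \<in> L2" if "h \<in> L2" for h n
    unfolding q_def using that by (intro L2_scale L2_diff tau_adj_L2)
  have qf: "(\<lambda>n. l2norm (\<lambda>x. q h n x - gen hb c h x)) \<longlonglongrightarrow> 0" if "h \<in> test_fn" for h
    unfolding q_def by (rule tau_adj_derivative_L2[OF that hb t])
  have c0: "(\<lambda>n. l2norm (\<lambda>x. h x - h x)) \<longlonglongrightarrow> 0" for h :: "'d fn" by simp
  have Tz: "(\<lambda>n. T n *\<^sub>R dir c) \<longlonglongrightarrow> 0"
    using tendsto_scaleR[OF t(1) tendsto_const[of "dir c"]] by simp
  have "(\<lambda>n. l2norm (\<lambda>x. tau_adj hb (T n *\<^sub>R dir c) f x - f x)) \<longlonglongrightarrow> 0"
    using tau_adj_tendsto[OF fL Tz, of hb] by simp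
  then have rf: "(\<lambda>n. l2norm (\<lambda>x. \<rho> (tau_adj hb (T n *\<^sub>R dir c) f) x - \<rho> f x)) \<longlonglongrightarrow> 0"
    by (intro bdd_op_tendsto[OF \<rho>]) (use fL in auto)
  have rq: "(\<lambda>n. l2norm (\<lambda>x. \<rho> (q f n) x - \<rho> (gen hb c f) x)) \<longlonglongrightarrow> 0"
    by (rule bdd_op_tendsto[OF \<rho> qL[OF fL] gen_L2[OF f] qf[OF f]])
  have l1: "(\<lambda>n. l2inner (q g n) (\<rho> (tau_adj hb (T n *\<^sub>R dir c) f))) \<longlonglongrightarrow> l2inner (gen hb c g) (\<rho> f)"
    by (rule l2inner_tendsto[OF _ qL[OF gL] _ gen_L2[OF g] rf qf[OF g]])
       (use fL is_operator_L2[OF op] in auto)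
  have l2: "(\<lambda>n. l2inner g (\<rho> (q f n))) \<longlonglongrightarrow> l2inner g (\<rho> (gen hb c f))"
    by (rule l2inner_tendsto[OF is_operator_L2[OF op qL[OF fL]] gL is_operator_L2[OF op gen_L2[OF f]] gL rq c0])
  \<comment> \<open>One vector is changed at a time: first the difference quotient falls on
    \<open>g\<close> with the shifted \<open>f\<close> kept, then on \<open>f\<close> inside
    \<open>\<rho>\<close>, whose boundedness carries the \<open>L2\<close> limits through.\<close>
  have eq: "complex_of_real (1 / T n) * (orbit hb \<rho> g f (T n *\<^sub>R dir c) - orbit hb \<rho> g f 0)
    = l2inner (q g n) (\<rho> (tau_adj hb (T n *\<^sub>R dir c) f)) + l2inner g (\<rho> (q f n))" for n
  proof -
    let ?f = "tau_adj hb (T n *\<^sub>R dir c) f" and ?g = "tau_adj hb (T n *\<^sub>R dir c) g"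
    have L: "?f \<in> L2" "?g \<in> L2" "\<rho> ?f \<in> L2" "\<rho> f \<in> L2" using fL gL is_operator_L2[OF op] by auto
    have "l2inner (q g n) (\<rho> ?f) = complex_of_real (1 / T n) * (l2inner ?g (\<rho> ?f) - l2inner g (\<rho> ?f))"
      unfolding q_def l2inner_scale_left complex_cnj_complex_of_real l2inner_diff_left[OF L(3,2) gL] ..
    moreover have "l2inner g (\<rho> (q f n)) = complex_of_real (1 / T n) * (l2inner g (\<rho> ?f) - l2inner g (\<rho> f))"
    proof -
      have "l2inner g (\<rho> (q f n)) = complex_of_real (1 / T n) * l2inner g (\<rho> (\<lambda>x. ?f x - f x))"
        unfolding q_def by (rule l2inner_op_scale[OF op L2_diff[OF L(1) fL] gL])
      also have "l2inner g (\<rho> (\<lambda>x. ?f x - f x)) = l2inner g (\<lambda>x. \<rho> ?f x - \<rho> f x)"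
        by (rule l2inner_cong_AE[OF is_operator_L2[OF op L2_diff[OF L(1) fL]] L2_diff[OF L(3,4)] gL gL
              is_operator_diff[OF op L(1) fL]]) simp
      finally show ?thesis by (simp only: l2inner_diff_right[OF gL L(3,4)])
    qed
    ultimately show ?thesis
      by (simp add: orbit_def right_diff_distrib)
  qed
  show ?thesis unfolding orbit_deriv_def eq by (rule tendsto_add[OF l1 l2])
qed

text \<open>Covariance of the orbit transports the derivative at 0 to every time: the vectors are
  replaced by their shifts, which are again test functions.\<close>

lemma orbit_has_derivative:
  fixes f g :: "'d::finite fn"
  assumes \<rho>: "bdd_op R \<rho>" and f: "f \<in> test_fn" and g: "g \<in> test_fn" and hb: "hb > 0"
  shows "((\<lambda>t. orbit hb \<rho> g f (z + t *\<^sub>R dir c)) has_vector_derivative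
    orbit_deriv hb \<rho> c (tau_adj hb (z + t *\<^sub>R dir c) g) (tau_adj hb (z + t *\<^sub>R dir c) f)) (at t)"
proof -
  have op: "is_operator \<rho>" using \<rho> by (simp add: bdd_op_def)
  have fL: "f \<in> L2" and gL: "g \<in> L2" using f g test_fn_L2 by auto
  let ?z = "z + t *\<^sub>R dir c"
  let ?f = "tau_adj hb ?z f" and ?g = "tau_adj hb ?z g"
  have shift: "orbit hb \<rho> g f (z + (t + h) *\<^sub>R dir c) = orbit hb \<rho> ?g ?f (h *\<^sub>R dir c)" for h
    using orbit_add[OF op fL gL, of hb ?z "h *\<^sub>R dir c"] by (simp add: scaleR_add_left add.assoc)
  have shift0: "orbit hb \<rho> g f ?z = orbit hb \<rho> ?g ?f 0"
    using shift[of 0] by simp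
  have "((\<lambda>h. (1 / h) *\<^sub>R (orbit hb \<rho> ?g ?f (h *\<^sub>R dir c) - orbit hb \<rho> ?g ?f 0)) \<longlongrightarrow> orbit_deriv hb \<rho> c ?g ?f) (at 0)"
    unfolding tendsto_at_iff_sequentially o_def scaleR_conv_of_real
    using orbit_difference_quotient[OF \<rho> tau_adj_test_fn[OF f] tau_adj_test_fn[OF g] hb] by simp
  then have *: "((\<lambda>h. (1 / h) *\<^sub>R (orbit hb \<rho> g f (z + (t + h) *\<^sub>R dir c) - orbit hb \<rho> g f ?z)) \<longlongrightarrow> orbit_deriv hb \<rho> c ?g ?f) (at 0)"
    unfolding shift shift0 .
  show ?thesis
    unfolding has_vector_derivative_def has_derivative_at
  proof (intro conjI bounded_linear_scaleR_left)
    have "((\<lambda>h. norm ((1 / h) *\<^sub>R (orbit hb \<rho> g f (z + (t + h) *\<^sub>R dir c) - orbit hb \<rho> g f ?z) - orbit_deriv hb \<rho> c ?g ?f)) \<longlongrightarrow> 0) (at 0)"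
      by (rule tendsto_norm_zero[OF LIM_zero[OF *]])
    then show "((\<lambda>h. norm (orbit hb \<rho> g f (z + (t + h) *\<^sub>R dir c) - orbit hb \<rho> g f ?z - h *\<^sub>R orbit_deriv hb \<rho> c ?g ?f) / norm h) \<longlongrightarrow> 0) (at 0)"
    proof (rule Lim_transform_eventually)
      have "norm ((1 / h) *\<^sub>R A - G) = norm (A - h *\<^sub>R G) / norm h" if "h \<noteq> 0" for h :: real and A G :: complex
      proof -
        have "(1 / h) *\<^sub>R A - G = (1 / h) *\<^sub>R (A - h *\<^sub>R G)" using that by (simp add: scaleR_diff_right)
        then show ?thesis by simp
      qed
      then show "\<forall>\<^sub>F h in at 0. norm ((1 / h) *\<^sub>R (orbit hb \<rho> g f (z + (t + h) *\<^sub>R dir c) - orbit hb \<rho> g f ?z) - orbit_deriv hb \<rho> c ?g ?f)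
        = norm (orbit hb \<rho> g f (z + (t + h) *\<^sub>R dir c) - orbit hb \<rho> g f ?z - h *\<^sub>R orbit_deriv hb \<rho> c ?g ?f) / norm h"
        by (simp add: eventually_at_filter)
    qed
  qed
qed

text \<open>The function is a pointwise limit of difference quotients along
  \<open>1 / (n + 1)\<close>, each measurable in \<open>z\<close>. Exchanging the integrals over
  segment and ball will rely on this.\<close>

lemma orbit_deriv_measurable:
  fixes f g :: "'d::finite fn"
  assumes \<rho>: "bdd_op R \<rho>" and f: "f \<in> test_fn" and g: "g \<in> test_fn" and hb: "hb > 0"
  shows "(\<lambda>z. orbit_deriv hb \<rho> c (tau_adj hb z g) (tau_adj hb z f)) \<in> borel_measurable borel"
proof (rule borel_measurable_LIMSEQ_metric)
  have op: "is_operator \<rho>" using \<rho> by (simp add: bdd_op_def)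
  have fL: "f \<in> L2" and gL: "g \<in> L2" using f g test_fn_L2 by auto
  let ?T = "\<lambda>n. inverse (real (Suc n))"
  have om[measurable]: "orbit hb \<rho> g f \<in> borel_measurable borel"
    by (intro borel_measurable_continuous_onI continuous_orbit[OF \<rho> fL gL])
  show "(\<lambda>z. complex_of_real (1 / ?T n) * (orbit hb \<rho> g f (z + ?T n *\<^sub>R dir c) - orbit hb \<rho> g f z)) \<in> borel_measurable borel" for n
    by measurable
  fix z :: "(real^'d) \<times> (real^'d)"
  have eq: "orbit hb \<rho> g f (z + y) = orbit hb \<rho> (tau_adj hb z g) (tau_adj hb z f) y" for y
    by (rule orbit_add[OF op fL gL])
  have eq0: "orbit hb \<rho> g f z = orbit hb \<rho> (tau_adj hb z g) (tau_adj hb z f) 0" using eq[of 0] by simp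
  show "(\<lambda>n. complex_of_real (1 / ?T n) * (orbit hb \<rho> g f (z + ?T n *\<^sub>R dir c) - orbit hb \<rho> g f z))
    \<longlonglongrightarrow> orbit_deriv hb \<rho> c (tau_adj hb z g) (tau_adj hb z f)"
    unfolding eq eq0
    by (rule orbit_difference_quotient[OF \<rho> tau_adj_test_fn[OF f] tau_adj_test_fn[OF g] hb LIMSEQ_inverse_real_of_nat]) simp
qed

text \<open>An infinite right-hand side leaves nothing to prove. Otherwise the derivative is
  Lebesgue integrable on the interval, and its integral agrees with the gauge integral in the
  fundamental theorem of calculus, which asks for no continuity of the derivative.\<close>

lemma diff_le_nn_integral_derivative:
  fixes \<phi> :: "real \<Rightarrow> complex"
  assumes d: "\<And>t. (\<phi> has_vector_derivative \<phi>' t) (at t)" and [measurable]: "\<phi>' \<in> borel_measurable borel" and l: "l \<ge> 0"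
  shows "ennreal (cmod (\<phi> l - \<phi> 0)) \<le> (\<integral>\<^sup>+t. ennreal (cmod (\<phi>' t)) * indicator {0..l} t \<partial>lborel)"
proof (cases "(\<integral>\<^sup>+t. ennreal (cmod (\<phi>' t)) * indicator {0..l} t \<partial>lborel) = \<infinity>")
  case False
  have eq: "(\<integral>\<^sup>+t. ennreal (norm (indicat_real {0..l} t *\<^sub>R \<phi>' t)) \<partial>lborel) = (\<integral>\<^sup>+t. ennreal (cmod (\<phi>' t)) * indicator {0..l} t \<partial>lborel)"
    by (intro nn_integral_cong) (auto split: split_indicator)
  have si: "set_integrable lborel {0..l} \<phi>'"
    unfolding set_integrable_def
  proof (rule integrableI_bounded)
    show "(\<integral>\<^sup>+t. ennreal (norm (indicat_real {0..l} t *\<^sub>R \<phi>' t)) \<partial>lborel) < \<infinity>"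
      unfolding eq using False by (simp only: less_top infinity_ennreal_def not_False_eq_True)
  qed measurable
  have "(\<phi>' has_integral (\<phi> l - \<phi> 0)) {0..l}"
    using l d by (intro fundamental_theorem_of_calculus) (auto intro: has_vector_derivative_at_within)
  then have "\<phi> l - \<phi> 0 = (LINT t:{0..l}|lborel. \<phi>' t)"
    using set_borel_integral_eq_integral(2)[OF si] by (simp add: integral_unique)
  then have "ennreal (cmod (\<phi> l - \<phi> 0)) = ennreal (norm (\<integral>t. indicat_real {0..l} t *\<^sub>R \<phi>' t \<partial>lborel))"
    by (simp add: set_lebesgue_integral_def)
  also have "\<dots> \<le> (\<integral>\<^sup>+t. ennreal (norm (indicat_real {0..l} t *\<^sub>R \<phi>' t)) \<partial>lborel)"
    by (rule integral_norm_bound_ennreal[OF si[unfolded set_integrable_def]])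
  finally show ?thesis by (simp only: eq)
qed simp

lemma l2inner_op_sum:
  assumes op: "is_operator \<rho>" and L: "\<And>i. i \<in> A \<Longrightarrow> f i \<in> L2" and h: "h \<in> L2" and A: "finite A" "A \<noteq> {}"
  shows "l2inner h (\<rho> (\<lambda>x. \<Sum>i\<in>A. f i x)) = (\<Sum>i\<in>A. l2inner h (\<rho> (f i)))"
  using A L
proof (induction rule: finite_ne_induct)
  case (insert i A)
  then show ?case
    using l2inner_op_add[OF op insert.prems[of i] L2_sum[of A f] h] by simp
qed simp

text \<open>The orbit moves \<open>\<rho>\<close> forward, so its derivative is minus the
  directional commutator; under a modulus the sign disappears. Weighting copies of \<open>g\<close>
  by \<open>c\<close> contracts the quantum gradient to the direction \<open>dir c\<close>.\<close>

lemma orbit_deriv_eq_grad_form: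
  fixes f g :: "'d::finite fn"
  assumes op: "is_operator \<rho>" and f: "f \<in> test_fn" and g: "g \<in> test_fn"
  shows "orbit_deriv hb \<rho> c g f = - grad_form hb \<rho> (\<lambda>k x. complex_of_real (c k) * g x) f"
proof -
  have fL: "f \<in> L2" and gL: "g \<in> L2" using f g test_fn_L2 by auto
  note \<rho>L = is_operator_L2[OF op fL]
  let ?x = "\<lambda>h j x. complex_of_real (x $ j) * h x"
  let ?k = "\<lambda>j. - \<i> * complex_of_real (c (j, True) / hb)"
  have 1: "l2inner (gen hb c g) (\<rho> f) = (\<Sum>j\<in>UNIV. complex_of_real (c (j, False)) * l2inner (partial j g) (\<rho> f))
    + (\<Sum>j\<in>UNIV. cnj (?k j) * l2inner (?x g j) (\<rho> f))"
    unfolding gen_def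
    by (simp only: l2inner_add_left[OF \<rho>L L2_sum[OF L2_scale[OF test_fn_partial_L2[OF g]]] L2_sum[OF L2_scale[OF test_fn_coord_L2[OF g]]]]
      l2inner_sum_left[OF \<rho>L L2_scale[OF test_fn_partial_L2[OF g]]] l2inner_sum_left[OF \<rho>L L2_scale[OF test_fn_coord_L2[OF g]]]
      l2inner_scale_left complex_cnj_complex_of_real)
  have 2: "l2inner g (\<rho> (gen hb c f)) = (\<Sum>j\<in>UNIV. complex_of_real (c (j, False)) * l2inner g (\<rho> (partial j f)))
    + (\<Sum>j\<in>UNIV. ?k j * l2inner g (\<rho> (?x f j)))"
  proof -
    have "l2inner g (\<rho> (gen hb c f)) = l2inner g (\<rho> (\<lambda>x. \<Sum>j\<in>UNIV. complex_of_real (c (j, False)) * partial j f x))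
      + l2inner g (\<rho> (\<lambda>x. \<Sum>j\<in>UNIV. ?k j * ?x f j x))"
      unfolding gen_def[abs_def]
      by (rule l2inner_op_add[OF op L2_sum[OF L2_scale[OF test_fn_partial_L2[OF f]]] L2_sum[OF L2_scale[OF test_fn_coord_L2[OF f]]] gL])
    also have "l2inner g (\<rho> (\<lambda>x. \<Sum>j\<in>UNIV. complex_of_real (c (j, False)) * partial j f x))
      = (\<Sum>j\<in>UNIV. l2inner g (\<rho> (\<lambda>x. complex_of_real (c (j, False)) * partial j f x)))"
      by (rule l2inner_op_sum[OF op L2_scale[OF test_fn_partial_L2[OF f]] gL]) auto
    also have "l2inner g (\<rho> (\<lambda>x. \<Sum>j\<in>UNIV. ?k j * ?x f j x)) = (\<Sum>j\<in>UNIV. l2inner g (\<rho> (\<lambda>x. ?k j * ?x f j x)))"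
      by (rule l2inner_op_sum[OF op L2_scale[OF test_fn_coord_L2[OF f]] gL]) auto
    finally show ?thesis
      by (simp only: l2inner_op_scale[OF op test_fn_partial_L2[OF f] gL] l2inner_op_scale[OF op test_fn_coord_L2[OF f] gL])
  qed
  have 3: "(\<lambda>x. complex_of_real (x $ j) * (complex_of_real a * g x)) = (\<lambda>x. complex_of_real a * ?x g j x)" for a j
    by (simp add: mult.left_commute)
  have 4: "grad_form hb \<rho> (\<lambda>k x. complex_of_real (c k) * g x) f =
    (\<Sum>j\<in>UNIV. - (complex_of_real (c (j, False)) * l2inner (partial j g) (\<rho> f)) - complex_of_real (c (j, False)) * l2inner g (\<rho> (partial j f)))
    + (\<Sum>j\<in>UNIV. (complex_of_real (c (j, True)) * l2inner (?x g j) (\<rho> f) - complex_of_real (c (j, True)) * l2inner g (\<rho> (?x f j))) / (\<i> * complex_of_real hb))"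
    unfolding grad_form_def 3
    by (simp only: partial_scale[OF g] l2inner_scale_left complex_cnj_complex_of_real)
  have 5: "- ((complex_of_real a * X - complex_of_real a * Y) / (\<i> * complex_of_real hb))
    = cnj (- \<i> * complex_of_real (a / hb)) * X + (- \<i> * complex_of_real (a / hb)) * Y" for a X Y
    by (simp add: divide_inverse algebra_simps)
  show ?thesis
    unfolding orbit_deriv_def 1 2 4 minus_add_distrib sum_negf[symmetric] 5 sum.distrib minus_diff_eq
    by (simp add: sum.distrib sum_subtractf algebra_simps)
qed

text \<open>The increment is at most the integral of the derivative along a segment of length
  \<open>norm y\<close>. After the integrals are exchanged, each time contributes the weak-type
  bound on a translate of the ball, the same at all times.\<close>

lemma gradient_difference_bound:
  fixes \<rho> :: "'d::finite fn \<Rightarrow> 'd fn" and p hb S :: real and y :: "(real^'d) \<times> (real^'d)"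
  assumes p: "p > 2" and hb: "hb > 0" and \<rho>: "bdd_op R \<rho>" and S: "S > 0"
    and tr: "trace_pow (UNIV :: ('d \<times> bool) set) test_fn (grad_form hb \<rho>) p \<le> ennreal (S powr p)"
    and f: "f \<in> test_fn" "l2norm f \<le> 1" and g: "g \<in> test_fn" "l2norm g \<le> 1" and r: "r > 0"
  shows "ball_diff (orbit hb \<rho> g f) a r y
    \<le> ennreal (ball_wt p (2 * real CARD('d)) (planck hb ^ CARD('d)) * r powr (2 * real CARD('d) * (1 - 1 / p)) * S * norm y)"
proof (cases "y = 0")
  case True
  then show ?thesis by simp
next
  case False
  define \<kappa> where "\<kappa> = ball_wt p (2 * real CARD('d)) (planck hb ^ CARD('d)) * r powr (2 * real CARD('d) * (1 - 1 / p)) * S"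
  have op: "is_operator \<rho>" using \<rho> by (simp add: bdd_op_def)
  define l where "l = norm y"
  have l: "l > 0" using False by (simp add: l_def)
  \<comment> \<open>Coordinates of the unit vector in the direction of \<open>y\<close>: their
    squares sum to 1, as the contraction of the gradient column requires.\<close>
  define c :: "'d \<times> bool \<Rightarrow> real" where "c k = (if snd k then snd y $ fst k else fst y $ fst k) / l" for k
  have dir: "l *\<^sub>R dir c = y"
    using l by (auto simp: dir_def c_def vec_eq_iff prod_eq_iff)
  have c_le: "(\<Sum>k\<in>UNIV. (c k)\<^sup>2) \<le> 1"
  proof -
    have "(\<Sum>k\<in>UNIV. (c k)\<^sup>2) = (\<Sum>j\<in>UNIV. \<Sum>b\<in>UNIV. (c (j, b))\<^sup>2)"
      by (simp add: sum.cartesian_product flip: UNIV_Times_UNIV)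
    also have "\<dots> = (\<Sum>j\<in>UNIV. (fst y $ j)\<^sup>2 / l\<^sup>2 + (snd y $ j)\<^sup>2 / l\<^sup>2)"
      by (simp add: UNIV_bool c_def power_divide)
    also have "\<dots> = ((norm (fst y))\<^sup>2 + (norm (snd y))\<^sup>2) / l\<^sup>2"
    proof -
      have "(norm x)\<^sup>2 = (\<Sum>j\<in>UNIV. (x $ j)\<^sup>2)" for x :: "real^'d"
        unfolding power2_norm_eq_inner inner_vec_def by (simp add: power2_eq_square)
      then show ?thesis by (simp only: sum.distrib add_divide_distrib sum_divide_distrib)
    qed
    also have "(norm (fst y))\<^sup>2 + (norm (snd y))\<^sup>2 = l\<^sup>2"
      by (simp add: l_def norm_prod_def)
    finally show ?thesis using l by simp
  qed
  define D where "D z = orbit_deriv hb \<rho> c (tau_adj hb z g) (tau_adj hb z f)" for z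
  have Dm[measurable]: "D \<in> borel_measurable borel"
    unfolding D_def by (rule orbit_deriv_measurable[OF \<rho> f(1) g(1) hb])
  have [measurable]: "cball x \<rho> \<in> sets borel" for x :: "(real^'d) \<times> (real^'d)" and \<rho> by simp
  have pw: "ennreal (cmod (orbit hb \<rho> g f (z + y) - orbit hb \<rho> g f z))
    \<le> (\<integral>\<^sup>+t. ennreal (cmod (D (z + t *\<^sub>R dir c))) * indicator {0..l} t \<partial>lborel)" for z
  proof -
    have m: "(\<lambda>t. D (z + t *\<^sub>R dir c)) \<in> borel_measurable borel" by measurable
    have d: "((\<lambda>t. orbit hb \<rho> g f (z + t *\<^sub>R dir c)) has_vector_derivative D (z + t *\<^sub>R dir c)) (at t)" for t
      unfolding D_def by (rule orbit_has_derivative[OF \<rho> f(1) g(1) hb])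
    show ?thesis
      using diff_le_nn_integral_derivative[OF d m less_imp_le[OF l]] by (simp add: dir)
  qed
  have ball: "(\<integral>\<^sup>+z. ennreal (cmod (D (z + e))) * indicator (cball a r) z \<partial>lborel) \<le> ennreal \<kappa>" for e
  proof -
    have "(\<lambda>z. ennreal (cmod (D z)) * indicator (cball (a + e) r) z) \<in> borel_measurable borel" by measurable
    from nn_integral_translate[OF this, of e]
    have "(\<integral>\<^sup>+z. ennreal (cmod (D (z + e))) * indicator (cball (a + e) r) (z + e) \<partial>lborel)
      = (\<integral>\<^sup>+z. ennreal (cmod (D z)) * indicator (cball (a + e) r) z \<partial>lborel)" .
    moreover have "indicator (cball (a + e) r) (z + e) = (indicator (cball a r) z :: ennreal)" for z
      by (simp add: indicator_def dist_norm)
    moreover have "(\<integral>\<^sup>+z. ennreal (cmod (D z)) * indicator (cball (a + e) r) z \<partial>lborel) \<le> ennreal \<kappa>"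
      unfolding D_def orbit_deriv_eq_grad_form[OF op tau_adj_test_fn[OF f(1)] tau_adj_test_fn[OF g(1)]] norm_minus_cancel \<kappa>_def
      by (rule weak_type_ball[OF p S hb _ dense_L2_test_fn tau_adj_test_fn test_fn_scale tr c_le f g r]) simp
    ultimately show ?thesis by simp
  qed
  have "ball_diff (orbit hb \<rho> g f) a r y
    \<le> (\<integral>\<^sup>+z. (\<integral>\<^sup>+t. ennreal (cmod (D (z + t *\<^sub>R dir c))) * indicator {0..l} t * indicator (cball a r) z \<partial>lborel) \<partial>lborel)"
  proof (rule nn_integral_mono)
    fix z :: "(real^'d) \<times> (real^'d)"
    have "(\<integral>\<^sup>+t. ennreal (cmod (D (z + t *\<^sub>R dir c))) * indicator {0..l} t * indicator (cball a r) z \<partial>lborel)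
      = (\<integral>\<^sup>+t. ennreal (cmod (D (z + t *\<^sub>R dir c))) * indicator {0..l} t \<partial>lborel) * indicator (cball a r) z"
      by (rule nn_integral_multc) measurable
    then show "ennreal (cmod (orbit hb \<rho> g f (z + y) - orbit hb \<rho> g f z)) * indicator (cball a r) z
      \<le> (\<integral>\<^sup>+t. ennreal (cmod (D (z + t *\<^sub>R dir c))) * indicator {0..l} t * indicator (cball a r) z \<partial>lborel)"
      using mult_right_mono[OF pw[of z], of "indicator (cball a r) z"] by simp
  qed
  also have "\<dots> = (\<integral>\<^sup>+t. (\<integral>\<^sup>+z. ennreal (cmod (D (z + t *\<^sub>R dir c))) * indicator {0..l} t * indicator (cball a r) z \<partial>lborel) \<partial>lborel)"
    by (rule lborel_pair.Fubini') measurable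
  also have "\<dots> \<le> (\<integral>\<^sup>+t. ennreal \<kappa> * indicator {0..l} t \<partial>lborel)"
  proof (rule nn_integral_mono)
    fix t :: real
    show "(\<integral>\<^sup>+z. ennreal (cmod (D (z + t *\<^sub>R dir c))) * indicator {0..l} t * indicator (cball a r) z \<partial>lborel) \<le> ennreal \<kappa> * indicator {0..l} t"
      using ball[of "t *\<^sub>R dir c"] by (cases "t \<in> {0..l}") auto
  qed
  also have "\<dots> = ennreal \<kappa> * ennreal l" using l by (simp add: nn_integral_cmult_indicator)
  also have "\<dots> = ennreal (\<kappa> * l)" using l by (subst ennreal_mult'') auto
  finally show ?thesis by (simp only: \<kappa>_def l_def)
qed

lemma gradient_embedding:
  fixes \<theta> p :: real
  assumes \<theta>: "0 < \<theta>" and p: "p > 2" and eq: "\<theta> = 1 - 2 * real CARD('d::finite) / p"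
  shows "\<exists>C::real. \<forall>hb>0. \<forall>\<rho> :: 'd fn \<Rightarrow> 'd fn. compact_op \<rho> \<longrightarrow> W_inf hb \<theta> \<rho> \<le> ennreal C * W_sp hb 1 p \<rho>"
proof -
  obtain C where C: "C > 0"
    and hold: "\<And>hb R (\<rho> :: 'd fn \<Rightarrow> 'd fn) D K. bdd_op R \<rho> \<Longrightarrow> dense_L2 D \<Longrightarrow> K > 0 \<Longrightarrow>
      (\<And>f g a r. f \<in> D \<Longrightarrow> g \<in> D \<Longrightarrow> l2norm f \<le> 1 \<Longrightarrow> l2norm g \<le> 1 \<Longrightarrow> r > 0 \<Longrightarrow>
        mean_diff (orbit hb \<rho> g f) a r
          \<le> ennreal (K * r powr (4 * real CARD('d) + \<theta>))) \<Longrightarrow>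
      W_inf hb \<theta> \<rho> \<le> ennreal (C * K)"
    using holder_constant[OF \<theta>, where 'd = 'd] by blast
  define n where "n = 2 * real CARD('d)"
  define v where "v = unit_ball_vol n"
  \<comment> \<open>The factors \<open>2\<close> and \<open>2 powr n\<close> both come from the
    radius \<open>2 * r\<close> of the shifts, through the bound on \<open>norm y\<close> and
    through the volume.\<close>
  define K where "K = ball_wt p n 1 * (2 * v * 2 powr n)"
  have v: "v > 0" by (simp add: v_def n_def)
  have K: "K > 0"
    unfolding K_def using v by (intro mult_pos_pos ball_wt_pos p) (auto simp: n_def)
  show ?thesis
  proof (intro exI[of _ "C * K"] allI impI)
    fix hb :: real and \<rho> :: "'d fn \<Rightarrow> 'd fn" assume hb: "0 < hb" and "compact_op \<rho>"
    then obtain R where \<rho>: "bdd_op R \<rho>" using compact_op_bounded by blast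
    define H where "H = planck hb ^ CARD('d)"
    have planck: "planck hb > 0" using hb by (simp add: planck_def)
    have H: "H > 0" using planck by (simp add: H_def)
    have Hp: "planck hb powr (real CARD('d) / p) = H powr (1 / p)"
      using planck by (simp add: H_def powr_powr flip: powr_realpow)
    show "W_inf hb \<theta> \<rho> \<le> ennreal (C * K) * W_sp hb 1 p \<rho>"
    proof (rule ennreal_bound_from_real_bounds)
      fix w assume w: "w > 0" and W: "W_sp hb 1 p \<rho> \<le> ennreal w"
      let ?TP = "trace_pow (UNIV :: ('d \<times> bool) set) test_fn (grad_form hb \<rho>) p"
      \<comment> \<open>Dividing by \<open>H powr (1 / p)\<close> removes the semiclassical factor
        of the norm; the same power of \<open>H\<close> in \<open>ball_wt\<close> compensates it, so
        \<open>hb\<close> cancels.\<close>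
      define S where "S = w / H powr (1 / p)"
      have S: "S > 0" using w H by (simp add: S_def)
      have "ennreal (H powr (1 / p)) * ennpowr ?TP (1 / p) \<le> ennreal w"
        using W by (simp add: W_sp_def Hp)
      then have "ennreal (1 / H powr (1 / p)) * (ennreal (H powr (1 / p)) * ennpowr ?TP (1 / p))
        \<le> ennreal (1 / H powr (1 / p)) * ennreal w"
        by (rule mult_left_mono) simp
      moreover have "ennreal (1 / H powr (1 / p)) * (ennreal (H powr (1 / p)) * ennpowr ?TP (1 / p)) = ennpowr ?TP (1 / p)"
        using H by (simp add: mult.assoc[symmetric] ennreal_mult[symmetric])
      moreover have "ennreal (1 / H powr (1 / p)) * ennreal w = ennreal S"
        using H w by (simp add: S_def ennreal_mult[symmetric])
      ultimately have "ennpowr ?TP (1 / p) \<le> ennreal S" by (simp only:)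
      then have tr: "?TP \<le> ennreal (S powr p)" using p S by (intro ennpowr_le_imp) auto
      have "W_inf hb \<theta> \<rho> \<le> ennreal (C * (K * w))"
      proof (rule hold[OF \<rho> dense_L2_test_fn])
        fix f g :: "'d fn" and a :: "(real^'d) \<times> (real^'d)" and r :: real
        assume fg: "f \<in> test_fn" "g \<in> test_fn" "l2norm f \<le> 1" "l2norm g \<le> 1" and r: "r > 0"
        define \<kappa> where "\<kappa> = ball_wt p n H * r powr (n * (1 - 1 / p)) * S"
        have \<kappa>: "\<kappa> > 0" unfolding \<kappa>_def using ball_wt_pos[OF p H, of n] r S by (simp add: n_def)
        have vol: "emeasure lborel (cball (0 :: (real^'d) \<times> (real^'d)) (2 * r)) = ennreal (v * (2 * r) powr n)"
          unfolding v_def n_def using r by (intro emeasure_cball_phase) simp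
        have "mean_diff (orbit hb \<rho> g f) a r
          \<le> (\<integral>\<^sup>+y. ennreal (\<kappa> * (2 * r)) * indicator (cball (0 :: (real^'d) \<times> (real^'d)) (2 * r)) y \<partial>lborel)"
        proof (rule nn_integral_mono)
          fix y :: "(real^'d) \<times> (real^'d)"
          show "ball_diff (orbit hb \<rho> g f) a r y * indicator (cball 0 (2 * r)) y
            \<le> ennreal (\<kappa> * (2 * r)) * indicator (cball 0 (2 * r)) y"
          proof (cases "y \<in> cball 0 (2 * r)")
            case True
            have "ball_diff (orbit hb \<rho> g f) a r y \<le> ennreal (\<kappa> * norm y)"
              unfolding \<kappa>_def n_def H_def
              by (rule gradient_difference_bound[OF p hb \<rho> S tr fg(1,3,2,4) r])
            also have "\<dots> \<le> ennreal (\<kappa> * (2 * r))"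
              using True \<kappa> by (intro ennreal_leI mult_left_mono) auto
            finally show ?thesis using True by simp
          qed simp
        qed
        also have "\<dots> = ennreal (\<kappa> * (2 * r)) * ennreal (v * (2 * r) powr n)"
          by (simp add: nn_integral_cmult_indicator vol)
        also have "\<dots> = ennreal (\<kappa> * (2 * r) * (v * (2 * r) powr n))"
          using \<kappa> r v by (intro ennreal_mult[symmetric]) auto
        also have "\<kappa> * (2 * r) * (v * (2 * r) powr n) = K * w * r powr (2 * n + \<theta>)"
        proof -
          have "ball_wt p n H = ball_wt p n 1 * H powr (1 / p)" by (simp add: ball_wt_def)
          then have "\<kappa> = ball_wt p n 1 * w * r powr (n * (1 - 1 / p))"
            using H by (simp add: \<kappa>_def S_def)
          moreover have "(2 * r) powr n = 2 powr n * r powr n" using r by (simp add: powr_mult)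
          moreover have "r powr (n * (1 - 1 / p)) * r * r powr n = r powr (2 * n + \<theta>)"
          proof -
            have "r powr (n * (1 - 1 / p)) * r * r powr n = r powr (n * (1 - 1 / p)) * r powr 1 * r powr n"
              using r by simp
            also have "\<dots> = r powr (n * (1 - 1 / p) + 1 + n)" by (simp only: powr_add)
            \<comment> \<open>The relation between the exponents, \<theta> = 1 - n/p, makes the
              powers of \<open>r\<close> match.\<close>
            also have "n * (1 - 1 / p) + 1 + n = 2 * n + \<theta>"
              by (simp add: eq n_def right_diff_distrib)
            finally show ?thesis .
          qed
          then have "K * w * r powr (2 * n + \<theta>) = K * w * (r powr (n * (1 - 1 / p)) * r * r powr n)" by (simp only:)
          ultimately show ?thesis by (simp only: K_def mult_ac)
        qed
        also have "2 * n + \<theta> = 4 * real CARD('d) + \<theta>" by (simp add: n_def)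
        finally show "mean_diff (orbit hb \<rho> g f) a r \<le> ennreal (K * w * r powr (4 * real CARD('d) + \<theta>))" .
      qed (use K w in simp)
      then show "W_inf hb \<theta> \<rho> \<le> ennreal (C * K * w)" by (simp only: mult.assoc)
    qed (use C K in simp)
  qed
qed

theorem mainTheorem4:
  fixes \<theta> s p :: real
  assumes "0 < \<theta>" "\<theta> \<le> s" "s \<le> 1" "1 \<le> p"
    and "1 / p = (s - \<theta>) / (2 * real CARD('d::finite))"
  shows "\<exists>C::real. \<forall>hb>0. \<forall>\<rho> :: 'd fn \<Rightarrow> 'd fn. compact_op \<rho> \<longrightarrow>
           W_inf hb \<theta> \<rho> \<le> ennreal C * W_sp hb s p \<rho>"
proof -
  define n where "n = 2 * real CARD('d)"
  have n: "n \<ge> 2" by (simp add: n_def Suc_leI)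
  have p0: "p > 0" using assms(4) by simp
  have "n / p = n * (1 / p)" by simp
  also have "\<dots> = n * ((s - \<theta>) / n)" unfolding assms(5) n_def ..
  finally have "n / p = n * ((s - \<theta>) / n)" .
  then have np: "n / p = s - \<theta>" using n by simp
  \<comment> \<open>As \<theta> is positive and \<open>s\<close> is at most 1, \<open>p\<close>
    exceeds \<open>n\<close>, hence 2: the range in which the dyadic sums of the weak-type estimate
    are governed by their last term.\<close>
  then have "n / p < 1" using assms by linarith
  then have p: "p > 2" using n p0 by (simp add: pos_divide_less_eq)
  have \<theta>: "\<theta> = s - 2 * real CARD('d) / p" using np by (simp add: n_def)
  show ?thesis
  proof (cases "s = 1")
    case True
    show ?thesis unfolding True by (rule gradient_embedding[OF assms(1) p \<theta>[unfolded True]])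
  next
    case False
    then have s: "0 < s" "s < 1" using assms by linarith+
    show ?thesis by (rule fractional_embedding[OF assms(1) s p \<theta>])
  qed
qed

end
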